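(* Let $\mathcal{A}$ be a unital $C^*$-algebra and let $F\in B^a(H_{\mathcal{A}})$. Then, with $\partial$ denoting the boundary in $Z(\mathcal{A})$, $$\partial\sigma_{ew}^{\mathcal{A}}(F)\subseteq\partial\sigma_{e\tilde a}^{\mathcal{A}}(F)\subseteq\partial\sigma_{ea}^{\mathcal{A}}(F).$$ Moreover, $\partial\sigma_{ea}^{\mathcal{A}}(F)\subseteq\partial\sigma_{e\alpha}^{\mathcal{A}}(F)$ if $K(\mathcal{A})$ satisfies the cancellation property.
   Context: $\mathcal{A}$ is a unital $C^*$-algebra with center $Z(\mathcal{A})$ (with the norm topology); $H_{\mathcal{A}}$ is the standard countably generated (right) Hilbert $\mathcal{A}$-module. $B^a(H_{\mathcal{A}})$ is the set of bounded adjointable operators on $H_{\mathcal{A}}$. For $\alpha\in Z(\mathcal{A})$, $\alpha I$ is the operator $x\mapsto x\alpha$ on $H_{\mathcal{A}}$. $\tilde\oplus$ denotes the internal direct sum of closed submodules, not necessarily orthogonal. A Hilbert module is finitely generated if it equals the $\mathcal{A}$-linear span of a finite subset. "Isomorphism" (and $\cong$) between closed submodules means a bounded bijective $\mathcal{A}$-linear map (with bounded inverse). $N_1\preceq N_2$ means that $N_1$ is isomorphic to a closed submodule of $N_2$. $K(\mathcal{A})$ is the $K_0$-group of $\mathcal{A}$; $[N]$ denotes the class in it of a finitely generated closed submodule $N$ of $H_{\mathcal{A}}$. $K(\mathcal{A})$ satisfies the cancellation property if $[N]=[M]$ implies $N\cong M$ for any two finitely generated closed submodules $M,N$ of $H_{\mathcal{A}}$.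 For $F\in B^a(H_{\mathcal{A}})$ consider decompositions $H_{\mathcal{A}}=M_1\tilde\oplus N_1\stackrel{F}{\longrightarrow}M_2\tilde\oplus N_2=H_{\mathcal{A}}$ (all four submodules closed) with respect to which $F$ has matrix $\begin{bmatrix}F_1&0\\0&F_4\end{bmatrix}$ (i.e. $F(M_1)\subseteq M_2$, $F(N_1)\subseteq N_2$, $F_1=F_{|M_1}:M_1\to M_2$, $F_4=F_{|N_1}:N_1\to N_2$) and $F_1$ is an isomorphism. Then: - $\mathcal{M}\Phi_+(H_{\mathcal{A}})$: those $F$ having such a decomposition with $N_1$ finitely generated; - $\mathcal{M}\Phi(H_{\mathcal{A}})$: those $F$ having such a decomposition with both $N_1$ and $N_2$ finitely generated (an $\mathcal{M}\Phi$-decomposition). For such $F$, $\mathrm{index}\,F=[N_1]-[N_2]\in K(\mathcal{A})$; it is known that this does not depend on the choice of $\mathcal{M}\Phi$-decomposition; - $\mathcal{M}\Phi_0(H_{\mathcal{A}})=\{F\in\mathcal{M}\Phi(H_{\mathcal{A}})\mid\mathrm{index}\,F=0\}$; - $\tilde{\mathcal{M}}\Phi_+^-(H_{\mathcal{A}})$: those $F$ having such a decomposition with $N_1,N_2$ finitely generated and $N_1\preceq N_2$; - $\mathcal{M}\Phi_+^-(H_{\mathcal{A}})=\tilde{\mathcal{M}}\Phi_+^-(H_{\mathcal{A}})\cup(\mathcal{M}\Phi_+(H_{\mathcal{A}})\setminus\mathcal{M}\Phi(H_{\mathcal{A}}))$. The spectra are the following subsets of $Z(\mathcal{A})$: - $\sigma_{ew}^{\mathcal{A}}(F)=\{\alpha\in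 Z(\mathcal{A})\mid F-\alpha I\notin\mathcal{M}\Phi_0(H_{\mathcal{A}})\}$, - $\sigma_{e\tilde a}^{\mathcal{A}}(F)=\{\alpha\in Z(\mathcal{A})\mid F-\alpha I\notin\tilde{\mathcal{M}}\Phi_+^-(H_{\mathcal{A}})\}$, - $\sigma_{ea}^{\mathcal{A}}(F)=\{\alpha\in Z(\mathcal{A})\mid F-\alpha I\notin\mathcal{M}\Phi_+^-(H_{\mathcal{A}})\}$, - $\sigma_{e\alpha}^{\mathcal{A}}(F)=\{\alpha\in Z(\mathcal{A})\mid F-\alpha I\notin\mathcal{M}\Phi_+(H_{\mathcal{A}})\}$. *)

theory Defs
  imports "HOL-Analysis.Analysis" "HOL-Library.Function_Algebras" "HOL-Algebra.Group"
begin

class cstar_algebra = real_normed_algebra_1 + banach +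
  fixes scaleC :: "complex \<Rightarrow> 'a \<Rightarrow> 'a"
    and star :: "'a \<Rightarrow> 'a"
  assumes scaleC_of_real: "scaleC (complex_of_real r) a = r *\<^sub>R a"
    and scaleC_add_right: "scaleC c (a + b) = scaleC c a + scaleC c b"
    and scaleC_add_left: "scaleC (c + d) a = scaleC c a + scaleC d a"
    and scaleC_scaleC: "scaleC c (scaleC d a) = scaleC (c * d) a"
    and scaleC_mult_left: "scaleC c a * b = scaleC c (a * b)"
    and scaleC_mult_right: "a * scaleC c b = scaleC c (a * b)"
    and norm_scaleC: "norm (scaleC c a) = cmod c * norm a"
    and star_star: "star (star a) = a"
    and star_add: "star (a + b) = star a + star b"
    and star_scaleC: "star (scaleC c a) = scaleC (cnj c) (star a)"
    and star_mult: "star (a * b) = star b * star a"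
    and cstar_identity: "norm (star a * a) = (norm a)\<^sup>2"

definition center :: "'a::cstar_algebra set" where
  "center = {a. \<forall>b. a * b = b * a}"

text \<open>
  Elements of the standard module are sequences in the algebra; addition and zero are the
  pointwise operations on functions. The module of all sequences \<open>x\<close> for which
  \<open>\<Sum>n. star (x n) * x n\<close> converges in norm is kept as a carrier set. Operators are functions on
  all sequences, of which only the restriction to this carrier matters.
\<close>

definition HA :: "(nat \<Rightarrow> 'a::cstar_algebra) set" where
  "HA = {x. summable (\<lambda>n. star (x n) * x n)}"

definition rscale :: "(nat \<Rightarrow> 'a) \<Rightarrow> 'a \<Rightarrow> (nat \<Rightarrow> 'a::cstar_algebra)" where
  "rscale x a = (\<lambda>n. x n * a)"

definition hinner :: "(nat \<Rightarrow> 'a) \<Rightarrow> (nat \<Rightarrow> 'a) \<Rightarrow> 'a::cstar_algebra" where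
  "hinner x y = (\<Sum>n. star (x n) * y n)"

definition hnorm :: "(nat \<Rightarrow> 'a::cstar_algebra) \<Rightarrow> real" where
  "hnorm x = sqrt (norm (hinner x x))"

definition HA_topology :: "(nat \<Rightarrow> 'a::cstar_algebra) topology" where
  "HA_topology = Metric_space.mtopology HA (\<lambda>x y. hnorm (x - y))"

definition closed_submodule :: "(nat \<Rightarrow> 'a::cstar_algebra) set \<Rightarrow> bool" where
  "closed_submodule M \<longleftrightarrow> M \<subseteq> HA \<and> 0 \<in> M \<and> (\<forall>x\<in>M. \<forall>y\<in>M. x + y \<in> M) \<and>
     (\<forall>x\<in>M. \<forall>a. rscale x a \<in> M) \<and> closedin HA_topology M"

definition fin_gen :: "(nat \<Rightarrow> 'a::cstar_algebra) set \<Rightarrow> bool" where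
  "fin_gen M \<longleftrightarrow> (\<exists>S. finite S \<and> S \<subseteq> M \<and> M = {\<Sum>s\<in>S. rscale s (c s) | c. True})"

definition fg_closed_submodule :: "(nat \<Rightarrow> 'a::cstar_algebra) set \<Rightarrow> bool" where
  "fg_closed_submodule M \<longleftrightarrow> closed_submodule M \<and> fin_gen M"

definition internal_direct_sum ::
  "(nat \<Rightarrow> 'a::cstar_algebra) set \<Rightarrow> (nat \<Rightarrow> 'a) set \<Rightarrow> (nat \<Rightarrow> 'a) set \<Rightarrow> bool" where
  "internal_direct_sum L M N \<longleftrightarrow> L = {x + y | x y. x \<in> M \<and> y \<in> N} \<and> M \<inter> N = {0}"

definition bounded_module_map ::
  "((nat \<Rightarrow> 'a) \<Rightarrow> (nat \<Rightarrow> 'a)) \<Rightarrow> (nat \<Rightarrow> 'a::cstar_algebra) set \<Rightarrow> (nat \<Rightarrow> 'a) set \<Rightarrow> bool" where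
  "bounded_module_map f M N \<longleftrightarrow> f ` M \<subseteq> N \<and>
     (\<forall>x\<in>M. \<forall>y\<in>M. f (x + y) = f x + f y) \<and>
     (\<forall>x\<in>M. \<forall>a. f (rscale x a) = rscale (f x) a) \<and>
     (\<exists>C. \<forall>x\<in>M. hnorm (f x) \<le> C * hnorm x)"

definition module_iso ::
  "((nat \<Rightarrow> 'a) \<Rightarrow> (nat \<Rightarrow> 'a)) \<Rightarrow> (nat \<Rightarrow> 'a::cstar_algebra) set \<Rightarrow> (nat \<Rightarrow> 'a) set \<Rightarrow> bool" where
  "module_iso f M N \<longleftrightarrow> bounded_module_map f M N \<and> bij_betw f M N \<and>
     bounded_module_map (inv_into M f) N M"

definition isomorphic_modules ::
  "(nat \<Rightarrow> 'a::cstar_algebra) set \<Rightarrow> (nat \<Rightarrow> 'a) set \<Rightarrow> bool"  (infix "\<cong>\<^sub>H" 50) where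
  "M \<cong>\<^sub>H N \<longleftrightarrow> (\<exists>f. module_iso f M N)"

definition embeds_in ::
  "(nat \<Rightarrow> 'a::cstar_algebra) set \<Rightarrow> (nat \<Rightarrow> 'a) set \<Rightarrow> bool"  (infix "\<preceq>\<^sub>H" 50) where
  "M \<preceq>\<^sub>H N \<longleftrightarrow> (\<exists>L. closed_submodule L \<and> L \<subseteq> N \<and> M \<cong>\<^sub>H L)"

definition Ba :: "((nat \<Rightarrow> 'a::cstar_algebra) \<Rightarrow> (nat \<Rightarrow> 'a)) set" where
  "Ba = {F. bounded_module_map F HA HA \<and>
     (\<exists>G. bounded_module_map G HA HA \<and> (\<forall>x\<in>HA. \<forall>y\<in>HA. hinner (F x) y = hinner x (G y)))}"

text \<open>
  The \<open>K\<^sub>0\<close>-group is the Grothendieck group of the monoid of isomorphism classes of finitely generated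
  projective modules under direct sum. Every such module is isomorphic to a finitely generated
  closed submodule of the standard module, and conversely finitely generated Hilbert modules over a
  unital algebra are projective, so these submodules represent all the isomorphism classes.
  The external direct sum is realised inside the standard module by interleaving coordinates.
\<close>

definition ext_sum ::
  "(nat \<Rightarrow> 'a::cstar_algebra) set \<Rightarrow> (nat \<Rightarrow> 'a) set \<Rightarrow> (nat \<Rightarrow> 'a) set"  (infixr "\<oplus>\<^sub>H" 65) where
  "M \<oplus>\<^sub>H N = {z. (\<lambda>n. z (2 * n)) \<in> M \<and> (\<lambda>n. z (2 * n + 1)) \<in> N}"

text \<open>\<open>K0_diff P Q\<close> is the Grothendieck class of the pair \<open>(P, Q)\<close>, that is, \<open>[P] - [Q]\<close>.\<close>

definition K0_diff ::
  "(nat \<Rightarrow> 'a::cstar_algebra) set \<Rightarrow> (nat \<Rightarrow> 'a) set \<Rightarrow> ((nat \<Rightarrow> 'a) set \<times> (nat \<Rightarrow> 'a) set) set" where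
  "K0_diff P Q = {(P', Q'). fg_closed_submodule P' \<and> fg_closed_submodule Q' \<and>
     (\<exists>R. fg_closed_submodule R \<and> P \<oplus>\<^sub>H Q' \<oplus>\<^sub>H R \<cong>\<^sub>H P' \<oplus>\<^sub>H Q \<oplus>\<^sub>H R)}"

text \<open>The group operation, written additively in the mathematics, is multiplicative in HOL-Algebra.\<close>

definition K0 :: "((nat \<Rightarrow> 'a::cstar_algebra) set \<times> (nat \<Rightarrow> 'a) set) set monoid" where
  "K0 = \<lparr>carrier = {K0_diff P Q | P Q. fg_closed_submodule P \<and> fg_closed_submodule Q},
         mult = (\<lambda>X Y. \<Union>(P, Q)\<in>X. \<Union>(P', Q')\<in>Y. K0_diff (P \<oplus>\<^sub>H P') (Q \<oplus>\<^sub>H Q')),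
         one = K0_diff {0} {0}\<rparr>"

definition K0_class ::
  "(nat \<Rightarrow> 'a::cstar_algebra) set \<Rightarrow> ((nat \<Rightarrow> 'a) set \<times> (nat \<Rightarrow> 'a) set) set" where
  "K0_class N = K0_diff N {0}"

definition K0_cancellation :: "'a::cstar_algebra itself \<Rightarrow> bool" where
  "K0_cancellation _ \<longleftrightarrow> (\<forall>M N :: (nat \<Rightarrow> 'a) set.
     fg_closed_submodule M \<and> fg_closed_submodule N \<and> K0_class N = K0_class M \<longrightarrow> N \<cong>\<^sub>H M)"

definition decomposition ::
  "((nat \<Rightarrow> 'a) \<Rightarrow> (nat \<Rightarrow> 'a::cstar_algebra)) \<Rightarrow> (nat \<Rightarrow> 'a) set \<Rightarrow> (nat \<Rightarrow> 'a) set \<Rightarrow>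
   (nat \<Rightarrow> 'a) set \<Rightarrow> (nat \<Rightarrow> 'a) set \<Rightarrow> bool" where
  "decomposition F M1 N1 M2 N2 \<longleftrightarrow>
     closed_submodule M1 \<and> closed_submodule N1 \<and> closed_submodule M2 \<and> closed_submodule N2 \<and>
     internal_direct_sum HA M1 N1 \<and> internal_direct_sum HA M2 N2 \<and>
     module_iso F M1 M2 \<and> F ` N1 \<subseteq> N2"

definition MPhi_decomposition ::
  "((nat \<Rightarrow> 'a) \<Rightarrow> (nat \<Rightarrow> 'a::cstar_algebra)) \<Rightarrow> (nat \<Rightarrow> 'a) set \<Rightarrow> (nat \<Rightarrow> 'a) set \<Rightarrow>
   (nat \<Rightarrow> 'a) set \<Rightarrow> (nat \<Rightarrow> 'a) set \<Rightarrow> bool" where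
  "MPhi_decomposition F M1 N1 M2 N2 \<longleftrightarrow> decomposition F M1 N1 M2 N2 \<and> fin_gen N1 \<and> fin_gen N2"

definition MPhi_plus :: "((nat \<Rightarrow> 'a) \<Rightarrow> (nat \<Rightarrow> 'a::cstar_algebra)) set" where
  "MPhi_plus = {F \<in> Ba. \<exists>M1 N1 M2 N2. decomposition F M1 N1 M2 N2 \<and> fin_gen N1}"

definition MPhi :: "((nat \<Rightarrow> 'a) \<Rightarrow> (nat \<Rightarrow> 'a::cstar_algebra)) set" where
  "MPhi = {F \<in> Ba. \<exists>M1 N1 M2 N2. MPhi_decomposition F M1 N1 M2 N2}"

definition index ::
  "((nat \<Rightarrow> 'a) \<Rightarrow> (nat \<Rightarrow> 'a::cstar_algebra)) \<Rightarrow> ((nat \<Rightarrow> 'a) set \<times> (nat \<Rightarrow> 'a) set) set" where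
  "index F = (THE k. \<exists>M1 N1 M2 N2. MPhi_decomposition F M1 N1 M2 N2 \<and>
     k = K0_class N1 \<otimes>\<^bsub>K0\<^esub> inv\<^bsub>K0\<^esub> K0_class N2)"

definition MPhi_0 :: "((nat \<Rightarrow> 'a) \<Rightarrow> (nat \<Rightarrow> 'a::cstar_algebra)) set" where
  "MPhi_0 = {F \<in> MPhi. index F = \<one>\<^bsub>K0\<^esub>}"

definition MPhi_tilde_plus_minus :: "((nat \<Rightarrow> 'a) \<Rightarrow> (nat \<Rightarrow> 'a::cstar_algebra)) set" where
  "MPhi_tilde_plus_minus =
     {F \<in> Ba. \<exists>M1 N1 M2 N2. MPhi_decomposition F M1 N1 M2 N2 \<and> N1 \<preceq>\<^sub>H N2}"

definition MPhi_plus_minus :: "((nat \<Rightarrow> 'a) \<Rightarrow> (nat \<Rightarrow> 'a::cstar_algebra)) set" where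
  "MPhi_plus_minus = MPhi_tilde_plus_minus \<union> (MPhi_plus - MPhi)"

definition shift_op ::
  "((nat \<Rightarrow> 'a) \<Rightarrow> (nat \<Rightarrow> 'a)) \<Rightarrow> 'a \<Rightarrow> ((nat \<Rightarrow> 'a::cstar_algebra) \<Rightarrow> (nat \<Rightarrow> 'a))" where
  "shift_op F \<alpha> = (\<lambda>x. F x - rscale x \<alpha>)"

definition sigma_ew :: "((nat \<Rightarrow> 'a) \<Rightarrow> (nat \<Rightarrow> 'a::cstar_algebra)) \<Rightarrow> 'a set" where
  "sigma_ew F = {\<alpha> \<in> center. shift_op F \<alpha> \<notin> MPhi_0}"

definition sigma_ea_tilde :: "((nat \<Rightarrow> 'a) \<Rightarrow> (nat \<Rightarrow> 'a::cstar_algebra)) \<Rightarrow> 'a set" where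
  "sigma_ea_tilde F = {\<alpha> \<in> center. shift_op F \<alpha> \<notin> MPhi_tilde_plus_minus}"

definition sigma_ea :: "((nat \<Rightarrow> 'a) \<Rightarrow> (nat \<Rightarrow> 'a::cstar_algebra)) \<Rightarrow> 'a set" where
  "sigma_ea F = {\<alpha> \<in> center. shift_op F \<alpha> \<notin> MPhi_plus_minus}"

definition sigma_e_alpha :: "((nat \<Rightarrow> 'a) \<Rightarrow> (nat \<Rightarrow> 'a::cstar_algebra)) \<Rightarrow> 'a set" where
  "sigma_e_alpha F = {\<alpha> \<in> center. shift_op F \<alpha> \<notin> MPhi_plus}"

definition boundary :: "'a::cstar_algebra set \<Rightarrow> 'a set" where
  "boundary S = top_of_set center frontier_of S"

end

theory Submission
  imports Defs
begin

text \<open>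
  The boundaries are compared in the Banach algebra \<open>B\<close> of bounded module operators on the standard
  module \<open>H\<close>. In \<open>B\<close>, a decomposition \<open>M\<^sub>1 + N\<^sub>1 \<rightarrow> M\<^sub>2 + N\<^sub>2\<close> of \<open>T\<close> is the same thing as an element \<open>G\<close> with
  \<open>GTG = G\<close>: then \<open>GT\<close> and \<open>TG\<close> are idempotents with ranges \<open>M\<^sub>1\<close>, \<open>M\<^sub>2\<close> and kernels \<open>N\<^sub>1\<close>, \<open>N\<^sub>2\<close>
  (\<open>decomposition_iff_outer_inverse\<close>; the bounded projections come from the open mapping theorem). The
  submodule \<open>N\<^sub>1\<close> is finitely generated exactly when \<open>1 - GT\<close> lies in the ideal of operators that factor
  through some \<open>\<A>\<^sup>m\<close> (\<open>fin_gen_rng_iff\<close>), and isomorphism of summands is Murray-von Neumann equivalence of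
  idempotents. So all classes of operators in question are described by \<open>G\<close> and by the classes of
  \<open>1 - GT\<close> and \<open>1 - TG\<close> in a commutative monoid.

  Three facts carry the argument. An outer inverse survives a small perturbation of \<open>T\<close> without any
  change in the two classes (\<open>outer_inverse_perturb\<close>). For two outer inverses of the same operator, the
  differences of the two classes agree stably (\<open>index_independent\<close>). The classes can be enlarged
  simultaneously by any class, because the complement of a finitely generated summand of \<open>H\<close> contains a
  copy of every summand (\<open>enlarge_outer_inverse\<close>).

  By the first fact, conditions on the two classes are open conditions. Together with the other two it
  shows that each class of operators is open and is relatively clopen in the next: the index is locally constant, so operators of index zero cannot
  accumulate at an operator of nonzero index; an operator whose kernel is but whose cokernel is not
  finitely generated is not a limit of Fredholm operators; and if Fredholm operators near \<open>T\<close> have a kernel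
  that embeds in the cokernel, then equality of the indices allows a decomposition of \<open>T\<close> to be enlarged
  to one with the same property. If \<open>A \<subseteq> B\<close> are open and \<open>B - A\<close> is open, then the boundary of \<open>A\<close> misses \<open>B\<close>
  and therefore lies in the boundary of \<open>B\<close>; applied to the complements of the spectra, this is the claim.

  The \<open>C\<^sup>*\<close>-structure enters through positivity: it makes \<open>H\<close> a Banach space, and it makes every finitely
  generated closed submodule complemented (\<open>fin_gen_projection\<close>). The theory of positive elements is
  developed from the binomial series of the square root, without spectra.
\<close>

section \<open>Positive elements of a C*-algebra\<close>

lemma star_0 [simp]: "star (0::'a::cstar_algebra) = 0"
  using star_add[of "0::'a" 0] by simp

lemma star_minus [simp]: "star (- a) = - star (a::'a::cstar_algebra)"
  using star_add[of a "- a"] by (simp add: eq_neg_iff_add_eq_0 add.commute)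

lemma star_diff: "star (a - b) = star a - star (b::'a::cstar_algebra)"
  using star_add[of a "- b"] by simp

lemma star_1 [simp]: "star (1::'a::cstar_algebra) = 1"
  by (metis mult.left_neutral star_mult star_star mult.right_neutral)

lemma star_scaleR [simp]: "star (r *\<^sub>R a) = r *\<^sub>R star (a::'a::cstar_algebra)"
  by (metis scaleC_of_real star_scaleC complex_cnj_complex_of_real)

lemma star_sum: "star (\<Sum>i\<in>I. f i) = (\<Sum>i\<in>I. star (f i :: 'a::cstar_algebra))"
  by (induction I rule: infinite_finite_induct) (auto simp: star_add)

lemma star_power: "star (a ^ n) = star (a::'a::cstar_algebra) ^ n"
  by (induction n) (auto simp: star_mult power_commutes)

lemma norm_star [simp]: "norm (star a) = norm (a::'a::cstar_algebra)"
proof -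
  have le: "norm b \<le> norm (star b)" for b :: 'a
  proof (cases "norm b = 0")
    case False
    have "norm b * norm b \<le> norm (star b) * norm b"
      using cstar_identity[of b] norm_mult_ineq[of "star b" b] by (simp add: power2_eq_square)
    then show ?thesis using False by simp
  qed simp
  from le[of a] le[of "star a"] show ?thesis by (simp add: star_star)
qed

lemma bounded_linear_star: "bounded_linear (star :: 'a::cstar_algebra \<Rightarrow> 'a)"
  by (rule bounded_linear_intro[of _ 1]) (auto simp: star_add)

lemma scaleC_i_i: "scaleC \<i> (scaleC \<i> a) = - (a::'a::cstar_algebra)"
  using scaleC_of_real[of "-1" a] by (simp add: scaleC_scaleC)

lemma scaleC_i_diff: "scaleC \<i> (a - b) = scaleC \<i> a - scaleC \<i> (b::'a::cstar_algebra)"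
  using scaleC_add_right[of \<i> "a - b" b] by (simp add: algebra_simps)

lemma star_scaleC_i: "star (scaleC \<i> a) = - scaleC \<i> (star (a::'a::cstar_algebra))"
proof -
  have "scaleC (- \<i>) (star a) + scaleC \<i> (star a) = 0"
    using scaleC_of_real[of 0 "star a"] by (simp flip: scaleC_add_left)
  then show ?thesis by (simp add: star_scaleC eq_neg_iff_add_eq_0)
qed

lemmas scaleC_i_simps = scaleC_i_i scaleC_i_diff star_scaleC_i scaleC_add_right scaleC_mult_left scaleC_mult_right

lemma norm_square_hermitian: "star h = h \<Longrightarrow> norm (h * h) = (norm (h::'a::cstar_algebra))\<^sup>2"
  using cstar_identity[of h] by simp

text \<open>The Taylor coefficients of \<open>sqrt (1 - x)\<close>.\<close>

definition sqrt_coeff :: "nat \<Rightarrow> real" where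
  "sqrt_coeff n = (-1) ^ n * ((1/2) gchoose n)"

lemma sqrt_coeff_Suc_nonpos: "sqrt_coeff (Suc n) \<le> 0"
proof (induction n)
  case 0
  then show ?case by (simp add: sqrt_coeff_def)
next
  case (Suc n)
  have "real (Suc (Suc n)) * ((1/2::real) gchoose Suc (Suc n)) = (1/2 - real (Suc n)) * ((1/2) gchoose Suc n)"
    using gbinomial_mult_1[of "1/2::real" "Suc n"] by (simp add: algebra_simps)
  then have eq: "((1/2::real) gchoose Suc (Suc n)) = (1/2 - real (Suc n)) * ((1/2) gchoose Suc n) / real (Suc (Suc n))"
    by (simp add: field_simps)
  have "sqrt_coeff (Suc (Suc n)) = ((real (Suc n) - 1/2) / real (Suc (Suc n))) * sqrt_coeff (Suc n)"
    unfolding sqrt_coeff_def eq by (simp add: field_simps)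
  moreover have "(real (Suc n) - 1/2) / real (Suc (Suc n)) \<ge> 0" by simp
  ultimately show ?case using Suc mult_nonneg_nonpos by metis
qed

text \<open>The series stays absolutely convergent on the boundary of its disc: all coefficients but the
  first have the same sign, so its partial sums there are limits of those inside, which are bounded
  by \<open>1 - sqrt (1 - x)\<close>.\<close>

lemma
  shows summable_sqrt_coeff: "summable (\<lambda>n. \<bar>sqrt_coeff n\<bar>)"
    and suminf_sqrt_coeff_Suc_le: "(\<Sum>n. \<bar>sqrt_coeff (Suc n)\<bar>) \<le> 1"
proof -
  have bound: "(\<Sum>k<n. - sqrt_coeff (Suc k)) \<le> 1" for n
  proof -
    have *: "(\<Sum>k<n. - sqrt_coeff (Suc k) * x ^ Suc k) \<le> 1" if x: "0 < x" "x < 1" for x :: real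
    proof -
      have "(\<lambda>n. ((1/2) gchoose n) * (- x) ^ n) sums (1 + - x) powr (1/2)"
        by (rule gen_binomial_real) (use x in auto)
      moreover have "((1/2) gchoose n) * (- x) ^ n = sqrt_coeff n * x ^ n" for n
        by (simp add: sqrt_coeff_def power_minus[of x])
      ultimately have "(\<lambda>n. sqrt_coeff n * x ^ n) sums (1 - x) powr (1/2)" by simp
      then have "(\<lambda>n. sqrt_coeff (Suc n) * x ^ Suc n) sums ((1 - x) powr (1/2) - 1)"
        by (subst sums_Suc_iff) (simp add: sqrt_coeff_def)
      then have s: "(\<lambda>n. - sqrt_coeff (Suc n) * x ^ Suc n) sums (1 - (1 - x) powr (1/2))"
        using sums_minus by fastforce
      have "(\<Sum>k<n. - sqrt_coeff (Suc k) * x ^ Suc k) \<le> (\<Sum>k. - sqrt_coeff (Suc k) * x ^ Suc k)"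
        by (rule sum_le_suminf[OF sums_summable[OF s]])
           (use x sqrt_coeff_Suc_nonpos in \<open>auto intro!: mult_nonpos_nonneg\<close>)
      also have "\<dots> = 1 - (1 - x) powr (1/2)" using s by (simp add: sums_iff)
      also have "\<dots> \<le> 1" by simp
      finally show ?thesis .
    qed
    have lim: "((\<lambda>x. \<Sum>k<n. - sqrt_coeff (Suc k) * x ^ Suc k) \<longlongrightarrow> (\<Sum>k<n. - sqrt_coeff (Suc k) * 1 ^ Suc k)) (at_left 1)"
      by (intro tendsto_intros)
    have ev: "\<forall>\<^sub>F x in at_left (1::real). (\<Sum>k<n. - sqrt_coeff (Suc k) * x ^ Suc k) \<le> 1"
      by (rule eventually_mono[OF eventually_at_left_real[of 0 1]]) (use * in auto)
    show ?thesis using tendsto_upperbound[OF lim ev] by simp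
  qed
  have abs: "\<bar>sqrt_coeff (Suc n)\<bar> = - sqrt_coeff (Suc n)" for n
    using sqrt_coeff_Suc_nonpos[of n] by simp
  have s: "summable (\<lambda>n. \<bar>sqrt_coeff (Suc n)\<bar>)"
    unfolding abs by (rule summableI_nonneg_bounded[of _ 1]) (use bound sqrt_coeff_Suc_nonpos in auto)
  then show "summable (\<lambda>n. \<bar>sqrt_coeff n\<bar>)" by (subst (asm) summable_Suc_iff)
  show "(\<Sum>n. \<bar>sqrt_coeff (Suc n)\<bar>) \<le> 1"
    by (rule suminf_le_const[OF s]) (use bound in \<open>simp only: abs\<close>)
qed

text \<open>Vandermonde's convolution, saying that the series squares to \<open>1 - x\<close>.\<close>

lemma sqrt_coeff_convolution:
  "(\<Sum>i\<le>k. sqrt_coeff i * sqrt_coeff (k - i)) = (if k = 0 then 1 else if k = 1 then -1 else 0)"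
proof -
  have "(\<Sum>i\<le>k. sqrt_coeff i * sqrt_coeff (k - i)) =
      (\<Sum>i\<in>{0..k}. (-1) ^ k * (((1/2) gchoose i) * ((1/2) gchoose (k - i))))"
    by (rule sum.cong) (auto simp: sqrt_coeff_def atLeast0AtMost simp flip: power_add)
  also have "\<dots> = (-1) ^ k * ((1/2 + 1/2 :: real) gchoose k)"
    by (simp only: sum_distrib_left[symmetric] gbinomial_Vandermonde)
  also have "\<dots> = (-1) ^ k * real (1 choose k)"
    using binomial_gbinomial[of 1 k, where ?'a = real] by simp
  also have "\<dots> = (if k = 0 then 1 else if k = 1 then -1 else 0)"
    by (cases k rule: nat.exhaust; simp) 
  finally show ?thesis .
qed

text \<open>The root is the binomial series in \<open>1 - a\<close>; being a limit of polynomials in \<open>a\<close>, it is hermitian and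
  commutes with everything that commutes with \<open>a\<close>. It lies within distance \<open>1\<close> of \<open>1\<close> because the
  coefficients after the first have absolute sum at most \<open>1\<close>; this bound gives the root itself a
  hermitian root, so that it is positive.\<close>

lemma hermitian_sqrt_unit:
  fixes a :: "'a::cstar_algebra"
  assumes "star a = a" "norm (1 - a) \<le> 1"
  obtains h where "star h = h" "norm (1 - h) \<le> 1" "h * h = a" "\<And>b. a * b = b * a \<Longrightarrow> h * b = b * h"
proof -
  define x where "x = 1 - a"
  define f where "f n = sqrt_coeff n *\<^sub>R x ^ n" for n
  define h where "h = (\<Sum>n. f n)"
  have pw: "norm (x ^ n) \<le> 1" for n
    using norm_power_ineq[of x n] power_le_one[of "norm x" n] assms(2) by (simp add: x_def)
  have sn: "summable (\<lambda>n. norm (f n))"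
    by (rule summable_comparison_test'[OF summable_sqrt_coeff, of 0])
       (use pw in \<open>auto simp: f_def mult_left_le\<close>)
  then have s: "summable f" by (rule summable_norm_cancel)
  have sf: "star (f n) = f n" for n
    using assms(1) by (simp add: f_def star_power x_def star_diff)
  have "star h = (\<Sum>n. star (f n))"
    unfolding h_def by (rule bounded_linear.suminf[OF bounded_linear_star s])
  then have 1: "star h = h" by (simp add: h_def sf)
  have "(\<lambda>k. \<Sum>i\<le>k. f i * f (k - i)) sums (h * h)"
    unfolding h_def by (rule Cauchy_product_sums[OF sn sn])
  moreover have "(\<Sum>i\<le>k. f i * f (k - i)) = (\<Sum>i\<le>k. sqrt_coeff i * sqrt_coeff (k - i)) *\<^sub>R x ^ k" for k
    unfolding scaleR_sum_left by (rule sum.cong) (auto simp: f_def simp flip: power_add)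
  ultimately have "(\<lambda>k. (if k = 0 then 1 else if k = 1 then -1 else 0) *\<^sub>R x ^ k) sums (h * h)"
    by (simp add: sqrt_coeff_convolution)
  moreover have "(\<lambda>k. (if k = 0 then 1 else if k = 1 then -1 else 0::real) *\<^sub>R x ^ k) sums
      (\<Sum>k\<in>{0,1}. (if k = 0 then 1 else if k = 1 then -1 else 0::real) *\<^sub>R x ^ k)"
    by (rule sums_finite) auto
  ultimately have 2: "h * h = a" by (auto dest: sums_unique2 simp: x_def)
  have 3: "h * b = b * h" if "a * b = b * a" for b
  proof -
    have c: "x * b = b * x" using that by (simp add: x_def algebra_simps)
    have c': "x ^ n * b = b * x ^ n" for n
      using c by (rule power_commuting_commutes)
    have "h * b = (\<Sum>n. f n * b)" unfolding h_def by (rule suminf_mult2[OF s])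
    also have "\<dots> = (\<Sum>n. b * f n)" by (simp add: f_def c')
    also have "\<dots> = b * h" unfolding h_def by (rule suminf_mult[OF s])
    finally show ?thesis .
  qed
  have "f sums h" using s by (simp add: h_def summable_sums)
  then have "(\<lambda>n. f (Suc n)) sums (h - f 0)" by (simp add: sums_Suc_iff)
  then have h1: "h - 1 = (\<Sum>n. f (Suc n))" by (simp add: f_def sqrt_coeff_def sums_iff)
  have s': "summable (\<lambda>n. norm (f (Suc n)))" using sn by (subst summable_Suc_iff)
  have "norm (h - 1) \<le> (\<Sum>n. norm (f (Suc n)))" unfolding h1 by (rule summable_norm[OF s'])
  also have "\<dots> \<le> (\<Sum>n. \<bar>sqrt_coeff (Suc n)\<bar>)"
  proof (rule suminf_le[OF _ s'])
    show "norm (f (Suc n)) \<le> \<bar>sqrt_coeff (Suc n)\<bar>" for n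
      using pw[of "Suc n"] by (simp add: f_def mult_left_le del: power_Suc)
    show "summable (\<lambda>n. \<bar>sqrt_coeff (Suc n)\<bar>)" using summable_sqrt_coeff by (subst summable_Suc_iff)
  qed
  also have "\<dots> \<le> 1" by (rule suminf_sqrt_coeff_Suc_le)
  finally have 4: "norm (1 - h) \<le> 1" by (simp add: norm_minus_commute)
  show thesis by (rule that[OF 1 4 2 3])
qed

lemma hermitian_sqrt:
  fixes a :: "'a::cstar_algebra"
  assumes "star a = a" "norm (t *\<^sub>R 1 - a) \<le> t"
  obtains h where "star h = h" "norm (sqrt t *\<^sub>R 1 - h) \<le> sqrt t" "h * h = a"
    "\<And>b. a * b = b * a \<Longrightarrow> h * b = b * h"
proof (cases "t = 0")
  case True
  then have "a = 0" using assms by simp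
  then show ?thesis using that[of 0] True by simp
next
  case False
  then have t: "t > 0" using assms(2) norm_ge_zero[of "t *\<^sub>R 1 - a"] by linarith
  have "norm (1 - (1/t) *\<^sub>R a) = norm ((1/t) *\<^sub>R (t *\<^sub>R 1 - a))" using t by (simp add: algebra_simps)
  also have "\<dots> \<le> 1" using t assms(2) by simp
  finally have n: "norm (1 - (1/t) *\<^sub>R a) \<le> 1" .
  have "star ((1/t) *\<^sub>R a) = (1/t) *\<^sub>R a" using assms(1) by simp
  from hermitian_sqrt_unit[OF this n]
  obtain h where h: "star h = h" "norm (1 - h) \<le> 1" "h * h = (1/t) *\<^sub>R a"
      "\<And>b. ((1/t) *\<^sub>R a) * b = b * ((1/t) *\<^sub>R a) \<Longrightarrow> h * b = b * h" by blast
  have "sqrt t *\<^sub>R 1 - sqrt t *\<^sub>R h = sqrt t *\<^sub>R (1 - h)" by (simp add: algebra_simps)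
  then have "norm (sqrt t *\<^sub>R 1 - sqrt t *\<^sub>R h) \<le> sqrt t" using h(2) t by (simp add: mult_left_le)
  moreover have "star (sqrt t *\<^sub>R h) = sqrt t *\<^sub>R h" using h(1) by simp
  moreover have "(sqrt t *\<^sub>R h) * (sqrt t *\<^sub>R h) = a" using h(3) t by simp
  moreover have "(sqrt t *\<^sub>R h) * b = b * (sqrt t *\<^sub>R h)" if "a * b = b * a" for b
    using h(4)[of b] that by simp
  ultimately show ?thesis using that by blast
qed

text \<open>By \<open>posI\<close> and \<open>pos_norm_le\<close>, a hermitian \<open>a\<close> is positive iff \<open>\<bar>t - a\<bar> \<le> t\<close> for some, equivalently every,
  \<open>t \<ge> \<bar>a\<bar>\<close> (bars denote norms); in this form the cone is visibly convex and closed.\<close>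

definition pos :: "'a::cstar_algebra \<Rightarrow> bool" where
  "pos a \<longleftrightarrow> (\<exists>h. star h = h \<and> a = h * h)"

lemma posE:
  assumes "pos a" obtains h where "star h = h" "a = h * h"
  using assms by (auto simp: pos_def)

lemma pos_hermitian: "pos a \<Longrightarrow> star a = a"
  by (auto simp: pos_def star_mult)

lemma posI: "star a = a \<Longrightarrow> norm (t *\<^sub>R 1 - a) \<le> t \<Longrightarrow> pos a"
  by (metis hermitian_sqrt pos_def)

text \<open>With \<open>g\<close> a square root of \<open>1 - h\<^sup>2\<close>, the element \<open>h + \<i>g\<close> is unitary and \<open>h\<close>, \<open>g\<close> are its real
  and imaginary part; hence both are contractions.\<close>

lemma norm_le_1_if_squares_sum_1:
  fixes h g :: "'a::cstar_algebra"
  assumes "star h = h" "star g = g" "h * g = g * h" "h * h + g * g = 1"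
  shows "norm h \<le> 1" "norm g \<le> 1"
proof -
  define u where "u = h + scaleC \<i> g"
  have su: "star u = h - scaleC \<i> g" using assms by (simp add: u_def star_add star_scaleC_i)
  have "star u * u = h * h + g * g"
    unfolding su unfolding u_def by (simp add: algebra_simps scaleC_i_simps assms(3))
  then have "(norm u)\<^sup>2 = 1" using cstar_identity[of u] assms(4) by simp
  then have nu: "norm u = 1" by (simp add: power2_eq_1_iff) (metis norm_ge_zero neg_0_le_iff_le not_one_le_zero)
  have "norm (u + star u) \<le> 2" using norm_triangle_ineq[of u "star u"] nu by simp
  moreover have "u + star u = 2 *\<^sub>R h" unfolding su by (simp add: u_def scaleR_2)
  ultimately show "norm h \<le> 1" by simp
  have "norm (u - star u) \<le> 2" using norm_triangle_ineq4[of u "star u"] nu by simp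
  moreover have "u - star u = 2 *\<^sub>R scaleC \<i> g" unfolding su by (simp add: u_def scaleR_2)
  ultimately show "norm g \<le> 1" by (simp add: norm_scaleC)
qed

lemma pos_norm_le:
  fixes a :: "'a::cstar_algebra"
  assumes "pos a" "norm a \<le> t"
  shows "norm (t *\<^sub>R 1 - a) \<le> t"
proof (cases "t = 0")
  case True then show ?thesis using assms by simp
next
  case False
  then have t: "t > 0" using assms(2) norm_ge_zero[of a] by linarith
  obtain h0 where h0: "star h0 = h0" "a = h0 * h0" using assms(1) by (rule posE)
  define h where "h = (1 / sqrt t) *\<^sub>R h0"
  have h: "star h = h" "h * h = (1/t) *\<^sub>R a" using h0 t by (auto simp: h_def)
  have hh: "norm (h * h) \<le> 1" using h(2) assms(2) t by simp
  have "star (1 - h * h) = 1 - h * h" "norm (1 - (1 - h * h)) \<le> 1"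
    using h(1) hh by (auto simp: star_diff star_mult)
  from hermitian_sqrt_unit[OF this] obtain g where
    g: "star g = g" "g * g = 1 - h * h" "\<And>b. (1 - h * h) * b = b * (1 - h * h) \<Longrightarrow> g * b = b * g"
    by blast
  \<comment> \<open>so that \<open>h\<^sup>2 + g\<^sup>2 = 1\<close> with commuting hermitian \<open>h\<close> and \<open>g\<close>\<close>
  have "g * h = h * g" by (rule g(3)) (simp add: algebra_simps)
  then have "norm g \<le> 1"
    by (intro norm_le_1_if_squares_sum_1[OF h(1) g(1)]) (simp_all add: g(2))
  then have "norm (g * g) \<le> 1"
    using norm_square_hermitian[OF g(1)] by (simp add: power_le_one)
  then have "norm (t *\<^sub>R (g * g)) \<le> t" using t by simp
  moreover have "t *\<^sub>R (g * g) = t *\<^sub>R 1 - a" unfolding g(2) h(2) using t by (simp add: algebra_simps)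
  ultimately show ?thesis by simp
qed

lemma pos_scaleR: "pos a \<Longrightarrow> r \<ge> 0 \<Longrightarrow> pos (r *\<^sub>R a)"
  unfolding pos_def
  by (elim exE, rule_tac x = "sqrt r *\<^sub>R h" in exI) auto

lemma pos_add:
  assumes "pos a" "pos b" shows "pos (a + b)"
proof (rule posI)
  show "star (a + b) = a + b" using assms by (simp add: star_add pos_hermitian)
  have "norm ((norm a + norm b) *\<^sub>R 1 - (a + b)) = norm ((norm a *\<^sub>R 1 - a) + (norm b *\<^sub>R 1 - b))"
    by (simp add: algebra_simps)
  also have "\<dots> \<le> norm a + norm b"
    using pos_norm_le[OF assms(1) order_refl] pos_norm_le[OF assms(2) order_refl] by (rule norm_triangle_mono)
  finally show "norm ((norm a + norm b) *\<^sub>R 1 - (a + b)) \<le> norm a + norm b" .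
qed

lemma pos_0 [simp]: "pos 0" by (auto simp: pos_def intro!: exI[of _ 0])

lemma pos_sum: "(\<And>i. i \<in> I \<Longrightarrow> pos (f i)) \<Longrightarrow> pos (\<Sum>i\<in>I. f i)"
  by (induction I rule: infinite_finite_induct) (auto intro: pos_add)

lemma pos_norm_minus: "star a = a \<Longrightarrow> norm a \<le> t \<Longrightarrow> pos (t *\<^sub>R 1 - a)"
  by (rule posI[of _ t]) (auto simp: star_diff)

text \<open>After scaling, \<open>0 \<le> a \<le> 1\<close>; then \<open>a = h\<^sup>2\<close> and \<open>1 - a = g\<^sup>2\<close> where \<open>g\<close> can be chosen to commute with \<open>h\<close>, so
  \<open>h\<close> is a contraction by \<open>norm_le_1_if_squares_sum_1\<close>.\<close>

lemma pos_norm_mono: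
  fixes a b :: "'a::cstar_algebra"
  assumes "pos a" "pos (b - a)"
  shows "norm a \<le> norm b"
proof -
  have contraction: "norm a \<le> 1" if a: "pos a" "pos (1 - a)" for a :: 'a
  proof -
    obtain h where h: "star h = h" "a = h * h" using a(1) by (rule posE)
    have "norm (norm (1 - a) *\<^sub>R 1 - (1 - a)) \<le> norm (1 - a)"
      by (rule pos_norm_le[OF a(2)]) simp
    from hermitian_sqrt[OF pos_hermitian[OF a(2)] this]
    obtain g where g: "star g = g" "g * g = 1 - a" "\<And>b. (1 - a) * b = b * (1 - a) \<Longrightarrow> g * b = b * g"
      by blast
    have "g * h = h * g" by (rule g(3)) (simp add: h(2) algebra_simps)
    then have "norm h \<le> 1"
      by (intro norm_le_1_if_squares_sum_1[OF h(1) g(1)]) (simp_all add: g(2) h(2))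
    then show ?thesis using h norm_square_hermitian[OF h(1)] by (simp add: power_le_one)
  qed
  have "star (a + (b - a)) = a + (b - a)" using pos_add[OF assms] by (rule pos_hermitian)
  then have b: "star b = b" by simp
  have "norm a \<le> t" if t: "norm b < t" for t
  proof -
    have t0: "t > 0" using t norm_ge_zero[of b] by linarith
    have "pos ((t *\<^sub>R 1 - b) + (b - a))" using b t by (intro pos_add[OF _ assms(2)] pos_norm_minus) auto
    then have "pos ((1/t) *\<^sub>R (t *\<^sub>R 1 - a))" using t0 by (intro pos_scaleR) auto
    then have "pos (1 - (1/t) *\<^sub>R a)" using t0 by (simp add: algebra_simps)
    then have "norm ((1/t) *\<^sub>R a) \<le> 1" using assms(1) t0 by (intro contraction) (auto intro: pos_scaleR)
    then show ?thesis using t0 by (simp add: field_simps)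
  qed
  then show ?thesis by (rule dense_ge)
qed


lemma pos_power:
  assumes "pos a" shows "pos (a ^ n)"
proof -
  obtain h where h: "star h = h" "a = h * h" using assms by (rule posE)
  have "a ^ n = h ^ n * h ^ n" unfolding h(2) by (metis power_add power_mult mult_2 power2_eq_square)
  then show ?thesis using h(1) unfolding pos_def by (metis star_power)
qed

text \<open>This is the substitute for the spectral fact that \<open>x\<^sup>*x\<close> and \<open>xx\<^sup>*\<close> have the same spectrum away from
  zero: if \<open>z = xx\<^sup>*\<close> were positive and nonzero while \<open>x\<^sup>*x\<close> is negative, then
  \<open>z (1 + z)\<^sup>n = x (1 + x\<^sup>*x)\<^sup>n x\<^sup>*\<close> would grow without bound on the left but stay bounded on the right.\<close>

lemma contraction_star_mult_self_negative_imp_0: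
  fixes x :: "'a::cstar_algebra"
  assumes neg: "pos (- (star x * x))" and nrm: "norm x \<le> 1"
  shows "x = 0"
proof -
  define y where "y = star x * x"
  define z where "z = x * star x"
  have zy: "x * y = z * x" by (simp add: y_def z_def mult.assoc)
  have sy: "star y = y" and sz: "star z = z" by (auto simp: y_def z_def star_mult star_star)
  define u where "u = x + star x"
  define v where "v = scaleC \<i> (x - star x)"
  have "star u = u" "star v = v" by (auto simp: u_def v_def star_add star_star star_diff scaleC_i_simps)
  then have "pos (u * u)" "pos (v * v)" unfolding pos_def by blast+
  then have "pos (u * u + v * v)" by (rule pos_add)
  also have "u * u + v * v = 2 *\<^sub>R (y + z)"
    by (simp add: u_def v_def y_def z_def algebra_simps scaleC_i_simps scaleR_2)
  finally have "pos (2 *\<^sub>R (y + z))" .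
  then have "pos ((1/2) *\<^sub>R (2 *\<^sub>R (y + z)))" by (rule pos_scaleR) simp
  then have "pos (y + z)" by simp
  \<comment> \<open>\<open>x\<^sup>*x + xx\<^sup>* = (u\<^sup>2 + v\<^sup>2) / 2\<close> is positive, hence so is \<open>z = (y + z) - y\<close>\<close>
  then have pz: "pos z" using pos_add[of "y + z" "- y"] neg by (simp add: y_def)
  have ny: "norm (1 + y) \<le> 1"
  proof -
    have "norm (- y) \<le> 1" using cstar_identity[of x] nrm by (simp add: y_def power_le_one)
    then have "norm (1 *\<^sub>R 1 - (- y)) \<le> 1" using neg by (intro pos_norm_le) (auto simp: y_def)
    then show ?thesis by simp
  qed
  have "real n * norm (z * z) \<le> 1" for n
  proof -
    have comm: "x * (1 + y) ^ n = (1 + z) ^ n * x" for n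
    proof (induction n)
      case (Suc n)
      have "x * (1 + y) ^ Suc n = (x * (1 + y) ^ n) * (1 + y)" by (simp add: mult.assoc power_commutes)
      also have "\<dots> = (1 + z) ^ n * (x + z * x)" unfolding Suc by (simp add: algebra_simps zy)
      also have "\<dots> = (1 + z) ^ n * ((1 + z) * x)" by (simp add: distrib_right)
      also have "\<dots> = (1 + z) ^ Suc n * x" by (simp add: power_commutes flip: mult.assoc)
      finally show ?case .
    qed simp
    \<comment> \<open>\<open>z (1 + z)\<^sup>n - n z\<^sup>2\<close> is positive, having nonnegative coefficients as a polynomial in \<open>z\<close>\<close>
    have shift: "z ^ k * (1 + z) ^ Suc n = z ^ k * (1 + z) ^ n + z ^ Suc k * (1 + z) ^ n" for k n
      by (simp add: algebra_simps power_commutes flip: mult.assoc)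
    have mon: "pos (z ^ k * (1 + z) ^ n)" for k n
      by (induction n arbitrary: k) (simp_all add: pos_power pz pos_add shift del: power_Suc)
    have sq: "pos (z ^ 2 * (1 + z) ^ n - z ^ 2)" for n
    proof (induction n)
      case (Suc n)
      then show ?case using pos_add[OF Suc mon[of "Suc 2" n]] by (simp only: shift) (simp add: algebra_simps)
    qed simp
    have bern: "pos (z ^ 1 * (1 + z) ^ n - real n *\<^sub>R z ^ 2)" for n
    proof (induction n)
      case (Suc n)
      then show ?case using pos_add[OF Suc sq[of n]]
        by (simp only: shift) (simp add: algebra_simps numeral_2_eq_2)
    qed (use pz in simp)
    have "norm (real n *\<^sub>R (z * z)) \<le> norm (z * (1 + z) ^ n)"
      by (rule pos_norm_mono) (use bern[of n] pos_power[OF pz, of 2] in \<open>auto intro: pos_scaleR simp: power2_eq_square\<close>)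
    also have "z * (1 + z) ^ n = (1 + z) ^ n * z"
      by (rule power_commuting_commutes[symmetric]) (simp add: algebra_simps)
    also have "\<dots> = x * (1 + y) ^ n * star x" by (simp add: comm z_def mult.assoc)
    also have "norm \<dots> \<le> norm x * norm ((1 + y) ^ n) * norm (star x)"
      by (meson norm_mult_ineq order_trans mult_right_mono norm_ge_zero)
    also have "\<dots> \<le> 1 * 1 * 1"
      using nrm norm_power_ineq[of "1 + y" n] power_le_one[OF norm_ge_zero ny, of n]
      by (intro mult_mono) auto
    finally show ?thesis by simp
  qed
  then have "norm (z * z) = 0" by (metis real_archimedian_rdiv_eq_0 norm_ge_zero zero_le_one)
  then have "z = 0" using norm_square_hermitian[OF sz] by simp
  then have "norm x * norm x = 0"
    using cstar_identity[of "star x"] by (simp add: z_def star_star power2_eq_square)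
  then show ?thesis by simp
qed

lemma star_mult_self_negative_imp_0:
  fixes x :: "'a::cstar_algebra"
  assumes "pos (- (star x * x))"
  shows "x = 0"
proof (rule ccontr)
  assume x: "x \<noteq> 0"
  define r where "r = 1 / norm x"
  have "pos ((r * r) *\<^sub>R (- (star x * x)))" using assms by (rule pos_scaleR) simp
  then have "pos (- (star (r *\<^sub>R x) * (r *\<^sub>R x)))" by simp
  then have "r *\<^sub>R x = 0" by (rule contraction_star_mult_self_negative_imp_0) (simp add: r_def)
  then show False using x by (simp add: r_def)
qed

text \<open>Let \<open>m = \<bar>c\<bar>\<close> for \<open>c = a\<^sup>*a\<close>. With \<open>q = m\<^sup>1\<^sup>/\<^sup>2\<close> the element \<open>x = aq(m - c)\<close> has
  \<open>x\<^sup>*x = -(m(m - c))\<^sup>2 \<le> 0\<close>, so it vanishes, and this forces \<open>c = m\<close>.\<close>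

theorem pos_star_mult_self: "pos (star a * (a::'a::cstar_algebra))"
proof -
  define c where "c = star a * a"
  have sc: "star c = c" by (simp add: c_def star_mult star_star)
  have pcc: "pos (c * c)" using sc unfolding pos_def by metis
  from hermitian_sqrt[OF pos_hermitian[OF pcc] pos_norm_le[OF pcc order_refl]]
  obtain m where m: "star m = m" "norm (sqrt (norm (c * c)) *\<^sub>R 1 - m) \<le> sqrt (norm (c * c))" "m * m = c * c"
    "\<And>b. (c * c) * b = b * (c * c) \<Longrightarrow> m * b = b * m" by blast
  \<comment> \<open>\<open>m(2)\<close> says that \<open>m\<close> is positive, so it has a root \<open>q\<close>\<close>
  from hermitian_sqrt[OF m(1,2)]
  obtain q where q: "star q = q" "q * q = m" "\<And>b. m * b = b * m \<Longrightarrow> q * b = b * q" by blast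
  have mc: "m * c = c * m" by (rule m(4)) (simp add: mult.assoc)
  have qc: "q * c = c * q" by (rule q(3)) (rule mc)
  define n where "n = m - c"
  have sn: "star n = n" by (simp add: n_def star_diff m(1) sc)
  have cn: "c * n = - (m * n)" using m(3) mc by (simp add: n_def algebra_simps)
  have mn: "m * n = n * m" using mc by (simp add: n_def algebra_simps)
  have nn: "n * n = 2 *\<^sub>R (m * n)" using m(3) mc by (simp add: n_def algebra_simps scaleR_2)
  define x where "x = a * q * n"
  have "star x * x = n * (q * c * q) * n" by (simp add: x_def star_mult q(1) sn c_def mult.assoc)
  also have "q * c * q = m * c" using qc q(2) by (metis mult.assoc)
  also have "n * (m * c) * n = - ((m * n) * (m * n))" by (metis cn mn mult.assoc mult_minus_right)
  finally have xx: "star x * x = - ((m * n) * (m * n))" .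
  have smn: "star (m * n) = m * n" by (simp add: star_mult m(1) sn mn)
  then have "pos (- (star x * x))" unfolding xx pos_def by auto
  then have "x = 0" by (rule star_mult_self_negative_imp_0)
  then have "norm ((m * n) * (m * n)) = 0" using xx by simp
  then have "m * n = 0" using norm_square_hermitian[OF smn] by simp
  then have "norm (n * n) = 0" using nn by simp
  then have "n = 0" using norm_square_hermitian[OF sn] by simp
  then have "c = q * q" by (simp add: n_def q(2))
  then show ?thesis unfolding c_def[symmetric] pos_def using q(1) by blast
qed

lemma pos_conjugate:
  assumes "pos a" shows "pos (star b * a * b)"
proof -
  obtain h where "star h = h" "a = h * h" using assms by (rule posE)
  then have "star b * a * b = star (h * b) * (h * b)" by (simp add: star_mult mult.assoc)
  then show ?thesis by (simp add: pos_star_mult_self)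
qed

text \<open>The Cauchy-Schwarz inequality: expand \<open>0 \<le> \<Sum>(x\<^sub>ic - y\<^sub>i)\<^sup>*(x\<^sub>ic - y\<^sub>i)\<close> at \<open>c = t\<^sup>-\<^sup>1\<Sum>x\<^sub>i\<^sup>*y\<^sub>i\<close> for some
  \<open>t\<close> above the norm of \<open>\<Sum>x\<^sub>i\<^sup>*x\<^sub>i\<close>.\<close>

lemma cauchy_schwarz_sum:
  fixes x y :: "'i \<Rightarrow> 'a::cstar_algebra"
  shows "(norm (\<Sum>i\<in>I. star (x i) * y i))\<^sup>2
           \<le> norm (\<Sum>i\<in>I. star (x i) * x i) * norm (\<Sum>i\<in>I. star (y i) * y i)"
proof -
  define X Y Z where "X = (\<Sum>i\<in>I. star (x i) * x i)" and "Y = (\<Sum>i\<in>I. star (y i) * y i)"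
    and "Z = (\<Sum>i\<in>I. star (x i) * y i)"
  have sX: "star X = X" by (simp add: X_def star_sum star_mult star_star)
  have *: "(norm Z)\<^sup>2 \<le> t * norm Y" if t: "norm X < t" for t
  proof -
    have t0: "t > 0" using t norm_ge_zero[of X] by linarith
    define c where "c = (1/t) *\<^sub>R Z"
    have "pos (\<Sum>i\<in>I. star (x i * c - y i) * (x i * c - y i))"
      by (intro pos_sum pos_star_mult_self)
    also have "(\<Sum>i\<in>I. star (x i * c - y i) * (x i * c - y i)) =
        (\<Sum>i\<in>I. star c * (star (x i) * x i) * c - star c * (star (x i) * y i) - star (star (x i) * y i) * c + star (y i) * y i)"
      by (simp add: star_diff star_mult star_star algebra_simps)
    also have "\<dots> = star c * X * c - star c * Z - star Z * c + Y"
      by (simp add: sum.distrib sum_subtractf X_def Y_def Z_def sum_distrib_left sum_distrib_right star_sum)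
    finally have 1: "pos (star c * X * c - star c * Z - star Z * c + Y)" .
    have "pos (star c * (t *\<^sub>R 1 - X) * c)"
      using t by (intro pos_conjugate pos_norm_minus sX) simp
    from pos_add[OF 1 this] have 2: "pos (Y - (1/t) *\<^sub>R (star Z * Z))"
      using t0 by (simp add: c_def algebra_simps)
    have "norm ((1/t) *\<^sub>R (star Z * Z)) \<le> norm Y"
      by (rule pos_norm_mono[OF _ 2]) (use t0 in \<open>auto intro!: pos_scaleR pos_star_mult_self\<close>)
    then show ?thesis using t0 by (simp add: cstar_identity field_simps)
  qed
  have lim: "((\<lambda>t. t * norm Y) \<longlongrightarrow> norm X * norm Y) (at_right (norm X))"
    by (intro tendsto_intros)
  have "(norm Z)\<^sup>2 \<le> norm X * norm Y"
    by (rule tendsto_lowerbound[OF lim]) (use * in \<open>auto simp: eventually_at_filter\<close>)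
  then show ?thesis by (simp add: X_def Y_def Z_def)
qed

section \<open>The standard module as a Banach space\<close>

text \<open>The norm of the standard module restricted to the coordinates in a finite set \<open>I\<close>. All estimates are
  made on such sets and passed to the limit.\<close>

definition seq_norm :: "nat set \<Rightarrow> (nat \<Rightarrow> 'a::cstar_algebra) \<Rightarrow> real" where
  "seq_norm I x = sqrt (norm (\<Sum>i\<in>I. star (x i) * x i))"

lemma seq_norm_nonneg [simp]: "0 \<le> seq_norm I x"
  by (simp add: seq_norm_def)

lemma seq_norm_mono: "finite J \<Longrightarrow> I \<subseteq> J \<Longrightarrow> seq_norm I x \<le> seq_norm J x"
  unfolding seq_norm_def
  by (intro real_sqrt_le_mono pos_norm_mono)
     (auto intro!: pos_sum pos_star_mult_self simp: sum_diff[symmetric])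

lemma norm_le_seq_norm: "finite I \<Longrightarrow> i \<in> I \<Longrightarrow> norm (x i) \<le> seq_norm I x"
  using seq_norm_mono[of I "{i}" x] by (simp add: seq_norm_def cstar_identity)

lemma seq_norm_cong: "(\<And>i. i \<in> I \<Longrightarrow> x i = y i) \<Longrightarrow> seq_norm I x = seq_norm I y"
  by (simp add: seq_norm_def)

lemma norm_inner_sum_le: "norm (\<Sum>i\<in>I. star (x i) * y i) \<le> seq_norm I x * seq_norm I y"
  by (rule power2_le_imp_le) (auto simp: seq_norm_def power_mult_distrib cauchy_schwarz_sum)

lemma seq_norm_triangle: "seq_norm I (\<lambda>i. x i + y i) \<le> seq_norm I x + seq_norm I y"
proof (rule power2_le_imp_le)
  define X Y Z where "X = (\<Sum>i\<in>I. star (x i) * x i)" and "Y = (\<Sum>i\<in>I. star (y i) * y i)"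
    and "Z = (\<Sum>i\<in>I. star (x i) * y i)"
  have "(\<Sum>i\<in>I. star (x i + y i) * (x i + y i)) = X + Y + (Z + star Z)"
    by (simp add: X_def Y_def Z_def star_sum star_add star_mult star_star algebra_simps sum.distrib)
  then have "(seq_norm I (\<lambda>i. x i + y i))\<^sup>2 = norm (X + Y + (Z + star Z))"
    by (simp add: seq_norm_def)
  also have "\<dots> \<le> norm X + norm Y + (norm Z + norm Z)"
    by (intro norm_triangle_mono order_refl) simp
  also have "norm Z \<le> seq_norm I x * seq_norm I y" unfolding Z_def by (rule norm_inner_sum_le)
  finally show "(seq_norm I (\<lambda>i. x i + y i))\<^sup>2 \<le> (seq_norm I x + seq_norm I y)\<^sup>2"
    by (simp add: power2_sum seq_norm_def X_def Y_def)
qed simp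

lemma seq_norm_scaleR [simp]: "seq_norm I (\<lambda>i. r *\<^sub>R x i) = \<bar>r\<bar> * seq_norm I x"
proof -
  have "(\<Sum>i\<in>I. star (r *\<^sub>R x i) * (r *\<^sub>R x i)) = (r * r) *\<^sub>R (\<Sum>i\<in>I. star (x i) * x i)"
    by (simp add: scaleR_sum_right)
  then show ?thesis by (simp add: seq_norm_def real_sqrt_mult)
qed

lemma seq_norm_uminus [simp]: "seq_norm I (\<lambda>i. - x i) = seq_norm I x"
  by (simp add: seq_norm_def)

lemma seq_norm_rscale: "seq_norm I (rscale x a) \<le> seq_norm I x * norm a"
proof (rule power2_le_imp_le)
  have "(\<Sum>i\<in>I. star (x i * a) * (x i * a)) = star a * (\<Sum>i\<in>I. star (x i) * x i) * a"
    by (simp add: star_mult sum_distrib_left sum_distrib_right mult.assoc)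
  then have "(seq_norm I (rscale x a))\<^sup>2 = norm (star a * (\<Sum>i\<in>I. star (x i) * x i) * a)"
    by (simp add: seq_norm_def rscale_def)
  also have "\<dots> \<le> norm (star a) * norm (\<Sum>i\<in>I. star (x i) * x i) * norm a"
    by (meson norm_mult_ineq order_trans mult_right_mono norm_ge_zero)
  finally show "(seq_norm I (rscale x a))\<^sup>2 \<le> (seq_norm I x * norm a)\<^sup>2"
    by (simp add: seq_norm_def power_mult_distrib power2_eq_square mult_ac)
qed simp

lemma seq_norm_reindex: "inj_on \<phi> I \<Longrightarrow> seq_norm I (\<lambda>i. x (\<phi> i)) = seq_norm (\<phi> ` I) x"
  by (simp add: seq_norm_def sum.reindex o_def)

text \<open>By positivity the series \<open>\<Sum>x\<^sub>n\<^sup>*x\<^sub>n\<close> converges as soon as its finite tails become small, in any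
  order.\<close>

lemma HA_iff:
  "x \<in> HA \<longleftrightarrow> (\<forall>e>0. \<exists>N. \<forall>I. finite I \<longrightarrow> I \<subseteq> {N..} \<longrightarrow> seq_norm I x < e)" (is "_ \<longleftrightarrow> ?R")
proof
  assume "x \<in> HA"
  show ?R
  proof (intro allI impI)
    fix e :: real assume e: "e > 0"
    then have "e\<^sup>2 > 0" by simp
    moreover have "summable (\<lambda>n. star (x n) * x n)" using \<open>x \<in> HA\<close> by (simp add: HA_def)
    ultimately obtain N where N: "\<And>m n. m \<ge> N \<Longrightarrow> norm (\<Sum>i=m..<n. star (x i) * x i) < e\<^sup>2"
      unfolding summable_Cauchy by blast
    have "seq_norm I x < e" if "finite I" "I \<subseteq> {N..}" for I
    proof -
      have "I \<subseteq> {N..<Suc (Max I)}" using that by (auto simp: less_Suc_eq_le)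
      then have "seq_norm I x \<le> seq_norm {N..<Suc (Max I)} x" by (intro seq_norm_mono) auto
      also have "\<dots> < sqrt (e\<^sup>2)" unfolding seq_norm_def by (intro real_sqrt_less_mono N) auto
      finally show ?thesis using e by simp
    qed
    then show "\<exists>N. \<forall>I. finite I \<longrightarrow> I \<subseteq> {N..} \<longrightarrow> seq_norm I x < e" by blast
  qed
next
  assume R: ?R
  show "x \<in> HA"
    unfolding HA_def summable_Cauchy mem_Collect_eq
  proof (intro allI impI)
    fix e :: real assume e: "e > 0"
    then have "sqrt e > 0" by simp
    with R obtain N where N: "\<And>I. finite I \<Longrightarrow> I \<subseteq> {N..} \<Longrightarrow> seq_norm I x < sqrt e" by blast
    have "norm (\<Sum>i=m..<n. star (x i) * x i) < e" if "m \<ge> N" for m n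
      using N[of "{m..<n}"] that by (force simp: seq_norm_def)
    then show "\<exists>N. \<forall>m\<ge>N. \<forall>n. norm (\<Sum>i=m..<n. star (x i) * x i) < e" by blast
  qed
qed

lemma seq_norm_tendsto_hnorm: "x \<in> HA \<Longrightarrow> (\<lambda>n. seq_norm {..<n} x) \<longlonglongrightarrow> hnorm x"
  unfolding seq_norm_def hnorm_def hinner_def HA_def
  by (intro tendsto_intros summable_LIMSEQ) simp

lemma seq_norm_le_hnorm:
  assumes "x \<in> HA" "finite I" shows "seq_norm I x \<le> hnorm x"
proof (rule tendsto_lowerbound[OF seq_norm_tendsto_hnorm[OF assms(1)]])
  show "\<forall>\<^sub>F n in sequentially. seq_norm I x \<le> seq_norm {..<n} x"
    using eventually_ge_at_top[of "Suc (Max I)"]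
    by eventually_elim (use assms(2) in \<open>auto intro!: seq_norm_mono simp: Suc_le_eq le_less_trans[OF Max_ge]\<close>)
qed simp

lemma hnorm_le: "x \<in> HA \<Longrightarrow> (\<And>n. seq_norm {..<n} x \<le> c) \<Longrightarrow> hnorm x \<le> c"
  by (rule tendsto_upperbound[OF seq_norm_tendsto_hnorm]) auto

lemma HA_add: assumes "x \<in> HA" "y \<in> HA" shows "x + y \<in> HA"
  unfolding HA_iff
proof (intro allI impI)
  fix e :: real assume "e > 0"
  then have "e / 2 > 0" by simp
  with assms obtain M N where M: "\<And>I. finite I \<Longrightarrow> I \<subseteq> {M..} \<Longrightarrow> seq_norm I x < e / 2"
    and N: "\<And>I. finite I \<Longrightarrow> I \<subseteq> {N..} \<Longrightarrow> seq_norm I y < e / 2"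
    unfolding HA_iff by metis
  have "seq_norm I (x + y) < e" if "finite I" "I \<subseteq> {max M N..}" for I
  proof -
    have "I \<subseteq> {M..}" "I \<subseteq> {N..}" using that by auto
    then show ?thesis using M[of I] N[of I] that seq_norm_triangle[of I x y] by (simp add: plus_fun_def)
  qed
  then show "\<exists>N. \<forall>I. finite I \<longrightarrow> I \<subseteq> {N..} \<longrightarrow> seq_norm I (x + y) < e" by blast
qed

lemma HA_0 [simp]: "0 \<in> HA" by (simp add: HA_def)

lemma HA_dominated:
  assumes "x \<in> HA" "\<And>I. finite I \<Longrightarrow> seq_norm I y \<le> seq_norm I x * c"
  shows "y \<in> HA"
  unfolding HA_iff
proof (intro allI impI)
  fix e :: real assume e: "e > 0"
  then have "e / (\<bar>c\<bar> + 1) > 0" by simp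
  with assms(1) obtain N where N: "\<And>I. finite I \<Longrightarrow> I \<subseteq> {N..} \<Longrightarrow> seq_norm I x < e / (\<bar>c\<bar> + 1)"
    unfolding HA_iff by blast
  have "seq_norm I y < e" if "finite I" "I \<subseteq> {N..}" for I
  proof -
    have "seq_norm I y \<le> seq_norm I x * c" by (rule assms(2)) fact
    also have "\<dots> \<le> seq_norm I x * (\<bar>c\<bar> + 1)" by (rule mult_left_mono) auto
    also have "\<dots> < e" using N[OF that] by (simp add: pos_less_divide_eq)
    finally show ?thesis .
  qed
  then show "\<exists>N. \<forall>I. finite I \<longrightarrow> I \<subseteq> {N..} \<longrightarrow> seq_norm I y < e" by blast
qed

lemma HA_scaleR: "x \<in> HA \<Longrightarrow> (\<lambda>n. r *\<^sub>R x n) \<in> HA"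
  by (erule HA_dominated[of _ _ "\<bar>r\<bar>"]) simp

lemma HA_uminus: "x \<in> HA \<Longrightarrow> - x \<in> HA"
  by (erule HA_dominated[of _ _ 1]) (simp add: fun_Compl_def)

lemma HA_diff: "x \<in> HA \<Longrightarrow> y \<in> HA \<Longrightarrow> x - y \<in> HA"
  using HA_add[OF _ HA_uminus, of x y] by simp

lemma HA_rscale: "x \<in> HA \<Longrightarrow> rscale x a \<in> HA"
  by (erule HA_dominated) (rule seq_norm_rscale)

lemma summable_inner:
  assumes "x \<in> HA" "y \<in> HA" shows "summable (\<lambda>n. star (x n) * y n)"
  unfolding summable_Cauchy
proof (intro allI impI)
  fix e :: real assume e: "e > 0"
  have hy: "hnorm y + 1 > 0" by (simp add: hnorm_def add_nonneg_pos)
  with e have "e / (hnorm y + 1) > 0" by simp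
  from assms(1)[unfolded HA_iff, rule_format, OF this]
  obtain N where N: "\<And>I. finite I \<Longrightarrow> I \<subseteq> {N..} \<Longrightarrow> seq_norm I x < e / (hnorm y + 1)" by blast
  have "norm (\<Sum>i=m..<n. star (x i) * y i) < e" if "m \<ge> N" for m n
  proof -
    have "norm (\<Sum>i=m..<n. star (x i) * y i) \<le> seq_norm {m..<n} x * seq_norm {m..<n} y"
      by (rule norm_inner_sum_le)
    also have "\<dots> \<le> seq_norm {m..<n} x * (hnorm y + 1)"
      using seq_norm_le_hnorm[OF assms(2), of "{m..<n}"] by (intro mult_left_mono) auto
    also have "seq_norm {m..<n} x < e / (hnorm y + 1)" by (rule N) (use that in auto)
    then have "seq_norm {m..<n} x * (hnorm y + 1) < e" by (simp only: pos_less_divide_eq[OF hy])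
    finally show ?thesis .
  qed
  then show "\<exists>N. \<forall>m\<ge>N. \<forall>n. norm (\<Sum>i=m..<n. star (x i) * y i) < e" by blast
qed

lemma norm_hinner_le: assumes "x \<in> HA" "y \<in> HA" shows "norm (hinner x y) \<le> hnorm x * hnorm y"
proof (rule tendsto_le)
  show "(\<lambda>n. seq_norm {..<n} x * seq_norm {..<n} y) \<longlonglongrightarrow> hnorm x * hnorm y"
    using assms by (intro tendsto_intros seq_norm_tendsto_hnorm)
  show "(\<lambda>n. norm (\<Sum>i<n. star (x i) * y i)) \<longlonglongrightarrow> norm (hinner x y)"
    unfolding hinner_def using assms by (intro tendsto_intros summable_LIMSEQ summable_inner)
qed (auto simp: norm_inner_sum_le)

lemma norm_le_hnorm: "x \<in> HA \<Longrightarrow> norm (x n) \<le> hnorm x"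
  using norm_le_seq_norm[of "{n}" n x] seq_norm_le_hnorm[of x "{n}"] by simp

text \<open>The carrier is made a type, so that the library on Banach spaces applies to it.\<close>

typedef (overloaded) 'a hil = "HA :: (nat \<Rightarrow> 'a::cstar_algebra) set"
  morphisms seq hil
  using HA_0 by blast

setup_lifting type_definition_hil

declare seq [simp]

instantiation hil :: (cstar_algebra) real_normed_vector
begin

lift_definition zero_hil :: "'a hil" is 0 by (rule HA_0)
lift_definition plus_hil :: "'a hil \<Rightarrow> 'a hil \<Rightarrow> 'a hil" is "(+)" by (rule HA_add)
lift_definition uminus_hil :: "'a hil \<Rightarrow> 'a hil" is uminus by (rule HA_uminus)
lift_definition minus_hil :: "'a hil \<Rightarrow> 'a hil \<Rightarrow> 'a hil" is "(-)" by (rule HA_diff)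
lift_definition scaleR_hil :: "real \<Rightarrow> 'a hil \<Rightarrow> 'a hil" is "\<lambda>r x n. r *\<^sub>R x n" by (rule HA_scaleR)
lift_definition norm_hil :: "'a hil \<Rightarrow> real" is hnorm .

definition dist_hil :: "'a hil \<Rightarrow> 'a hil \<Rightarrow> real" where "dist_hil x y = norm (x - y)"
definition sgn_hil :: "'a hil \<Rightarrow> 'a hil" where "sgn_hil x = scaleR (inverse (norm x)) x"
definition uniformity_hil :: "('a hil \<times> 'a hil) filter" where
  "uniformity_hil = (INF e\<in>{0<..}. principal {(x, y). dist x y < e})"
definition open_hil :: "'a hil set \<Rightarrow> bool" where
  "open_hil U \<longleftrightarrow> (\<forall>x\<in>U. \<forall>\<^sub>F (x', y) in uniformity. x' = x \<longrightarrow> y \<in> U)"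

instance
proof
  fix x y z :: "'a hil" and a b :: real
  show "x + y + z = x + (y + z)" by transfer (simp add: add.assoc)
  show "x + y = y + x" by transfer (simp add: add.commute)
  show "0 + x = x" by transfer simp
  show "- x + x = 0" by transfer simp
  show "x - y = x + - y" by transfer simp
  show "a *\<^sub>R (x + y) = a *\<^sub>R x + a *\<^sub>R y" by transfer (auto simp: scaleR_add_right)
  show "(a + b) *\<^sub>R x = a *\<^sub>R x + b *\<^sub>R x" by transfer (auto simp: scaleR_add_left)
  show "a *\<^sub>R b *\<^sub>R x = (a * b) *\<^sub>R x" by transfer simp
  show "1 *\<^sub>R x = x" by transfer simp
  show "norm x = 0 \<longleftrightarrow> x = 0"
  proof transfer
    fix x :: "nat \<Rightarrow> 'a" assume "x \<in> HA"
    then show "hnorm x = 0 \<longleftrightarrow> x = 0"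
      using norm_le_hnorm[of x] by (force simp: hnorm_def hinner_def)
  qed
  show "norm (x + y) \<le> norm x + norm y"
  proof transfer
    fix x y :: "nat \<Rightarrow> 'a" assume xy: "x \<in> HA" "y \<in> HA"
    show "hnorm (x + y) \<le> hnorm x + hnorm y"
    proof (rule hnorm_le)
      show "x + y \<in> HA" using xy by (rule HA_add)
      show "seq_norm {..<n} (x + y) \<le> hnorm x + hnorm y" for n
        using seq_norm_triangle[of "{..<n}" x y] seq_norm_le_hnorm[OF xy(1), of "{..<n}"]
          seq_norm_le_hnorm[OF xy(2), of "{..<n}"] by (simp add: plus_fun_def)
    qed
  qed
  show "norm (a *\<^sub>R x) = \<bar>a\<bar> * norm x"
  proof transfer
    fix x :: "nat \<Rightarrow> 'a" and a :: real assume x: "x \<in> HA"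
    have "(\<lambda>n. seq_norm {..<n} (\<lambda>n. a *\<^sub>R x n)) \<longlonglongrightarrow> hnorm (\<lambda>n. a *\<^sub>R x n)"
      by (intro seq_norm_tendsto_hnorm HA_scaleR x)
    moreover have "(\<lambda>n. seq_norm {..<n} (\<lambda>n. a *\<^sub>R x n)) \<longlonglongrightarrow> \<bar>a\<bar> * hnorm x"
      unfolding seq_norm_scaleR by (intro tendsto_intros seq_norm_tendsto_hnorm x)
    ultimately show "hnorm (\<lambda>n. a *\<^sub>R x n) = \<bar>a\<bar> * hnorm x" by (rule LIMSEQ_unique)
  qed
qed (simp_all add: dist_hil_def sgn_hil_def uniformity_hil_def open_hil_def)

end

lemma seq_zero [simp]: "seq 0 n = 0" by transfer simp
lemma seq_add [simp]: "seq (x + y) n = seq x n + seq y n" by transfer simp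
lemma seq_diff [simp]: "seq (x - y) n = seq x n - seq y n" by transfer simp
lemma seq_uminus [simp]: "seq (- x) n = - seq x n" by transfer simp
lemma seq_scaleR [simp]: "seq (r *\<^sub>R x) n = r *\<^sub>R seq x n" by transfer simp

lemma seq_sum [simp]: "seq (\<Sum>i\<in>I. f i) n = (\<Sum>i\<in>I. seq (f i) n)"
  by (induction I rule: infinite_finite_induct) auto

lemma hil_eqI: "(\<And>n. seq x n = seq y n) \<Longrightarrow> x = y"
  by transfer auto

lemma norm_seq_le: "norm (seq x n) \<le> norm x"
  by transfer (rule norm_le_hnorm)

lemma seq_norm_le_norm: "finite I \<Longrightarrow> seq_norm I (seq x) \<le> norm x"
  by transfer (rule seq_norm_le_hnorm)

lemma norm_hil_le: "(\<And>n. seq_norm {..<n} (seq x) \<le> c) \<Longrightarrow> norm x \<le> c"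
  by transfer (rule hnorm_le)

instance hil :: (cstar_algebra) banach
proof
  fix X :: "nat \<Rightarrow> 'a hil" assume X: "Cauchy X"
  have "Cauchy (\<lambda>k. seq (X k) n)" for n
  proof (rule metric_CauchyI)
    fix e :: real assume "e > 0"
    then obtain M where "\<forall>k\<ge>M. \<forall>l\<ge>M. dist (X k) (X l) < e" using X metric_CauchyD by blast
    moreover have "dist (seq (X k) n) (seq (X l) n) \<le> dist (X k) (X l)" for k l
      using norm_seq_le[of "X k - X l" n] by (simp add: dist_norm)
    ultimately show "\<exists>M. \<forall>k\<ge>M. \<forall>l\<ge>M. dist (seq (X k) n) (seq (X l) n) < e"
      by (meson le_less_trans)
  qed
  then have "convergent (\<lambda>k. seq (X k) n)" for n by (rule Cauchy_convergent)
  then obtain y where y: "\<And>n. (\<lambda>k. seq (X k) n) \<longlonglongrightarrow> y n"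
    unfolding convergent_def by metis
  have near: "\<exists>M. \<forall>k\<ge>M. \<forall>I. finite I \<longrightarrow> seq_norm I (\<lambda>i. y i - seq (X k) i) \<le> e" if e: "e > 0" for e
  proof -
    from X e obtain M where M: "\<And>k l. k \<ge> M \<Longrightarrow> l \<ge> M \<Longrightarrow> dist (X k) (X l) < e" using metric_CauchyD by blast
    have "seq_norm I (\<lambda>i. y i - seq (X k) i) \<le> e" if "k \<ge> M" "finite I" for k I
    proof (rule tendsto_upperbound)
      show "(\<lambda>l. seq_norm I (\<lambda>i. seq (X l) i - seq (X k) i)) \<longlonglongrightarrow> seq_norm I (\<lambda>i. y i - seq (X k) i)"
        unfolding seq_norm_def
        by (intro tendsto_intros y bounded_linear.tendsto[OF bounded_linear_star])
      show "\<forall>\<^sub>F l in sequentially. seq_norm I (\<lambda>i. seq (X l) i - seq (X k) i) \<le> e"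
        using eventually_ge_at_top[of M]
      proof eventually_elim
        case (elim l)
        have "seq_norm I (seq (X l - X k)) \<le> norm (X l - X k)" using that by (intro seq_norm_le_norm)
        moreover have "seq (X l - X k) = (\<lambda>i. seq (X l) i - seq (X k) i)" by (rule ext) simp
        ultimately show ?case using M[OF elim \<open>k \<ge> M\<close>] by (simp add: dist_norm)
      qed
    qed simp
    then show ?thesis by blast
  qed
  \<comment> \<open>Boundedness of the partial sums of \<open>y\<close> would not suffice: the tails are small because those of \<open>X M\<close> are.\<close>
  have "y \<in> HA"
    unfolding HA_iff
  proof (intro allI impI)
    fix e :: real assume "e > 0"
    then have e2: "e / 2 > 0" by simp
    from near[OF e2] obtain M where M: "\<And>I. finite I \<Longrightarrow> seq_norm I (\<lambda>i. y i - seq (X M) i) \<le> e / 2" by blast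
    have "seq (X M) \<in> HA" by simp
    with e2 obtain N where N: "\<And>I. finite I \<Longrightarrow> I \<subseteq> {N..} \<Longrightarrow> seq_norm I (seq (X M)) < e / 2"
      unfolding HA_iff by blast
    have "seq_norm I y < e" if "finite I" "I \<subseteq> {N..}" for I
      using seq_norm_triangle[of I "\<lambda>i. y i - seq (X M) i" "seq (X M)"] M[OF that(1)] N[OF that] by simp
    then show "\<exists>N. \<forall>I. finite I \<longrightarrow> I \<subseteq> {N..} \<longrightarrow> seq_norm I y < e" by blast
  qed
  then obtain x where x: "seq x = y" using hil_inverse by blast
  have "X \<longlonglongrightarrow> x"
  proof (rule metric_LIMSEQ_I)
    fix e :: real assume "e > 0"
    then have e2: "e / 2 > 0" by simp
    from near[OF e2] obtain M where M: "\<And>k I. k \<ge> M \<Longrightarrow> finite I \<Longrightarrow> seq_norm I (\<lambda>i. y i - seq (X k) i) \<le> e / 2" by blast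
    have "dist (X k) x < e" if "k \<ge> M" for k
    proof -
      have "seq (x - X k) = (\<lambda>i. y i - seq (X k) i)" by (rule ext) (simp add: x)
      then have "norm (x - X k) \<le> e / 2" using M[OF that] by (intro norm_hil_le) simp
      then show ?thesis using \<open>e > 0\<close> by (simp add: dist_norm norm_minus_commute)
    qed
    then show "\<exists>M. \<forall>k\<ge>M. dist (X k) x < e" by blast
  qed
  then show "convergent X" by (rule convergentI)
qed

lift_definition rmul :: "'a::cstar_algebra hil \<Rightarrow> 'a \<Rightarrow> 'a hil" is rscale by (rule HA_rscale)

lemma seq_rmul [simp]: "seq (rmul x a) n = seq x n * a" by transfer (simp add: rscale_def)

lemma seq_rmul': "seq (rmul x a) = rscale (seq x) a" by transfer simp

lemma rmul_scaleR: "rmul x (r *\<^sub>R 1) = r *\<^sub>R x" by (rule hil_eqI) simp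
lemma rmul_add_left: "rmul (x + y) a = rmul x a + rmul y a" by (rule hil_eqI) (simp add: algebra_simps)
lemma rmul_diff_left: "rmul (x - y) a = rmul x a - rmul y a" by (rule hil_eqI) (simp add: algebra_simps)
lemma rmul_add_right: "rmul x (a + b) = rmul x a + rmul x b" by (rule hil_eqI) (simp add: algebra_simps)
lemma rmul_rmul: "rmul (rmul x a) b = rmul x (a * b)" by (rule hil_eqI) (simp add: mult.assoc)
lemma rmul_0_left [simp]: "rmul 0 a = 0" by (rule hil_eqI) simp
lemma rmul_sum_left: "rmul (\<Sum>i\<in>I. f i) a = (\<Sum>i\<in>I. rmul (f i) a)"
  by (rule hil_eqI) (simp add: sum_distrib_right)

lemma norm_rmul_le: "norm (rmul x a) \<le> norm x * norm a"
proof (rule norm_hil_le)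
  fix n
  have "seq_norm {..<n} (seq (rmul x a)) \<le> seq_norm {..<n} (seq x) * norm a"
    unfolding seq_rmul' by (rule seq_norm_rscale)
  also have "\<dots> \<le> norm x * norm a" by (intro mult_right_mono seq_norm_le_norm) auto
  finally show "seq_norm {..<n} (seq (rmul x a)) \<le> norm x * norm a" .
qed

lemma bounded_linear_rmul: "bounded_linear (\<lambda>x. rmul x a)"
  by (rule bounded_linear_intro[of _ "norm a"])
     (auto simp: rmul_add_left norm_rmul_le rmul_rmul intro: hil_eqI)

lift_definition ip :: "'a::cstar_algebra hil \<Rightarrow> 'a hil \<Rightarrow> 'a" is hinner .

lemma ip_add_right: "ip x (y + z) = ip x y + ip x z"
  by transfer (simp add: hinner_def algebra_simps suminf_add summable_inner)

lemma ip_add_left: "ip (x + y) z = ip x z + ip y z"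
  by transfer (simp add: hinner_def algebra_simps suminf_add summable_inner star_add)

lemma ip_rmul_right: "ip x (rmul y a) = ip x y * a"
  by transfer (simp add: hinner_def rscale_def suminf_mult2[OF summable_inner] mult.assoc)

lemma ip_rmul_left: "ip (rmul x a) y = star a * ip x y"
  by transfer (simp add: hinner_def rscale_def suminf_mult[OF summable_inner] mult.assoc star_mult)

lemma ip_0_left [simp]: "ip 0 x = 0" by transfer (simp add: hinner_def)
lemma ip_0_right [simp]: "ip x 0 = 0" by transfer (simp add: hinner_def)

lemma ip_sum_left: "ip (\<Sum>i\<in>I. f i) y = (\<Sum>i\<in>I. ip (f i) y)"
  by (induction I rule: infinite_finite_induct) (auto simp: ip_add_left)

lemma norm_ip_le: "norm (ip x y) \<le> norm x * norm y"
  by transfer (rule norm_hinner_le)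

lemma norm_ip_self: "norm (ip x x) = (norm x)\<^sup>2"
  by transfer (simp add: hnorm_def)

lemma star_ip: "star (ip x y) = ip y x"
proof transfer
  fix x y :: "nat \<Rightarrow> 'a" assume xy: "x \<in> HA" "y \<in> HA"
  have "star (hinner x y) = (\<Sum>n. star (star (x n) * y n))"
    unfolding hinner_def by (rule bounded_linear.suminf[OF bounded_linear_star summable_inner[OF xy]])
  also have "\<dots> = hinner y x" by (simp only: star_mult star_star hinner_def)
  finally show "star (hinner x y) = hinner y x" .
qed

lemma closed_pos: "closed {a::'a::cstar_algebra. pos a}"
proof -
  have "{a::'a. pos a} = {a. star a = a \<and> norm (norm a *\<^sub>R 1 - a) \<le> norm a}"
    by (metis posI pos_norm_le pos_hermitian order_refl)
  also have "closed \<dots>"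
    by (intro closed_Collect_conj closed_Collect_eq closed_Collect_le continuous_intros
          linear_continuous_on bounded_linear_star)
  finally show ?thesis .
qed

lemma pos_ip_self: "pos (ip x x)"
proof transfer
  fix x :: "nat \<Rightarrow> 'a" assume x: "x \<in> HA"
  have lim: "(\<lambda>n. \<Sum>i<n. star (x i) * x i) \<longlonglongrightarrow> hinner x x"
    unfolding hinner_def by (rule summable_LIMSEQ[OF summable_inner[OF x x]])
  have "hinner x x \<in> {a. pos a}"
    by (rule closed_sequentially[OF closed_pos _ lim]) (auto intro: pos_sum pos_star_mult_self)
  then show "pos (hinner x x)" by simp
qed

section \<open>The Banach algebra of module operators\<close>

lift_definition unit_vec :: "nat \<Rightarrow> 'a::cstar_algebra hil" is "\<lambda>i n. if n = i then 1 else 0"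
proof -
  fix i :: nat
  show "(\<lambda>n. if n = i then 1 else 0 :: 'a) \<in> HA"
    unfolding HA_def mem_Collect_eq by (rule summable_finite[of "{i}"]) auto
qed

lemma seq_unit_vec [simp]: "seq (unit_vec i) n = (if n = i then 1 else 0)"
  by transfer simp

lemma norm_unit_vec_0_nonzero: "norm (unit_vec i :: 'a::cstar_algebra hil) \<noteq> 0"
proof
  assume "norm (unit_vec i :: 'a hil) = 0"
  then have "seq (unit_vec i :: 'a hil) i = seq 0 i" by simp
  then show False by simp
qed

lifting_forget hil.lifting

text \<open>All bounded module operators are taken, adjointable or not: the projections that belong to a
  decomposition arise from the open mapping theorem, which gives boundedness but no adjoint.\<close>

typedef (overloaded) 'a mop =
  "{T :: 'a::cstar_algebra hil \<Rightarrow>\<^sub>L 'a hil. \<forall>x a. blinfun_apply T (rmul x a) = rmul (blinfun_apply T x) a}"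
  morphisms blinfun_of_mop mop_of_blinfun
  by (rule exI[of _ 0]) simp

setup_lifting type_definition_mop

lift_definition ap :: "'a::cstar_algebra mop \<Rightarrow> 'a hil \<Rightarrow> 'a hil" is blinfun_apply .

lemma ap_rmul: "ap T (rmul x a) = rmul (ap T x) a" by transfer simp

lemma bounded_linear_ap: "bounded_linear (ap T)"
  by transfer (rule blinfun.bounded_linear_right)

lemmas linear_ap = bounded_linear.linear[OF bounded_linear_ap]
lemmas ap_add = linear_add[OF linear_ap]
  and ap_diff = linear_diff[OF linear_ap]
  and ap_0 [simp] = linear_0[OF linear_ap]
  and ap_sum = linear_sum[OF linear_ap]
  and continuous_on_ap = bounded_linear.continuous_on[OF bounded_linear_ap]

lemma mop_eqI: "(\<And>x. ap T x = ap S x) \<Longrightarrow> T = S"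
  by transfer (rule blinfun_eqI)

instantiation mop :: (cstar_algebra) real_normed_algebra_1
begin

lift_definition zero_mop :: "'a mop" is 0 by simp
lift_definition one_mop :: "'a mop" is id_blinfun by simp
lift_definition plus_mop :: "'a mop \<Rightarrow> 'a mop \<Rightarrow> 'a mop" is "(+)"
  by (simp add: blinfun.add_left rmul_add_left)
lift_definition uminus_mop :: "'a mop \<Rightarrow> 'a mop" is uminus
  by (simp add: blinfun.minus_left linear_neg[OF bounded_linear.linear[OF bounded_linear_rmul]])
lift_definition minus_mop :: "'a mop \<Rightarrow> 'a mop \<Rightarrow> 'a mop" is "(-)"
  by (simp add: blinfun.diff_left rmul_diff_left)
lift_definition scaleR_mop :: "real \<Rightarrow> 'a mop \<Rightarrow> 'a mop" is "(*\<^sub>R)"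
  by (simp add: blinfun.scaleR_left linear_scale[OF bounded_linear.linear[OF bounded_linear_rmul]])
lift_definition times_mop :: "'a mop \<Rightarrow> 'a mop \<Rightarrow> 'a mop" is "(o\<^sub>L)" by simp
lift_definition norm_mop :: "'a mop \<Rightarrow> real" is norm .

definition dist_mop :: "'a mop \<Rightarrow> 'a mop \<Rightarrow> real" where "dist_mop x y = norm (x - y)"
definition sgn_mop :: "'a mop \<Rightarrow> 'a mop" where "sgn_mop x = scaleR (inverse (norm x)) x"
definition uniformity_mop :: "('a mop \<times> 'a mop) filter" where
  "uniformity_mop = (INF e\<in>{0<..}. principal {(x, y). dist x y < e})"
definition open_mop :: "'a mop set \<Rightarrow> bool" where
  "open_mop U \<longleftrightarrow> (\<forall>x\<in>U. \<forall>\<^sub>F (x', y) in uniformity. x' = x \<longrightarrow> y \<in> U)"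

instance
proof
  fix x y z :: "'a mop" and a b :: real
  show "x + y + z = x + (y + z)" by transfer (simp add: add.assoc)
  show "x + y = y + x" by transfer (simp add: add.commute)
  show "0 + x = x" by transfer simp
  show "- x + x = 0" by transfer simp
  show "x - y = x + - y" by transfer simp
  show "a *\<^sub>R (x + y) = a *\<^sub>R x + a *\<^sub>R y" by transfer (simp add: scaleR_add_right)
  show "(a + b) *\<^sub>R x = a *\<^sub>R x + b *\<^sub>R x" by transfer (simp add: scaleR_add_left)
  show "a *\<^sub>R b *\<^sub>R x = (a * b) *\<^sub>R x" by transfer simp
  show "1 *\<^sub>R x = x" by transfer simp
  show "x * y * z = x * (y * z)" by transfer (rule blinfun_eqI, simp)
  show "1 * x = x" by transfer (rule blinfun_eqI, simp)
  show "x * 1 = x" by transfer (rule blinfun_eqI, simp)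
  show "(x + y) * z = x * z + y * z" by transfer (rule blinfun_eqI, simp add: blinfun.add_left)
  show "x * (y + z) = x * y + x * z" by transfer (rule blinfun_eqI, simp add: blinfun.add_left blinfun.add_right)
  show "a *\<^sub>R x * y = a *\<^sub>R (x * y)" by transfer (rule blinfun_eqI, simp add: blinfun.scaleR_left)
  show "x * a *\<^sub>R y = a *\<^sub>R (x * y)"
    by transfer (rule blinfun_eqI, simp add: blinfun.scaleR_left blinfun.scaleR_right)
  show "(0::'a mop) \<noteq> 1"
  proof
    assume "(0::'a mop) = 1"
    then have "ap (0::'a mop) (unit_vec 0) = ap 1 (unit_vec 0)" by simp
    then have "unit_vec 0 = (0 :: 'a hil)" by transfer simp
    then show False using norm_unit_vec_0_nonzero[of 0, where ?'a='a] by simp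
  qed
  show "norm x = 0 \<longleftrightarrow> x = 0" by transfer simp
  show "norm (x + y) \<le> norm x + norm y" by transfer (rule norm_triangle_ineq)
  show "norm (a *\<^sub>R x) = \<bar>a\<bar> * norm x" by transfer simp
  show "norm (x * y) \<le> norm x * norm y" by transfer (rule norm_blinfun_compose)
  show "norm (1::'a mop) = 1"
  proof (rule antisym)
    show "norm (1::'a mop) \<le> 1" by transfer (rule norm_blinfun_id_le)
    have "norm (ap 1 (unit_vec 0 :: 'a hil)) \<le> norm (1::'a mop) * norm (unit_vec 0 :: 'a hil)"
      by transfer (rule norm_blinfun)
    also have "ap 1 (unit_vec 0 :: 'a hil) = unit_vec 0" by transfer simp
    finally show "1 \<le> norm (1::'a mop)" using norm_unit_vec_0_nonzero[of 0, where ?'a='a] by simp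
  qed
qed (simp_all add: dist_mop_def sgn_mop_def uniformity_mop_def open_mop_def)

end

lemma ap_zero_mop [simp]: "ap 0 x = 0" by transfer simp
lemma ap_one_mop [simp]: "ap 1 x = x" by transfer simp
lemma ap_add_mop: "ap (S + T) x = ap S x + ap T x" by transfer (simp add: blinfun.add_left)
lemma ap_diff_mop: "ap (S - T) x = ap S x - ap T x" by transfer (simp add: blinfun.diff_left)
lemma ap_mult [simp]: "ap (S * T) x = ap S (ap T x)" by transfer simp
lemma norm_ap_le: "norm (ap T x) \<le> norm T * norm x" by transfer (rule norm_blinfun)

lemma norm_mop_le: "0 \<le> C \<Longrightarrow> (\<And>x. norm (ap T x) \<le> C * norm x) \<Longrightarrow> norm T \<le> C"
  by transfer (rule norm_blinfun_bound)

instance mop :: (cstar_algebra) banach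
proof
  fix X :: "nat \<Rightarrow> 'a mop" assume X: "Cauchy X"
  have d: "dist (blinfun_of_mop S) (blinfun_of_mop T) = dist S T" for S T :: "'a mop"
    unfolding dist_norm by transfer simp
  have "Cauchy (\<lambda>n. blinfun_of_mop (X n))" using X by (simp add: Cauchy_def d)
  then obtain L where L: "(\<lambda>n. blinfun_of_mop (X n)) \<longlonglongrightarrow> L" using Cauchy_convergent_iff convergent_def by metis
  have "blinfun_apply L (rmul x a) = rmul (blinfun_apply L x) a" for x a
  proof (rule LIMSEQ_unique)
    show "(\<lambda>n. blinfun_apply (blinfun_of_mop (X n)) (rmul x a)) \<longlonglongrightarrow> blinfun_apply L (rmul x a)"
      by (intro tendsto_intros L)
    have "(\<lambda>n. rmul (blinfun_apply (blinfun_of_mop (X n)) x) a) \<longlonglongrightarrow> rmul (blinfun_apply L x) a"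
      by (intro bounded_linear.tendsto[OF bounded_linear_rmul] tendsto_intros L)
    then show "(\<lambda>n. blinfun_apply (blinfun_of_mop (X n)) (rmul x a)) \<longlonglongrightarrow> rmul (blinfun_apply L x) a"
      by (simp add: ap_rmul[unfolded ap.rep_eq])
  qed
  then obtain T where "blinfun_of_mop T = L" using mop_of_blinfun_inverse by blast
  then have "X \<longlonglongrightarrow> T" using L unfolding tendsto_iff by (simp flip: d)
  then show "convergent X" by (rule convergentI)
qed

lemma ex_mop:
  fixes f :: "'a::cstar_algebra hil \<Rightarrow> 'a hil"
  assumes add: "\<And>x y. f (x + y) = f x + f y" and rm: "\<And>x a. f (rmul x a) = rmul (f x) a"
    and bd: "\<And>x. norm (f x) \<le> C * norm x"
  obtains T where "\<And>x. ap T x = f x"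
proof -
  \<comment> \<open>real scaling is right multiplication by a real multiple of the unit\<close>
  have "bounded_linear f"
    by (rule bounded_linear_intro[of _ C]) (use add bd rm[of _ "_ *\<^sub>R 1"] in \<open>auto simp: rmul_scaleR mult.commute\<close>)
  then have "blinfun_apply (Blinfun f) = f" by (rule bounded_linear_Blinfun_apply)
  then have "mop_of_blinfun (Blinfun f) = mop_of_blinfun (Blinfun f) \<and> blinfun_of_mop (mop_of_blinfun (Blinfun f)) = Blinfun f"
    using mop_of_blinfun_inverse[of "Blinfun f"] rm by auto
  then have "ap (mop_of_blinfun (Blinfun f)) x = f x" for x
    using \<open>blinfun_apply (Blinfun f) = f\<close> by (simp add: ap.rep_eq)
  then show ?thesis using that by blast
qed

lemma mop_one_minus_invertible:
  fixes x :: "'a::cstar_algebra mop"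
  assumes "norm x < 1"
  obtains w where "(1 - x) * w = 1" "w * (1 - x) = 1"
proof -
  define w where "w = (\<Sum>n. x ^ n)"
  have s: "summable (\<lambda>n. x ^ n)" using assms by (rule complete_algebra_summable_geometric)
  have "(\<lambda>n. x ^ n - x ^ Suc n) sums (x ^ 0 - 0)"
    by (intro telescope_sums' LIMSEQ_power_zero assms)
  then have t: "(\<Sum>n. x ^ n - x ^ Suc n) = 1" by (simp add: sums_iff)
  have "(1 - x) * w = (\<Sum>n. (1 - x) * x ^ n)" unfolding w_def by (rule suminf_mult[OF s, symmetric])
  moreover have "w * (1 - x) = (\<Sum>n. x ^ n * (1 - x))" unfolding w_def by (rule suminf_mult2[OF s])
  ultimately show ?thesis using that t by (simp add: algebra_simps power_commutes)
qed

text \<open>This covers the coordinate projections, the interleaving isometries and their left inverses at once. A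
  rearrangement of coordinates along an injective partial map \<open>\<phi>\<close> turns the norm over a finite set \<open>I\<close> into the
  norm over the image of \<open>I\<close>, whence the bound.\<close>

lemma ex_coord_op:
  assumes inj: "inj_on \<phi> (dom \<phi>)"
  obtains T :: "'a::cstar_algebra mop"
  where "\<And>x n. seq (ap T x) n = (case \<phi> n of None \<Rightarrow> 0 | Some m \<Rightarrow> seq x m)" "norm T \<le> 1"
proof -
  define g where "g x n = (case \<phi> n of None \<Rightarrow> 0 | Some m \<Rightarrow> x m)" for x :: "nat \<Rightarrow> 'a" and n
  define ix where "ix I = the ` \<phi> ` (I \<inter> dom \<phi>)" for I
  have gn: "seq_norm I (g x) = seq_norm (ix I) x" if "finite I" for I x
  proof -
    have i: "inj_on (\<lambda>n. the (\<phi> n)) (I \<inter> dom \<phi>)" using inj by (force simp: inj_on_def dom_def)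
    have "(\<Sum>i\<in>I. star (g x i) * g x i) = (\<Sum>i\<in>I \<inter> dom \<phi>. star (g x i) * g x i)"
      using that by (intro sum.mono_neutral_right) (auto simp: g_def dom_def)
    then have "seq_norm I (g x) = seq_norm (I \<inter> dom \<phi>) (g x)" by (simp add: seq_norm_def)
    also have "\<dots> = seq_norm (I \<inter> dom \<phi>) (\<lambda>n. x (the (\<phi> n)))"
      by (rule seq_norm_cong) (auto simp: g_def)
    also have "\<dots> = seq_norm (ix I) x"
      using seq_norm_reindex[OF i, of x] by (simp add: ix_def image_image)
    finally show ?thesis .
  qed
  have gH: "g x \<in> HA" if x: "x \<in> HA" for x
    unfolding HA_iff
  proof (intro allI impI)
    fix e :: real assume "e > 0"
    then obtain N where N: "\<And>I. finite I \<Longrightarrow> I \<subseteq> {N..} \<Longrightarrow> seq_norm I x < e" using x unfolding HA_iff by metis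
    have "finite {n \<in> dom \<phi>. \<phi> n \<in> Some ` {..<N}}"
      by (rule finite_imageD[where f = \<phi>]) (auto intro: finite_subset[of _ "Some ` {..<N}"] inj_on_subset[OF inj])
    then obtain M where M: "\<And>n. n \<in> dom \<phi> \<Longrightarrow> \<phi> n \<in> Some ` {..<N} \<Longrightarrow> n < M"
      using finite_nat_set_iff_bounded by (metis (no_types, lifting) mem_Collect_eq)
    have "seq_norm I (g x) < e" if "finite I" "I \<subseteq> {M..}" for I
    proof -
      have "ix I \<subseteq> {N..}" using that M by (fastforce simp: ix_def not_less[symmetric])
      then show ?thesis unfolding gn[OF that(1)] using that(1) by (intro N) (auto simp: ix_def)
    qed
    then show "\<exists>N. \<forall>I. finite I \<longrightarrow> I \<subseteq> {N..} \<longrightarrow> seq_norm I (g x) < e" by blast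
  qed
  define f where "f x = hil (g (seq x))" for x
  have sf: "seq (f x) n = g (seq x) n" for x n unfolding f_def by (subst hil_inverse) (auto simp: gH)
  have nf: "norm (f x) \<le> 1 * norm x" for x
  proof (rule norm_hil_le)
    fix n
    have "seq_norm {..<n} (seq (f x)) = seq_norm (ix {..<n}) (seq x)"
      using gn[of "{..<n}" "seq x"] by (simp add: sf seq_norm_def)
    also have "\<dots> \<le> norm x" by (rule seq_norm_le_norm) (simp add: ix_def)
    finally show "seq_norm {..<n} (seq (f x)) \<le> 1 * norm x" by simp
  qed
  obtain T where T: "\<And>x. ap T x = f x"
    by (rule ex_mop[of f 1]) (use nf in \<open>auto intro!: hil_eqI simp: sf g_def split: option.split\<close>)
  have "norm T \<le> 1" by (rule norm_mop_le) (use nf T in auto)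
  then show ?thesis by (rule that[rotated]) (simp add: T sf g_def)
qed

definition coord_op :: "(nat \<Rightarrow> nat option) \<Rightarrow> 'a::cstar_algebra mop" where
  "coord_op \<phi> = (SOME T. (\<forall>x n. seq (ap T x) n = (case \<phi> n of None \<Rightarrow> 0 | Some m \<Rightarrow> seq x m)) \<and> norm T \<le> 1)"

lemma coord_op:
  assumes "inj_on \<phi> (dom \<phi>)"
  shows "seq (ap (coord_op \<phi> :: 'a::cstar_algebra mop) x) n = (case \<phi> n of None \<Rightarrow> 0 | Some m \<Rightarrow> seq x m)"
    and "norm (coord_op \<phi> :: 'a mop) \<le> 1"
proof -
  have "\<exists>T :: 'a mop. (\<forall>x n. seq (ap T x) n = (case \<phi> n of None \<Rightarrow> 0 | Some m \<Rightarrow> seq x m)) \<and> norm T \<le> 1"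
    using ex_coord_op[OF assms] by metis
  from someI_ex[OF this]
  show "seq (ap (coord_op \<phi> :: 'a::cstar_algebra mop) x) n = (case \<phi> n of None \<Rightarrow> 0 | Some m \<Rightarrow> seq x m)"
    "norm (coord_op \<phi> :: 'a mop) \<le> 1" unfolding coord_op_def by blast+
qed

definition trunc :: "nat \<Rightarrow> 'a::cstar_algebra mop" where
  "trunc m = coord_op (\<lambda>n. if n < m then Some n else None)"
definition even_in :: "'a::cstar_algebra mop" where
  "even_in = coord_op (\<lambda>n. if even n then Some (n div 2) else None)"
definition odd_in :: "'a::cstar_algebra mop" where
  "odd_in = coord_op (\<lambda>n. if odd n then Some (n div 2) else None)"
definition even_out :: "'a::cstar_algebra mop" where
  "even_out = coord_op (\<lambda>n. Some (2 * n))"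
definition odd_out :: "'a::cstar_algebra mop" where
  "odd_out = coord_op (\<lambda>n. Some (2 * n + 1))"

lemma
  shows seq_trunc [simp]: "seq (ap (trunc m) x) n = (if n < m then seq x n else 0)"
    and seq_even_in [simp]: "seq (ap even_in x) n = (if even n then seq x (n div 2) else 0)"
    and seq_odd_in [simp]: "seq (ap odd_in x) n = (if odd n then seq x (n div 2) else 0)"
    and seq_even_out [simp]: "seq (ap even_out x) n = seq x (2 * n)"
    and seq_odd_out [simp]: "seq (ap odd_out x) n = seq x (2 * n + 1)"
    and norm_odd_in: "norm (odd_in :: 'a::cstar_algebra mop) \<le> 1"
  unfolding trunc_def even_in_def odd_in_def even_out_def odd_out_def
  by (subst coord_op; auto simp: inj_on_def dom_def split: if_splits elim!: evenE oddE)+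

lemma
  shows even_out_even_in: "even_out * even_in = (1 :: 'a::cstar_algebra mop)"
    and odd_out_odd_in: "odd_out * odd_in = (1 :: 'a::cstar_algebra mop)"
    and even_out_odd_in: "even_out * odd_in = (0 :: 'a::cstar_algebra mop)"
    and odd_out_even_in: "odd_out * even_in = (0 :: 'a::cstar_algebra mop)"
    and trunc_mult: "trunc m * trunc k = (trunc (min m k) :: 'a::cstar_algebra mop)"
    and trunc_double: "even_in * trunc m * even_out + odd_in * trunc m * odd_out = (trunc (2 * m) :: 'a::cstar_algebra mop)"
  by (auto intro!: mop_eqI hil_eqI simp: ap_add_mop elim!: evenE oddE)

lemma in_out_cancel_left [simp]:
  "even_out * (even_in * x) = (x :: 'a::cstar_algebra mop)" "odd_out * (odd_in * x) = x"
  "even_out * (odd_in * x) = 0" "odd_out * (even_in * x) = 0"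
  by (simp_all flip: mult.assoc add: even_out_even_in odd_out_odd_in even_out_odd_in odd_out_even_in)

declare even_out_even_in [simp] odd_out_odd_in [simp] even_out_odd_in [simp] odd_out_even_in [simp]

lemma trunc_expand: "ap (trunc m) z = (\<Sum>i<m. rmul (unit_vec i) (seq z i))"
proof (rule hil_eqI)
  fix n
  have "(\<Sum>i<m. (if n = i then 1 else 0) * seq z i) = (\<Sum>i<m. if n = i then seq z i else 0)"
    by (rule sum.cong) auto
  then show "seq (ap (trunc m) z) n = seq (\<Sum>i<m. rmul (unit_vec i) (seq z i)) n" by (simp add: sum.delta')
qed

text \<open>The operators that factor through some \<open>\<A>\<^sup>m\<close>; the idempotents among them are the projections
  onto finitely generated summands.\<close>

definition fin_ops :: "'a::cstar_algebra mop set" where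
  "fin_ops = {x * trunc m * y | x y m. True}"

lemma fin_opsI: "x * trunc m * y \<in> fin_ops" unfolding fin_ops_def by blast

lemma fin_ops_mult: "a * k \<in> fin_ops" "k * a \<in> fin_ops" if "k \<in> fin_ops"
proof -
  from that obtain x y m where k: "k = x * trunc m * y" unfolding fin_ops_def by blast
  show "a * k \<in> fin_ops" "k * a \<in> fin_ops"
    using fin_opsI[of "a * x" m y] fin_opsI[of x m "y * a"] by (simp_all add: k mult.assoc)
qed

text \<open>Two operators that factor through \<open>\<A>\<^sup>M\<close> are placed side by side on the even and odd coordinates, and
  their sum factors through \<open>\<A>\<^sup>2\<^sup>M\<close>.\<close>

lemma fin_ops_add: assumes "k \<in> fin_ops" "l \<in> fin_ops" shows "k + l \<in> fin_ops"
proof -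
  obtain x y m x' y' m' where k: "k = x * trunc m * y" and l: "l = x' * trunc m' * y'"
    using assms unfolding fin_ops_def by blast
  define M where "M = max m m'"
  have "trunc m = (trunc m * trunc M :: 'a mop)" "trunc m' = (trunc m' * trunc M :: 'a mop)"
    by (simp_all add: trunc_mult M_def)
  then have "k + l = x * trunc m * trunc M * y + x' * trunc m' * trunc M * y'"
    by (simp add: k l mult.assoc)
  also have "\<dots> = (x * trunc m * even_out + x' * trunc m' * odd_out) * trunc (2 * M) * (even_in * y + odd_in * y')"
    by (simp add: distrib_left distrib_right mult.assoc flip: trunc_double)
  finally show ?thesis by (simp add: fin_opsI)
qed

lemma fin_ops_0 [simp]: "0 \<in> fin_ops" using fin_opsI[of 0] by simp

lemma fin_ops_diff: "k \<in> fin_ops \<Longrightarrow> l \<in> fin_ops \<Longrightarrow> k - l \<in> fin_ops"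
  using fin_ops_add[of k "(- 1) * l"] fin_ops_mult(1)[of l "- 1"] by simp

lemma trunc_fin_ops [simp]: "trunc m \<in> fin_ops" using fin_opsI[of 1 m 1] by simp

text \<open>The power \<open>odd_out\<^sup>N\<close> reads only coordinates beyond \<open>2\<^sup>N - 2\<close>, so it tends to zero at each vector
  and hence in norm against operators that factor through some \<open>\<A>\<^sup>m\<close>.\<close>

lemma odd_out_power_vec_tendsto_0: "(\<lambda>N. ap (odd_out ^ N) z) \<longlonglongrightarrow> 0"
proof (rule metric_LIMSEQ_I)
  fix e :: real assume "e > 0"
  then have e2: "e / 2 > 0" by simp
  have "seq z \<in> HA" by simp
  from this[unfolded HA_iff, rule_format, OF e2]
  obtain M where M: "\<And>I. finite I \<Longrightarrow> I \<subseteq> {M..} \<Longrightarrow> seq_norm I (seq z) < e / 2" by blast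
  have idx: "seq (ap (odd_out ^ N) z) n = seq z (2 ^ N * (n + 1) - 1)" for N n
  proof (induction N arbitrary: n)
    case (Suc N)
    have "2 ^ N * (2 * n + 1 + 1) - 1 = (2::nat) ^ Suc N * (n + 1) - 1" by simp
    then show ?case by (simp add: Suc)
  qed simp
  have "norm (ap (odd_out ^ N) z) < e" if "N \<ge> M" for N
  proof -
    have inj: "inj_on (\<lambda>n. 2 ^ N * (n + 1) - 1) I" for I :: "nat set"
    proof (rule inj_onI)
      fix x y :: nat assume "2 ^ N * (x + 1) - 1 = 2 ^ N * (y + 1) - (1::nat)"
      moreover have "(2::nat) ^ N * (x + 1) > 0" "(2::nat) ^ N * (y + 1) > 0" by simp_all
      ultimately have "(2::nat) ^ N * (x + 1) = 2 ^ N * (y + 1)" by linarith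
      then show "x = y" by simp
    qed
    have "seq_norm {..<k} (seq (ap (odd_out ^ N) z)) \<le> e / 2" for k
    proof -
      have "seq_norm {..<k} (seq (ap (odd_out ^ N) z)) = seq_norm ((\<lambda>n. 2 ^ N * (n + 1) - 1) ` {..<k}) (seq z)"
        unfolding seq_norm_reindex[OF inj, symmetric] by (rule seq_norm_cong) (rule idx)
      also have "\<dots> < e / 2"
      proof (rule M)
        have "M \<le> 2 ^ N * (n + 1) - 1" for n
        proof -
          have "M < 2 ^ M" by (rule less_exp)
          also have "(2::nat) ^ M \<le> 2 ^ N" using that by simp
          also have "\<dots> \<le> 2 ^ N * (n + 1)" by simp
          finally show ?thesis by simp
        qed
        then show "(\<lambda>n. 2 ^ N * (n + 1) - 1) ` {..<k} \<subseteq> {M..}" by auto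
      qed simp
      finally show ?thesis by simp
    qed
    then have "norm (ap (odd_out ^ N) z) \<le> e / 2" by (rule norm_hil_le)
    then show ?thesis using \<open>e > 0\<close> by simp
  qed
  then show "\<exists>M. \<forall>N\<ge>M. dist (ap (odd_out ^ N) z) 0 < e" by auto
qed

lemma odd_out_power_fin_ops_tendsto_0:
  assumes "k \<in> fin_ops" shows "(\<lambda>N. odd_out ^ N * k) \<longlonglongrightarrow> 0"
proof -
  obtain x y m where k: "k = x * trunc m * y" using assms unfolding fin_ops_def by blast
  define B where "B N = (\<Sum>i<m. norm (ap (odd_out ^ N) (ap x (unit_vec i))))" for N
  have "norm (odd_out ^ N * x * trunc m) \<le> B N" for N
  proof (rule norm_mop_le)
    fix z :: "'a hil"
    have "ap (odd_out ^ N * x * trunc m) z = (\<Sum>i<m. rmul (ap (odd_out ^ N) (ap x (unit_vec i))) (seq z i))"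
      by (simp add: trunc_expand ap_sum ap_rmul)
    also have "norm \<dots> \<le> (\<Sum>i<m. norm (ap (odd_out ^ N) (ap x (unit_vec i))) * norm z)"
      by (intro sum_norm_le order_trans[OF norm_rmul_le] mult_left_mono norm_seq_le) auto
    finally show "norm (ap (odd_out ^ N * x * trunc m) z) \<le> B N * norm z" by (simp add: B_def sum_distrib_right)
  qed (simp add: B_def sum_nonneg)
  then have b: "norm (odd_out ^ N * x * trunc m * y) \<le> B N * norm y" for N
    by (meson norm_mult_ineq order_trans mult_right_mono norm_ge_zero)
  have "(\<lambda>N. B N * norm y) \<longlonglongrightarrow> (\<Sum>i<m. 0) * norm y"
    unfolding B_def by (intro tendsto_intros tendsto_norm_zero odd_out_power_vec_tendsto_0)
  then have lim: "(\<lambda>N. B N * norm y) \<longlonglongrightarrow> 0" by simp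
  have "(\<lambda>N. odd_out ^ N * x * trunc m * y) \<longlonglongrightarrow> 0"
    by (rule Lim_null_comparison[OF _ lim]) (simp add: b)
  then show ?thesis by (simp add: k mult.assoc)
qed

section \<open>The monoid of isomorphism classes of summands\<close>

definition idem :: "'a::ring_1 \<Rightarrow> bool" where "idem p \<longleftrightarrow> p * p = p"

text \<open>Murray-von Neumann equivalence of idempotents, which amounts to isomorphism of their ranges.\<close>

definition mvn :: "'a::cstar_algebra mop \<Rightarrow> 'a mop \<Rightarrow> bool" where
  "mvn p q \<longleftrightarrow> idem p \<and> idem q \<and> (\<exists>u v. u * v = p \<and> v * u = q)"

lemma mvnI: "idem p \<Longrightarrow> idem q \<Longrightarrow> u * v = p \<Longrightarrow> v * u = q \<Longrightarrow> mvn p q"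
  unfolding mvn_def by blast

lemma mvn_refl: "idem p \<Longrightarrow> mvn p p"
  by (rule mvnI[of p p p p]) (auto simp: idem_def)

lemma mvn_sym: "mvn p q \<Longrightarrow> mvn q p"
  unfolding mvn_def by blast

lemma mvn_trans: assumes "mvn p q" "mvn q r" shows "mvn p r"
proof -
  obtain u v u' v' where *: "u * v = p" "v * u = q" "u' * v' = q" "v' * u' = r"
    and i: "idem p" "idem r"
    using assms unfolding mvn_def by blast
  show ?thesis
  proof (rule mvnI)
    have "u * u' * (v' * v) = u * (u' * v') * v" by (simp add: mult.assoc)
    also have "\<dots> = (u * v) * (u * v)" unfolding *(3) by (simp add: *(2)[symmetric] mult.assoc)
    finally show "u * u' * (v' * v) = p" using i by (simp add: *(1) idem_def)
    have "v' * v * (u * u') = v' * (v * u) * u'" by (simp add: mult.assoc)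
    also have "\<dots> = (v' * u') * (v' * u')" unfolding *(2) by (simp add: *(3)[symmetric] mult.assoc)
    finally show "v' * v * (u * u') = r" using i by (simp add: *(4) idem_def)
  qed (use i in auto)
qed

text \<open>Block matrices over \<open>B\<close>, read as operators on \<open>H\<close> through the interleaving \<open>H \<cong> H \<oplus> H\<close>.\<close>

definition mat :: "'a::cstar_algebra mop \<Rightarrow> 'a mop \<Rightarrow> 'a mop \<Rightarrow> 'a mop \<Rightarrow> 'a mop" where
  "mat a b c d = even_in * a * even_out + even_in * b * odd_out + odd_in * c * even_out + odd_in * d * odd_out"

lemma mat_mult: "mat a b c d * mat a' b' c' d' = mat (a * a' + b * c') (a * b' + b * d') (c * a' + d * c') (c * b' + d * d')"
  by (simp add: mat_def algebra_simps)

definition oplus :: "'a::cstar_algebra mop \<Rightarrow> 'a mop \<Rightarrow> 'a mop" where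
  "oplus p q = mat p 0 0 q"

lemma idem_oplus: "idem p \<Longrightarrow> idem q \<Longrightarrow> idem (oplus p q)"
  by (simp add: idem_def oplus_def mat_mult)

lemma idem_0 [simp]: "idem 0" by (simp add: idem_def)

lemma mvn_oplus: assumes "mvn p q" "mvn p' q'" shows "mvn (oplus p p') (oplus q q')"
proof -
  obtain u v u' v' where *: "u * v = p" "v * u = q" "u' * v' = p'" "v' * u' = q'"
    and i: "idem p" "idem q" "idem p'" "idem q'"
    using assms unfolding mvn_def by blast
  show ?thesis
    by (rule mvnI[where u = "mat u 0 0 u'" and v = "mat v 0 0 v'"])
       (auto simp: i idem_oplus, auto simp: oplus_def mat_mult *)
qed

lemma mvn_oplus_commute: assumes "idem p" "idem q" shows "mvn (oplus p q) (oplus q p)"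
  by (rule mvnI[where u = "mat 0 p q 0" and v = "mat 0 q p 0"])
     (use assms in \<open>auto simp: idem_oplus\<close>, use assms in \<open>auto simp: oplus_def mat_mult idem_def\<close>)

lemma mvn_oplus_assoc:
  assumes "idem p" "idem q" "idem r"
  shows "mvn (oplus (oplus p q) r) (oplus p (oplus q r))"
proof -
  have *: "p * p = p" "q * q = q" "r * r = r" "p * (p * z) = p * z" "q * (q * z) = q * z" "r * (r * z) = r * z" for z
    using assms by (simp_all add: idem_def flip: mult.assoc)
  show ?thesis
    by (rule mvnI[where u = "even_in * even_in * p * even_out + even_in * odd_in * q * even_out * odd_out + odd_in * r * odd_out * odd_out"
          and v = "even_in * p * even_out * even_out + odd_in * even_in * q * odd_out * even_out + odd_in * odd_in * r * odd_out"])
       (use assms in \<open>auto simp: idem_oplus\<close>, auto simp: oplus_def mat_def algebra_simps *)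
qed

lemma mvn_oplus_0: assumes "idem p" shows "mvn (oplus 0 p) p"
proof -
  have *: "p * p = p" "p * (p * z) = p * z" for z
    using assms by (simp_all add: idem_def flip: mult.assoc)
  show ?thesis
    by (rule mvnI[where u = "odd_in * p" and v = "p * odd_out"])
       (use assms in \<open>auto simp: idem_oplus\<close>, auto simp: oplus_def mat_def mult.assoc *)
qed

text \<open>The classes of all idempotents, finitely generated or not, form a commutative monoid; identities between
  direct sums of submodules become identities that the simplifier proves by commutativity.\<close>

quotient_type (overloaded) 'a vcls = "'a::cstar_algebra mop" / partial: mvn morphisms rep_vcls cls
  by (rule part_equivpI) (auto intro!: exI[of _ 0] mvn_refl sympI transpI elim: mvn_sym mvn_trans)

lemma cls_eq_iff: "idem p \<Longrightarrow> idem q \<Longrightarrow> cls p = cls q \<longleftrightarrow> mvn p q"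
  using Quotient_rel[OF Quotient_vcls] mvn_refl by blast

lemma cls_cases: obtains p where "x = cls p" "idem p"
  by (metis Quotient_abs_rep[OF Quotient_vcls] Quotient_rep_reflp[OF Quotient_vcls] mvn_def)

instantiation vcls :: (cstar_algebra) comm_monoid_add
begin

lift_definition zero_vcls :: "'a vcls" is 0 by (rule mvn_refl) simp
lift_definition plus_vcls :: "'a vcls \<Rightarrow> 'a vcls \<Rightarrow> 'a vcls" is oplus by (rule mvn_oplus)

instance
proof
  fix a b c :: "'a vcls"
  show "a + b + c = a + (b + c)" by transfer (auto simp: mvn_def[of x x for x] intro: mvn_oplus_assoc)
  show "a + b = b + a" by transfer (auto simp: mvn_def[of x x for x] intro: mvn_oplus_commute)
  show "0 + a = a" by transfer (auto simp: mvn_def[of x x for x] intro: mvn_oplus_0)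
qed

end

lemma cls_oplus: "idem p \<Longrightarrow> idem q \<Longrightarrow> cls (oplus p q) = cls p + cls q"
  by (rule plus_vcls.abs_eq[symmetric]) (auto intro: mvn_refl)

lemma cls_0: "cls 0 = 0" by (rule zero_vcls.abs_eq[symmetric])

lemma cls_eqI: "idem p \<Longrightarrow> idem q \<Longrightarrow> u * v = p \<Longrightarrow> v * u = q \<Longrightarrow> cls p = cls q"
  by (simp add: cls_eq_iff mvnI)

lemma cls_orthogonal_sum:
  assumes "idem p" "idem q" "p * q = 0" "q * p = 0"
  shows "idem (p + q)" "cls (p + q) = cls p + cls q"
proof -
  show i: "idem (p + q)" using assms by (simp add: idem_def algebra_simps)
  have *: "p * p = p" "q * q = q" "p * (p * z) = p * z" "q * (q * z) = q * z" "p * (q * z) = 0" "q * (p * z) = 0" for z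
    using assms by (simp_all add: idem_def flip: mult.assoc)
  have "cls (oplus p q) = cls (p + q)"
  proof (rule cls_eqI)
    show "(even_in * p + odd_in * q) * (p * even_out + q * odd_out) = oplus p q"
      "(p * even_out + q * odd_out) * (even_in * p + odd_in * q) = p + q"
      using assms by (simp_all add: oplus_def mat_def algebra_simps *)
  qed (use i assms idem_oplus in auto)
  then show "cls (p + q) = cls p + cls q" using assms by (simp add: cls_oplus)
qed

definition fincls :: "'a::cstar_algebra vcls set" where
  "fincls = {cls p | p. idem p \<and> p \<in> fin_ops}"

lemma fin_ops_mvn: assumes "mvn p q" "p \<in> fin_ops" shows "q \<in> fin_ops"
proof -
  obtain u v where *: "u * v = p" "v * u = q" "idem q" using assms(1) unfolding mvn_def by blast
  have "v * (p * u) = (v * u) * (v * u)" unfolding *(1)[symmetric] mult.assoc ..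
  then have q: "v * (p * u) = q" using *(3) by (simp add: *(2) idem_def)
  have "v * (p * u) \<in> fin_ops" by (intro fin_ops_mult assms(2))
  then show ?thesis by (simp only: q)
qed

lemma cls_in_fincls_iff: "idem p \<Longrightarrow> cls p \<in> fincls \<longleftrightarrow> p \<in> fin_ops"
proof -
  assume p: "idem p"
  have "p \<in> fin_ops" if "cls p = cls q" "idem q" "q \<in> fin_ops" for q
    using fin_ops_mvn[of q p] that cls_eq_iff[OF that(2) p] by simp
  then show ?thesis unfolding fincls_def using p by blast
qed

lemma fincls_add: assumes "a \<in> fincls" "b \<in> fincls" shows "a + b \<in> fincls"
proof -
  obtain p q where *: "a = cls p" "idem p" "p \<in> fin_ops" "b = cls q" "idem q" "q \<in> fin_ops"
    using assms unfolding fincls_def by blast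
  have "oplus p q \<in> fin_ops" using * by (simp add: oplus_def mat_def fin_ops_add fin_ops_mult mult.assoc)
  then show ?thesis unfolding fincls_def using * cls_oplus idem_oplus by (metis (mono_tags, lifting) mem_Collect_eq)
qed

lemma fincls_0: "0 \<in> fincls"
  unfolding fincls_def using cls_0 idem_0 fin_ops_0 by (metis (mono_tags, lifting) mem_Collect_eq)

section \<open>Outer inverses\<close>

text \<open>If \<open>GFG = G\<close>, then \<open>1 - GF\<close> and \<open>1 - FG\<close> project onto a kernel and a cokernel of \<open>F\<close>: \<open>F\<close> is an
  isomorphism from the range of \<open>GF\<close> to that of \<open>FG\<close>, with inverse \<open>G\<close>.\<close>

lemma outer_inverse_idem:
  fixes F G :: "'r::ring_1"
  assumes "G * F * G = G"
  shows "idem (1 - G * F)" "idem (1 - F * G)" "idem (G * F)" "idem (F * G)"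
proof -
  have "G * (F * G) = G" "G * (F * (G * z)) = G * z" for z
    using assms by (simp_all flip: mult.assoc)
  then show "idem (1 - G * F)" "idem (1 - F * G)" "idem (G * F)" "idem (F * G)"
    by (simp_all add: idem_def algebra_simps)
qed

text \<open>The perturbed outer inverse is \<open>G' = G (1 + (F' - F) G)\<^sup>-\<^sup>1\<close>. It satisfies \<open>G'F'G = G = GF'G'\<close>, so \<open>1 - GF\<close> and
  \<open>1 - G'F'\<close> absorb each other on one side, and similarly for the cokernels; such idempotents are
  equivalent.\<close>

lemma outer_inverse_perturb:
  fixes F F' G :: "'a::cstar_algebra mop"
  assumes GFG: "G * F * G = G" and small: "norm (F' - F) * norm G < 1"
  obtains G' where "G' * F' * G' = G'" "cls (1 - G' * F') = cls (1 - G * F)" "cls (1 - F' * G') = cls (1 - F * G)"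
proof -
  define d where "d = F' - F"
  have F': "F' = F + d" by (simp add: d_def)
  have "norm (- (d * G)) < 1"
    using norm_mult_ineq[of d G] small by (simp add: d_def)
  then obtain w where "(1 - - (d * G)) * w = 1" "w * (1 - - (d * G)) = 1"
    by (rule mop_one_minus_invertible)
  then have w: "d * (G * w) = 1 - w" "w * (d * G) = 1 - w" by (simp_all add: algebra_simps)
  have g: "G * (F * G) = G" using GFG by (simp add: mult.assoc)
  have g2: "G * (F * (G * z)) = G * z" for z using GFG by (simp flip: mult.assoc)
  define G' where "G' = G * w"
  have a: "G * w * (F * G) = G * w"
  proof -
    have "w = 1 - w * d * G" using w(2) by (simp add: mult.assoc)
    then have "G * w * (F * G) = G * (1 - w * d * G) * (F * G)" by metis
    also have "\<dots> = G * (1 - w * d * G)" by (simp add: algebra_simps g)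
    also have "\<dots> = G * w" using w(2) by (simp add: mult.assoc)
    finally show ?thesis .
  qed
  have b: "G' * F' * G = G"
  proof -
    have "G' * F' * G = G * w * (F * G) + G * (w * (d * G))" by (simp add: G'_def F' algebra_simps)
    then show ?thesis unfolding a w(2) by (simp add: algebra_simps)
  qed
  have c: "G * F' * G' = G"
  proof -
    have "G * F' * G' = G * F * G * w + G * (d * (G * w))" by (simp add: G'_def F' algebra_simps)
    then show ?thesis unfolding GFG w(1) by (simp add: algebra_simps)
  qed
  have e: "G' * F' * G' = G'" using b by (simp add: G'_def flip: mult.assoc)
  have 1: "(1 - G * F) * G' = 0" by (simp add: G'_def algebra_simps g2)
  have 2: "G' * (1 - F * G) = 0" using a by (simp add: G'_def algebra_simps)
  show thesis
  proof (rule that)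
    show "cls (1 - G' * F') = cls (1 - G * F)"
    proof (rule cls_eqI)
      have "(1 - G' * F') * (1 - G * F) = (1 - G' * F') - (G - G' * F' * G) * F" by (simp add: algebra_simps)
      then show "(1 - G' * F') * (1 - G * F) = 1 - G' * F'" by (simp add: b)
      have "(1 - G * F) * (1 - G' * F') = (1 - G * F) - (1 - G * F) * G' * F'" by (simp add: algebra_simps)
      then show "(1 - G * F) * (1 - G' * F') = 1 - G * F" by (simp add: 1)
    qed (use outer_inverse_idem[OF e] outer_inverse_idem[OF GFG] in auto)
    show "cls (1 - F' * G') = cls (1 - F * G)"
    proof (rule cls_eqI)
      have "(1 - F' * G') * (1 - F * G) = (1 - F * G) - F' * (G' * (1 - F * G))" by (simp add: algebra_simps)
      then show "(1 - F' * G') * (1 - F * G) = 1 - F * G" by (simp add: 2)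
      have "(1 - F * G) * (1 - F' * G') = (1 - F' * G') - F * (G - G * F' * G')" by (simp add: algebra_simps)
      then show "(1 - F * G) * (1 - F' * G') = 1 - F' * G'" by (simp add: c)
    qed (use outer_inverse_idem[OF e] outer_inverse_idem[OF GFG] in auto)
  qed (rule e)
qed

text \<open>Modulo the ideal, \<open>G\<close> is a right inverse and \<open>G'\<close> a left inverse of \<open>F\<close>, so both are two-sided.\<close>

lemma cokernel_fin_ops_transfer:
  assumes "1 - F * G \<in> fin_ops" "1 - G' * F \<in> fin_ops"
  shows "1 - F * G' \<in> fin_ops"
proof -
  have "1 - F * G' = (1 - F * G) + F * ((1 - G' * F) * G - G' * (1 - F * G))"
    by (simp add: algebra_simps)
  then show ?thesis using assms by (metis fin_ops_add fin_ops_diff fin_ops_mult)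
qed

text \<open>Consider an isomorphism \<open>H \<oplus> p \<rightarrow> H \<oplus> q\<close> with rows \<open>(1 + xey, b)\<close> and \<open>(c, d)\<close>, and its
  inverse with rows \<open>(a, h)\<close> and \<open>(g, l)\<close>. After adding the identity of \<open>e\<close>, row and column operations
  with \<open>x\<close> and \<open>y\<close> turn the corner into \<open>1\<close>; the Schur complement \<open>S\<close> of that corner is then an isomorphism \<open>e \<oplus> p \<rightarrow> e \<oplus> q\<close>. Its inverse \<open>T\<close> is the
  complementary block of the inverse matrix.\<close>

lemma corner_complement_classes:
  fixes a :: "'a::cstar_algebra mop"
  assumes idem: "idem e" "idem p" "idem q"
    and UV: "(1 + x * e * y) * a + b * g = 1" "(1 + x * e * y) * h + b * l = 0" "c * a + d * g = 0" "c * h + d * l = q"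
    and VU: "a * (1 + x * e * y) + h * c = 1" "a * b + h * d = 0" "g * (1 + x * e * y) + l * c = 0" "g * b + l * d = p"
  shows "cls e + cls p = cls e + cls q"
proof -
  have e: "e * e = e" "e * (e * z) = e * z" for z using idem(1) by (simp_all add: idem_def flip: mult.assoc)
  define S where "S = mat (e + e * y * x * e) (e * y * b) (- (c * x * e)) (d - c * b)"
  define T where "T = mat (e - e * y * a * x * e) (e * y * h) (- (g * x * e)) l"
  have ST: "S * T = oplus e q"
  proof -
    have "(e + e * y * x * e) * (e - e * y * a * x * e) + e * y * b * - (g * x * e)
        = e + e * y * (1 - ((1 + x * e * y) * a + b * g)) * x * e" by (simp add: algebra_simps e)
    moreover have "(e + e * y * x * e) * (e * y * h) + e * y * b * l = e * y * ((1 + x * e * y) * h + b * l)"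
      by (simp add: algebra_simps e)
    moreover have "- (c * x * e) * (e - e * y * a * x * e) + (d - c * b) * - (g * x * e)
        = c * ((1 + x * e * y) * a + b * g - 1) * x * e - (c * a + d * g) * x * e" by (simp add: algebra_simps e)
    moreover have "- (c * x * e) * (e * y * h) + (d - c * b) * l = (c * h + d * l) - c * ((1 + x * e * y) * h + b * l)"
      by (simp add: algebra_simps e)
    ultimately show ?thesis unfolding S_def T_def mat_mult oplus_def UV by simp
  qed
  have TS: "T * S = oplus e p"
  proof -
    have "(e - e * y * a * x * e) * (e + e * y * x * e) + e * y * h * - (c * x * e)
        = e + e * y * (1 - (a * (1 + x * e * y) + h * c)) * x * e" by (simp add: algebra_simps e)
    moreover have "(e - e * y * a * x * e) * (e * y * b) + e * y * h * (d - c * b)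
        = e * y * (1 - (a * (1 + x * e * y) + h * c)) * b + e * y * (a * b + h * d)" by (simp add: algebra_simps e)
    moreover have "- (g * x * e) * (e + e * y * x * e) + l * - (c * x * e)
        = - (g * (1 + x * e * y) + l * c) * x * e" by (simp add: algebra_simps e)
    moreover have "- (g * x * e) * (e * y * b) + l * (d - c * b) = (g * b + l * d) - (g * (1 + x * e * y) + l * c) * b"
      by (simp add: algebra_simps e)
    ultimately show ?thesis unfolding S_def T_def mat_mult oplus_def VU by simp
  qed
  have "cls (oplus e p) = cls (oplus e q)" by (rule cls_eqI[OF _ _ TS ST]) (use idem idem_oplus in auto)
  then show ?thesis using idem by (simp add: cls_oplus)
qed

text \<open>An outer inverse \<open>G\<close> gives an isomorphism \<open>(x, y) \<mapsto> (FGFx + y, (1 - GF)x)\<close> from \<open>H \<oplus> (1 - FG)\<close> to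
  \<open>H \<oplus> (1 - GF)\<close>, with inverse \<open>(z, w) \<mapsto> (Gz + w, (1 - FG)z)\<close>. Following the one for \<open>G\<close> by the inverse of the one for
  \<open>G'\<close>, each extended by the identity on the other kernel, yields an isomorphism
  \<open>H \<oplus> (1 - FG) \<oplus> (1 - G'F) \<rightarrow> H \<oplus> (1 - FG') \<oplus> (1 - GF)\<close> whose corner \<open>G'FGF\<close> is \<open>1\<close> up to an operator
  that factors through some \<open>\<A>\<^sup>m\<close>. Now \<open>corner_complement_classes\<close> applies.\<close>

theorem index_independent:
  fixes F :: "'a::cstar_algebra mop"
  assumes G: "G * F * G = G" "1 - G * F \<in> fin_ops" and G': "G' * F * G' = G'" "1 - G' * F \<in> fin_ops"
  obtains r where "r \<in> fincls"
    "r + cls (1 - G * F) + cls (1 - F * G') = r + cls (1 - G' * F) + cls (1 - F * G)"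
proof -
  have g: "G * (F * G) = G" "G * (F * (G * z)) = G * z" "G' * (F * G') = G'" "G' * (F * (G' * z)) = G' * z" for z
    using G(1) G'(1) by (simp_all flip: mult.assoc)
  have "1 - G' * F * G * F = (1 - G' * F) + G' * F * (1 - G * F)" by (simp add: algebra_simps)
  then have "1 - G' * F * G * F \<in> fin_ops" using G(2) G'(2) by (metis fin_ops_add fin_ops_mult(1))
  then have "(- 1) * (1 - G' * F * G * F) \<in> fin_ops" by (rule fin_ops_mult)
  then obtain x m y where "(- 1) * (1 - G' * F * G * F) = x * trunc m * y" unfolding fin_ops_def by blast
  then have k: "1 + x * trunc m * y = G' * F * G * F" by (simp add: algebra_simps)
  note i = outer_inverse_idem[OF G(1)] outer_inverse_idem[OF G'(1)]
  have e: "idem (trunc m :: 'a mop)" by (simp add: idem_def trunc_mult)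
  have "cls (trunc m) + cls (oplus (1 - F * G) (1 - G' * F)) = cls (trunc m) + cls (oplus (1 - F * G') (1 - G * F))"
  proof (rule corner_complement_classes[where x = x and y = y
        and a = "G * F * G' * F"
        and b = "G' * (1 - F * G) * even_out + (1 - G' * F) * odd_out"
        and c = "even_in * (1 - F * G') * F * G * F + odd_in * (1 - G * F)"
        and d = "even_in * (1 - F * G') * (1 - F * G) * even_out"
        and h = "G * (1 - F * G') * even_out + (1 - G * F) * odd_out"
        and g = "even_in * (1 - F * G) * F * G' * F + odd_in * (1 - G' * F)"
        and l = "even_in * (1 - F * G) * (1 - F * G') * even_out"], unfold k)
  qed (use e i in \<open>simp_all add: idem_oplus\<close>, simp_all add: oplus_def mat_def algebra_simps g)
  then have "cls (trunc m) + cls (1 - G * F) + cls (1 - F * G') = cls (trunc m) + cls (1 - G' * F) + cls (1 - F * G)"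
    using i by (simp add: cls_oplus add_ac)
  then show thesis using that e cls_in_fincls_iff trunc_fin_ops by metis
qed

text \<open>The complement of a finitely generated summand contains a copy \<open>s\<close> of every summand \<open>r\<close>: push \<open>r\<close> out along
  a power of \<open>odd_in\<close> and project back to the range of \<open>GF\<close>. By \<open>odd_out_power_fin_ops_tendsto_0\<close> the projection
  changes little when the result is pulled back by \<open>odd_out\<close>, so nothing is lost for a large power. Then \<open>s\<close> is
  moved from the range of \<open>GF\<close> to the kernel, and its image under \<open>F\<close> to the cokernel.\<close>

theorem enlarge_outer_inverse:
  fixes F :: "'a::cstar_algebra mop"
  assumes G: "G * F * G = G" "1 - G * F \<in> fin_ops" and r: "idem r"
  obtains G' where "G' * F * G' = G'" "cls (1 - G' * F) = cls (1 - G * F) + cls r"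
    "cls (1 - F * G') = cls (1 - F * G) + cls r"
proof -
  define n where "n = 1 - G * F"
  have g: "G * (F * G) = G" "G * (F * (G * z)) = G * z" for z
    using G(1) by (simp_all flip: mult.assoc)
  have rr: "r * r = r" "r * (r * z) = r * z" for z using r by (simp_all add: idem_def flip: mult.assoc)
  have "(\<lambda>N. norm r * norm (odd_out ^ N * n) * norm r) \<longlonglongrightarrow> norm r * norm (0 :: 'a mop) * norm r"
    by (intro tendsto_intros odd_out_power_fin_ops_tendsto_0) (use G in \<open>simp add: n_def\<close>)
  then have "\<forall>\<^sub>F N in sequentially. norm r * norm (odd_out ^ N * n) * norm r < 1"
    by (intro order_tendstoD) auto
  then obtain N where N: "norm r * norm (odd_out ^ N * n) * norm r < 1"
    using eventually_happens' sequentially_bot by blast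
  have oN: "odd_out ^ N * odd_in ^ N = (1 :: 'a mop)"
  proof (induction N)
    case (Suc N)
    have "odd_out ^ Suc N = odd_out ^ N * (odd_out :: 'a mop)" by (rule power_Suc2)
    then have "odd_out ^ Suc N * odd_in ^ Suc N = odd_out ^ N * ((odd_out :: 'a mop) * odd_in) * odd_in ^ N"
      by (simp only: power_Suc mult.assoc)
    then show ?case using Suc by simp
  qed simp
  have nO: "norm ((odd_in :: 'a mop) ^ N) \<le> 1"
    by (rule order_trans[OF norm_power_ineq power_le_one[OF norm_ge_zero norm_odd_in]])
  define k where "k = r * odd_out ^ N * n * odd_in ^ N * r"
  have "norm k \<le> norm (r * (odd_out ^ N * n) * odd_in ^ N) * norm r"
    unfolding k_def mult.assoc by (simp only: norm_mult_ineq flip: mult.assoc)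
  also have "\<dots> \<le> (norm r * norm (odd_out ^ N * n) * 1) * norm r"
    by (intro mult_right_mono order_trans[OF norm_mult_ineq] mult_mono nO norm_mult_ineq) auto
  also have "\<dots> < 1" using N by simp
  finally obtain z where z: "(1 - k) * z = 1" "z * (1 - k) = 1" by (rule mop_one_minus_invertible)
  have rk: "r * k = k" "k * r = k" "r * (k * z) = k * z" "k * (r * z) = k * z" for z
    by (simp_all add: k_def rr mult.assoc)
  have rz: "z * r = r * z"
  proof -
    have "z * r = z * r * ((1 - k) * z)" by (simp add: z)
    also have "\<dots> = z * (1 - k) * r * z" by (simp add: algebra_simps rk)
    finally show ?thesis by (simp add: z)
  qed
  define m where "m = G * F"
  have mm: "m * m = m" "m * (m * z) = m * z" for z by (simp_all add: m_def mult.assoc g)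
  define u where "u = m * odd_in ^ N * r * z"
  define v where "v = r * odd_out ^ N * m"
  have "r - k = r * odd_out ^ N * (1 - n) * odd_in ^ N * r"
    using oN by (simp add: k_def algebra_simps rr)
  then have rmk: "r - k = r * odd_out ^ N * m * odd_in ^ N * r" by (simp add: n_def m_def)
  have vu: "v * u = r"
  proof -
    have "v * u = r * odd_out ^ N * (m * m) * odd_in ^ N * r * z" by (simp add: u_def v_def mult.assoc)
    also have "\<dots> = (r - k) * z" unfolding rmk mm(1) ..
    also have "\<dots> = r * ((1 - k) * z)" by (simp add: algebra_simps rk flip: mult.assoc)
    finally show ?thesis by (simp add: z)
  qed
  define s where "s = u * v"
  have ur: "u * r = u" using rz by (simp add: u_def mult.assoc rr)
  have si: "idem s" unfolding idem_def s_def using vu ur by (metis mult.assoc)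
  then have ss: "s * s = s" "s * (s * z) = s * z" for z by (simp_all add: idem_def flip: mult.assoc)
  have s: "cls s = cls r" by (rule cls_eqI[of _ _ u v]) (use si r vu s_def in auto)
  have ms: "m * s = s" "s * m = s" by (simp_all add: s_def u_def v_def mm mult.assoc)
  then have s1: "G * (F * s) = s" "s * (G * F) = s" "s * (G * (F * z)) = s * z" "G * (F * (s * z)) = s * z" for z
    by (simp_all add: m_def flip: mult.assoc)
  define G' where "G' = (m - s) * G"
  have G'F: "G' * F = m - s" by (simp add: G'_def algebra_simps s1) (simp add: m_def mult.assoc g)
  have mG: "m * G = G" by (simp add: m_def G)
  have FG': "F * G' = F * G - F * s * G" by (simp add: G'_def algebra_simps mG)
  show thesis
  proof
    show "G' * F * G' = G'" unfolding G'F by (simp add: G'_def algebra_simps ms ss mG mm) (simp add: ms flip: mult.assoc)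
    have "cls ((1 - m) + s) = cls (1 - m) + cls s"
      by (rule cls_orthogonal_sum) (use si ms in \<open>simp_all add: idem_def algebra_simps mm\<close>)
    then show "cls (1 - G' * F) = cls (1 - G * F) + cls r"
      unfolding G'F s by (simp add: m_def algebra_simps)
    have iF: "idem (F * s * G)" by (simp add: idem_def mult.assoc s1 ss)
    have "cls ((1 - F * G) + F * s * G) = cls (1 - F * G) + cls (F * s * G)"
      by (rule cls_orthogonal_sum)
         (use outer_inverse_idem[OF G(1)] iF in \<open>simp_all add: algebra_simps s1 g\<close>)
    also have "cls (F * s * G) = cls s"
      by (rule cls_eqI[of _ _ "F * s" "s * G"]) (use iF si in \<open>simp_all add: mult.assoc s1 ss\<close>)
    finally show "cls (1 - F * G') = cls (1 - F * G) + cls r"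
      unfolding FG' s by (simp add: algebra_simps)
  qed
qed

section \<open>Open mapping and projections\<close>

text \<open>The Baire category theorem in \<open>f ` S\<close> gives a bound for approximate preimages with error at most half the
  norm of the target; repeating this with the errors and summing the preimages gives exact ones.\<close>

theorem open_mapping_closed_range:
  fixes f :: "'a::banach \<Rightarrow> 'b::banach"
  assumes f: "bounded_linear f" and S: "closed S" "subspace S" and Y: "closed (f ` S)"
  obtains C where "C > 0" "\<And>y. y \<in> f ` S \<Longrightarrow> \<exists>x\<in>S. f x = y \<and> norm x \<le> C * norm y"
proof -
  interpret f: bounded_linear f by fact
  define Y where "Y = f ` S"
  define T where "T n = closure (f ` (S \<inter> cball 0 (real n)))" for n
  have Y0: "0 \<in> Y" using S(2) f.zero unfolding Y_def subspace_def by force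
  have sY: "subspace Y" unfolding Y_def by (rule linear_subspace_image) (use S f.linear in auto)
  have TY: "T n \<subseteq> Y" for n unfolding T_def Y_def using Y by (intro closure_minimal) auto
  have YsubT: "Y \<subseteq> (\<Union>n. T n)"
  proof
    fix y assume "y \<in> Y"
    then obtain x where x: "x \<in> S" "f x = y" by (auto simp: Y_def)
    obtain n where "norm x \<le> real n" using real_arch_simple by blast
    then have "y \<in> f ` (S \<inter> cball 0 (real n))" using x by auto
    then have "y \<in> T n" unfolding T_def by (rule subsetD[OF closure_subset])
    then show "y \<in> (\<Union>n. T n)" by blast
  qed
  have YT: "\<Union>(range T) = Y" by (rule equalityI[OF UN_least[OF TY] YsubT])
  have cl: "closedin (top_of_set Y) (T n)" for n
    by (rule closed_subset[OF TY]) (simp add: T_def)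
  have clY: "closedin euclidean Y" using Y unfolding Y_def closed_closedin .
  have "\<exists>n. top_of_set Y interior_of T n \<noteq> {}"
  proof (rule ccontr)
    assume "\<not> ?thesis"
    then have "top_of_set Y interior_of \<Union>(range T) = {}"
      using cl by (intro Baire_category_alt disjI1 completely_metrizable_space_closedin[OF _ clY]
          completely_metrizable_space_euclidean) auto
    moreover have "top_of_set Y interior_of Y = Y" using interior_of_topspace[of "top_of_set Y"] by simp
    ultimately show False using Y0 YT by simp
  qed
  then obtain n y0 where "y0 \<in> top_of_set Y interior_of T n" by blast
  then obtain U where U: "openin (top_of_set Y) U" "y0 \<in> U" "U \<subseteq> T n" by (auto simp: interior_of_def)
  then obtain r where r: "r > 0" "ball y0 r \<inter> Y \<subseteq> U" and y0: "y0 \<in> Y"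
    unfolding openin_contains_ball by blast
  \<comment> \<open>\<open>y\<close> is the difference of the points \<open>y0 + y\<close> and \<open>y0\<close> of the same ball\<close>
  have close: "\<exists>x\<in>S. norm x \<le> 2 * real n \<and> norm (y - f x) < e" if y: "y \<in> Y" "norm y < r" and e: "e > 0" for y e
  proof -
    have "y0 + y \<in> ball y0 r \<inter> Y" "y0 \<in> ball y0 r \<inter> Y"
      using y y0 r sY by (auto simp: dist_norm subspace_add)
    then have "y0 + y \<in> T n" "y0 \<in> T n" using r U by blast+
    have approx: "\<exists>u\<in>S. norm u \<le> real n \<and> dist (f u) w < e / 2" if w: "w \<in> T n" for w
    proof -
      have "e / 2 > 0" using e by simp
      with w obtain z where "z \<in> f ` (S \<inter> cball 0 (real n))" "dist z w < e / 2"
        unfolding T_def closure_approachable by blast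
      then show ?thesis by auto
    qed
    from approx[OF \<open>y0 + y \<in> T n\<close>] obtain u where u: "u \<in> S" "norm u \<le> real n" "dist (f u) (y0 + y) < e / 2" by blast
    from approx[OF \<open>y0 \<in> T n\<close>] obtain v where v: "v \<in> S" "norm v \<le> real n" "dist (f v) y0 < e / 2" by blast
    have "y - f (u - v) = (f v - y0) - (f u - (y0 + y))" by (simp add: f.diff)
    then have "norm (y - f (u - v)) \<le> dist (f v) y0 + dist (f u) (y0 + y)"
      by (simp only: dist_norm norm_triangle_ineq4)
    then have "norm (y - f (u - v)) < e" using u v by linarith
    moreover have "norm (u - v) \<le> 2 * real n" using norm_triangle_ineq4[of u v] u v by linarith
    moreover have "u - v \<in> S" using u v S(2) by (simp add: subspace_diff)
    ultimately show ?thesis by blast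
  qed
  define A where "A = 4 * real n / r"
  have A0: "A \<ge> 0" using r by (simp add: A_def)
  have "\<exists>x\<in>S. norm x \<le> A * norm y \<and> norm (y - f x) \<le> norm y / 2" if y: "y \<in> Y" for y
  proof (cases "y = 0")
    case True then show ?thesis using S(2) by (auto simp: subspace_0 f.zero intro!: bexI[of _ 0])
  next
    case False
    define t where "t = r / (2 * norm y)"
    have t: "t > 0" using r False by (simp add: t_def)
    have "t *\<^sub>R y \<in> Y" "norm (t *\<^sub>R y) < r" "t * norm y / 2 > 0"
      using y sY t r False by (auto simp: subspace_scale t_def)
    from close[OF this] obtain x where x: "x \<in> S" "norm x \<le> 2 * real n" "norm (t *\<^sub>R y - f x) < t * norm y / 2"
      by blast
    have "y - f ((1/t) *\<^sub>R x) = (1/t) *\<^sub>R (t *\<^sub>R y - f x)" using t by (simp add: f.scaleR algebra_simps)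
    then have "norm (y - f ((1/t) *\<^sub>R x)) = (1/t) * norm (t *\<^sub>R y - f x)" using t by simp
    also have "\<dots> \<le> norm y / 2" using x(3) t by (simp add: field_simps)
    finally have 1: "norm (y - f ((1/t) *\<^sub>R x)) \<le> norm y / 2" .
    have "norm ((1/t) *\<^sub>R x) = norm x / t" using t by simp
    also have "\<dots> \<le> 2 * real n / t" using x t by (simp add: divide_right_mono)
    also have "\<dots> = A * norm y" using False r by (simp add: A_def t_def field_simps)
    finally have "norm ((1/t) *\<^sub>R x) \<le> A * norm y" .
    with 1 x S(2) show ?thesis by (meson subspace_scale)
  qed
  then obtain g where g: "\<And>y. y \<in> Y \<Longrightarrow> g y \<in> S \<and> norm (g y) \<le> A * norm y \<and> norm (y - f (g y)) \<le> norm y / 2"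
    by metis
  have "\<exists>x\<in>S. f x = y \<and> norm x \<le> (2 * A + 1) * norm y" if y: "y \<in> Y" for y
  proof -
    define e where "e k = ((\<lambda>z. z - f (g z)) ^^ k) y" for k
    have eS: "e (Suc k) = e k - f (g (e k))" for k by (simp add: e_def)
    have eY: "e k \<in> Y" for k
    proof (induction k)
      case (Suc k)
      then have "f (g (e k)) \<in> Y" using g unfolding Y_def by blast
      then show ?case using Suc sY by (simp add: eS subspace_diff)
    qed (simp add: e_def y)
    have en: "norm (e k) \<le> norm y * (1/2) ^ k" for k
    proof (induction k)
      case (Suc k)
      have "norm (e (Suc k)) \<le> norm (e k) / 2" using g[OF eY[of k]] by (simp add: eS)
      then show ?case using Suc by simp
    qed (simp add: e_def)
    have xn: "norm (g (e k)) \<le> (A * norm y) * (1/2) ^ k" for k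
      using g[OF eY[of k]] mult_left_mono[OF en[of k] A0] by (simp add: mult.assoc)
    have geo: "summable (\<lambda>k. (A * norm y) * (1/2) ^ k)" by (intro summable_mult summable_geometric) simp
    have sn: "summable (\<lambda>k. norm (g (e k)))"
      by (rule summable_comparison_test'[OF geo, of 0]) (use xn in auto)
    then have s: "summable (\<lambda>k. g (e k))" by (rule summable_norm_cancel)
    define x where "x = (\<Sum>k. g (e k))"
    have "(\<lambda>m. \<Sum>k<m. g (e k)) \<longlonglongrightarrow> x" unfolding x_def by (rule summable_LIMSEQ[OF s])
    moreover have "(\<Sum>k<m. g (e k)) \<in> S" for m using S(2) g eY by (intro subspace_sum) auto
    ultimately have xS: "x \<in> S" using closed_sequentially[OF S(1)] by metis
    have "(\<lambda>m. f (\<Sum>k<m. g (e k))) \<longlonglongrightarrow> f x" by (rule f.tendsto) fact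
    moreover have "f (\<Sum>k<m. g (e k)) = y - e m" for m
      by (induction m) (auto simp: e_def f.add f.zero)
    moreover have "(\<lambda>m. y - e m) \<longlonglongrightarrow> y - 0"
    proof (intro tendsto_intros)
      have "(\<lambda>k. norm y * (1/2) ^ k) \<longlonglongrightarrow> norm y * 0" by (intro tendsto_intros LIMSEQ_power_zero) simp
      then show "e \<longlonglongrightarrow> 0" by (intro Lim_null_comparison[of e "\<lambda>k. norm y * (1/2) ^ k"]) (use en in auto)
    qed
    ultimately have fx: "f x = y" using LIMSEQ_unique by fastforce
    have "norm x \<le> (\<Sum>k. norm (g (e k)))" unfolding x_def by (rule summable_norm[OF sn])
    also have "\<dots> \<le> (\<Sum>k. (A * norm y) * (1/2) ^ k)" by (rule suminf_le[OF xn sn geo])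
    also have "\<dots> = (A * norm y) * 2" by (subst suminf_mult) (auto simp: suminf_geometric intro: summable_geometric)
    also have "\<dots> \<le> (2 * A + 1) * norm y" by (simp add: algebra_simps)
    finally show ?thesis using xS fx by blast
  qed
  then show thesis using that[of "2 * A + 1"] A0 by (simp add: Y_def)
qed

section \<open>Submodules and idempotents\<close>

definition csub :: "'a::cstar_algebra hil set \<Rightarrow> bool" where
  "csub L \<longleftrightarrow> closed L \<and> 0 \<in> L \<and> (\<forall>x\<in>L. \<forall>y\<in>L. x + y \<in> L) \<and> (\<forall>x\<in>L. \<forall>a. rmul x a \<in> L)"

lemma csub_subspace: "csub L \<Longrightarrow> subspace L"
  unfolding csub_def subspace_def by (metis rmul_scaleR)

lemma csub_ops:
  assumes "csub L"
  shows "closed L" "0 \<in> L" "x \<in> L \<Longrightarrow> y \<in> L \<Longrightarrow> x + y \<in> L" "x \<in> L \<Longrightarrow> y \<in> L \<Longrightarrow> x - y \<in> L"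
    "x \<in> L \<Longrightarrow> rmul x a \<in> L" "x \<in> L \<Longrightarrow> r *\<^sub>R x \<in> L"
  using assms csub_subspace[OF assms] by (auto simp: csub_def subspace_diff subspace_scale)

lemma hnorm_seq [simp]: "hnorm (seq x) = norm x" by (simp add: norm_hil.rep_eq)
lemma seq_plus: "seq x + seq y = seq (x + y)" by (simp add: plus_hil.rep_eq)
lemma seq_minus: "seq x - seq y = seq (x - y)" by (simp add: minus_hil.rep_eq)
lemma seq_0: "seq 0 = 0" by (simp add: zero_hil.rep_eq)
lemma seq_inject' [simp]: "seq x = seq y \<longleftrightarrow> x = y" by (rule seq_inject)
lemma hil_seq [simp]: "hil (seq x) = x" by (rule seq_inverse)
lemma seq_hil: "z \<in> HA \<Longrightarrow> seq (hil z) = z" by (rule hil_inverse)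
lemma HA_cases: assumes "z \<in> HA" obtains x where "z = seq x" using seq_hil[OF assms] by metis
lemma HA_eq: "HA = range seq"
proof (intro equalityI subsetI)
  show "z \<in> range seq" if "z \<in> HA" for z using seq_hil[OF that] by (metis rangeI)
qed auto

lemma Metric_space_HA: "Metric_space (HA :: (nat \<Rightarrow> 'a::cstar_algebra) set) (\<lambda>x y. hnorm (x - y))"
proof
  fix x y z :: "nat \<Rightarrow> 'a"
  show "0 \<le> hnorm (x - y)" by (simp add: hnorm_def)
  have "hinner (x - y) (x - y) = hinner (y - x) (y - x)"
    unfolding hinner_def by (simp add: star_diff algebra_simps)
  then show "hnorm (x - y) = hnorm (y - x)" by (simp add: hnorm_def)
  assume x: "x \<in> HA" and y: "y \<in> HA"
  show "(hnorm (x - y) = 0) = (x = y)"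
    by (rule HA_cases[OF x], rule HA_cases[OF y]) (simp add: seq_minus)
  assume z: "z \<in> HA"
  show "hnorm (x - z) \<le> hnorm (x - y) + hnorm (y - z)"
    by (rule HA_cases[OF x], rule HA_cases[OF y], rule HA_cases[OF z])
       (simp add: seq_minus norm_triangle_sub[of "x - z" "y - z" for x y z] flip: dist_norm, rule dist_triangle)
qed

lemma closedin_HA_topology: "closedin HA_topology (seq ` L) \<longleftrightarrow> closed L"
proof -
  interpret Metric_space HA "\<lambda>x y. hnorm (x - y :: nat \<Rightarrow> 'a)" by (rule Metric_space_HA)
  have "closedin mtopology (seq ` L) \<longleftrightarrow> openin mtopology (HA - seq ` L)"
    by (auto simp: closedin_def)
  also have "HA - seq ` L = seq ` (- L)" by (auto simp: HA_eq)
  also have "openin mtopology (seq ` (- L)) \<longleftrightarrow> open (- L)"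
  proof -
    have "mball (seq x) r = seq ` ball x r" for x :: "'a hil" and r
      unfolding mball_def unfolding HA_eq by (auto simp: seq_minus dist_norm)
    moreover have "seq ` X \<subseteq> seq ` Y \<longleftrightarrow> X \<subseteq> Y" for X Y :: "'a hil set"
      by (rule inj_image_subset_iff) (simp add: inj_on_def)
    moreover have "(\<forall>z. z \<in> seq ` X \<longrightarrow> P z) \<longleftrightarrow> (\<forall>x\<in>X. P (seq x))" for X :: "'a hil set" and P
      by blast
    moreover have "seq ` (- L) \<subseteq> HA" by auto
    ultimately show ?thesis
      unfolding openin_mtopology open_contains_ball by simp
  qed
  finally show ?thesis unfolding HA_topology_def closed_def .
qed

lemma closed_submodule_seq: "closed_submodule (seq ` L) \<longleftrightarrow> csub L"
proof -
  have "seq ` L \<subseteq> HA" by auto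
  moreover have "0 \<in> seq ` L \<longleftrightarrow> 0 \<in> L" unfolding seq_0[symmetric] by (simp add: image_iff)
  moreover have "(\<forall>x\<in>seq ` L. \<forall>y\<in>seq ` L. x + y \<in> seq ` L) \<longleftrightarrow> (\<forall>x\<in>L. \<forall>y\<in>L. x + y \<in> L)"
    by (simp add: seq_plus image_iff)
  moreover have "(\<forall>x\<in>seq ` L. \<forall>a. rscale x a \<in> seq ` L) \<longleftrightarrow> (\<forall>x\<in>L. \<forall>a. rmul x a \<in> L)"
    by (simp add: image_iff flip: seq_rmul')
  ultimately show ?thesis
    unfolding closed_submodule_def csub_def closedin_HA_topology by blast
qed

lemma closed_submoduleE:
  assumes "closed_submodule M" obtains L where "M = seq ` L" "csub L"
proof -
  have "M \<subseteq> range seq" using assms by (simp add: closed_submodule_def HA_eq)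
  then obtain L where "M = seq ` L" by (meson subset_imageE)
  then show thesis using that assms closed_submodule_seq by blast
qed

text \<open>The range as a set of sequences, the form in which submodules occur in decompositions.\<close>

definition rng :: "'a::cstar_algebra mop \<Rightarrow> (nat \<Rightarrow> 'a) set" where
  "rng p = seq ` range (ap p)"

lemma rng_eq: assumes "idem p" shows "rng p = seq ` {x. ap p x = x}"
proof -
  have "ap p (ap p x) = ap p x" for x using assms by (simp add: idem_def flip: ap_mult)
  then have "range (ap p) = {x. ap p x = x}" by (auto simp: image_iff) metis
  then show ?thesis by (simp add: rng_def)
qed

lemma rng_iff: "idem p \<Longrightarrow> seq x \<in> rng p \<longleftrightarrow> ap p x = x"
  by (auto simp: rng_eq)

lemma rngE: assumes "idem p" "z \<in> rng p" obtains x where "z = seq x" "ap p x = x"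
  using assms rng_eq by blast

lemma rng_subset_HA: "rng p \<subseteq> HA" by (auto simp: rng_def)

lemma closed_submodule_rng: assumes "idem p" shows "closed_submodule (rng p)"
proof -
  have "closed {x. ap p x = x}" by (intro closed_Collect_eq continuous_intros continuous_on_ap)
  then show ?thesis unfolding rng_eq[OF assms] closed_submodule_seq csub_def by (simp add: ap_add ap_rmul)
qed

lemma direct_sum_rng: assumes "idem p" shows "internal_direct_sum HA (rng p) (rng (1 - p))"
proof -
  have q: "idem (1 - p)" using assms by (simp add: idem_def algebra_simps)
  have "\<exists>x y. z = x + y \<and> x \<in> rng p \<and> y \<in> rng (1 - p)" if z: "z \<in> HA" for z
  proof (rule HA_cases[OF z])
    fix w assume w: "z = seq w"
    have "z = seq (ap p w) + seq (ap (1 - p) w)" by (simp add: w seq_plus ap_diff_mop)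
    then show ?thesis unfolding rng_def by blast
  qed
  moreover have "x = 0" if x: "x \<in> rng p" "x \<in> rng (1 - p)" for x
    using x by (elim rngE[OF assms] rngE[OF q]) (simp add: ap_diff_mop seq_0)
  moreover have "0 \<in> rng p" "0 \<in> rng (1 - p)"
    using closed_submodule_rng[OF assms] closed_submodule_rng[OF q] by (auto simp: closed_submodule_def)
  moreover have "x + y \<in> HA" if "x \<in> rng p" "y \<in> rng (1 - p)" for x y
    using that rng_subset_HA HA_add by blast
  ultimately show ?thesis unfolding internal_direct_sum_def by blast
qed

text \<open>Addition maps \<open>M \<times> N\<close> bijectively onto the whole module, so by the open mapping theorem the components of
  a vector depend boundedly on it.\<close>

lemma projection_of_direct_sum:
  fixes M N :: "(nat \<Rightarrow> 'a::cstar_algebra) set"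
  assumes "closed_submodule M" "closed_submodule N" "internal_direct_sum HA M N"
  obtains p where "idem p" "M = rng p" "N = rng (1 - p)"
proof -
  obtain A where A: "M = seq ` A" "csub A" using assms(1) by (rule closed_submoduleE)
  obtain B where B: "N = seq ` B" "csub B" using assms(2) by (rule closed_submoduleE)
  have ex: "\<exists>a\<in>A. \<exists>b\<in>B. z = a + b" for z
  proof -
    have "seq z \<in> HA" by simp
    then obtain a b where ab: "seq z = seq a + seq b" "a \<in> A" "b \<in> B"
      using assms(3) unfolding internal_direct_sum_def A(1) B(1) by blast
    then have "z = a + b" by (simp add: seq_plus)
    then show ?thesis using ab by blast
  qed
  have int: "x = 0" if "x \<in> A" "x \<in> B" for x
  proof -
    have "seq x \<in> M \<inter> N" using that A B by blast
    then have "seq x = 0" using assms(3) unfolding internal_direct_sum_def by blast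
    then show ?thesis by (simp flip: seq_0)
  qed
  have uniq: "a = a'" if "a \<in> A" "b \<in> B" "a' \<in> A" "b' \<in> B" "a + b = a' + b'" for a b a' b'
  proof -
    have "a - a' = b' - b" using that(5) by (simp add: algebra_simps)
    then have "a - a' = 0" using that csub_ops[OF A(2)] csub_ops[OF B(2)] by (intro int) (auto, metis)
    then show ?thesis by simp
  qed
  define f where "f = (\<lambda>(a :: 'a hil, b :: 'a hil). a + b)"
  have f: "bounded_linear f"
    unfolding f_def case_prod_unfold by (intro bounded_linear_add bounded_linear_fst bounded_linear_snd)
  have fS: "f ` (A \<times> B) = UNIV" using ex by (force simp: f_def)
  \<comment> \<open>the open mapping theorem bounds the \<open>A\<close>-component\<close>
  obtain C where C: "\<And>z. \<exists>w\<in>A \<times> B. f w = z \<and> norm w \<le> C * norm z"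
  proof (rule open_mapping_closed_range[OF f, of "A \<times> B"])
    show "closed (A \<times> B)" "subspace (A \<times> B)"
      using A B by (auto intro: closed_Times csub_ops csub_subspace subspace_Times)
  qed (use fS that in auto)
  then have "\<exists>a\<in>A. \<exists>b\<in>B. z = a + b \<and> norm a \<le> C * norm z" for z
    using C[of z] norm_fst_le by (fastforce simp: f_def intro: order_trans)
  then obtain g where g: "\<And>z. g z \<in> A \<and> (\<exists>b\<in>B. z = g z + b) \<and> norm (g z) \<le> C * norm z" by metis
  have gI: "g z = a" if "a \<in> A" "b \<in> B" "z = a + b" for z a b
    using g[of z] uniq that by metis
  have addg: "g (x + y) = g x + g y" for x y
  proof -
    obtain b c where b: "b \<in> B" "x = g x + b" and c: "c \<in> B" "y = g y + c" using g by metis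
    show ?thesis
    proof (rule gI)
      show "g x + g y \<in> A" "b + c \<in> B" using g b c csub_ops(3)[OF A(2)] csub_ops(3)[OF B(2)] by auto
      have "x + y = (g x + b) + (g y + c)" using b(2) c(2) by simp
      then show "x + y = g x + g y + (b + c)" by (simp only: add_ac)
    qed
  qed
  have mulg: "g (rmul x a) = rmul (g x) a" for x a
  proof -
    obtain b where b: "b \<in> B" "x = g x + b" using g by metis
    show ?thesis
    proof (rule gI)
      show "rmul (g x) a \<in> A" "rmul b a \<in> B" using g b csub_ops(5)[OF A(2)] csub_ops(5)[OF B(2)] by auto
      show "rmul x a = rmul (g x) a + rmul b a" by (subst b(2)) (rule rmul_add_left)
    qed
  qed
  obtain p where p: "\<And>x. ap p x = g x"
    by (rule ex_mop[of g C]) (use addg mulg g in auto)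
  have gA: "g x = x" if "x \<in> A" for x by (rule gI[of _ 0]) (use that csub_ops[OF B(2)] in auto)
  have rA: "range (ap p) = A" using p g gA by (auto simp: image_iff) metis
  have idp: "idem p" unfolding idem_def by (rule mop_eqI) (use p g gA in auto)
  have "range (ap (1 - p)) = B"
  proof -
    have "x - g x \<in> B" for x using g[of x] by (metis add_diff_cancel_left')
    moreover have "g x = 0" if "x \<in> B" for x by (rule gI[OF csub_ops(2)[OF A(2)] that]) simp
    ultimately show ?thesis by (auto simp: ap_diff_mop p image_iff) (metis diff_zero)
  qed
  with rA idp A B that show thesis unfolding rng_def by blast
qed

lemma op_of_map_on_rng:
  fixes p :: "'a::cstar_algebra mop"
  assumes p: "idem p" and f: "bounded_module_map f (rng p) N" and N: "N \<subseteq> HA"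
  obtains U where "\<And>z. seq (ap U z) = f (seq (ap p z))"
proof -
  have r: "seq (ap p z) \<in> rng p" for z by (auto simp: rng_def)
  have add: "\<And>x y. x \<in> rng p \<Longrightarrow> y \<in> rng p \<Longrightarrow> f (x + y) = f x + f y"
    and rs: "\<And>x a. x \<in> rng p \<Longrightarrow> f (rscale x a) = rscale (f x) a"
    and fN: "\<And>x. x \<in> rng p \<Longrightarrow> f x \<in> HA"
    using f N unfolding bounded_module_map_def by auto
  obtain C where C: "\<And>x. x \<in> rng p \<Longrightarrow> hnorm (f x) \<le> C * hnorm x"
    using f unfolding bounded_module_map_def by blast
  define g where "g z = hil (f (seq (ap p z)))" for z
  have sg: "seq (g z) = f (seq (ap p z))" for z unfolding g_def by (rule seq_hil) (rule fN[OF r])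
  obtain U where U: "\<And>z. ap U z = g z"
  proof (rule ex_mop[of g "\<bar>C\<bar> * norm p"])
    fix x y a
    have "seq (g (x + y)) = seq (g x + g y)" using add[OF r r, of x y] by (simp add: sg ap_add seq_plus[symmetric])
    then show "g (x + y) = g x + g y" by simp
    have "seq (g (rmul x a)) = seq (rmul (g x) a)" using rs[OF r, of x a] by (simp add: sg ap_rmul seq_rmul')
    then show "g (rmul x a) = rmul (g x) a" by simp
    have "norm (g x) \<le> C * norm (ap p x)" using C[OF r, of x] by (simp flip: sg)
    also have "\<dots> \<le> \<bar>C\<bar> * norm (ap p x)" by (rule mult_right_mono) auto
    also have "\<dots> \<le> \<bar>C\<bar> * (norm p * norm x)" by (intro mult_left_mono norm_ap_le) auto
    finally show "norm (g x) \<le> \<bar>C\<bar> * norm p * norm x" by (simp add: mult.assoc)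
  qed (use that in auto)
  show thesis by (rule that[of U]) (simp add: U sg)
qed

lemma bounded_module_map_op:
  fixes T :: "'a::cstar_algebra mop"
  assumes f: "\<And>x. f (seq x) = seq (ap T x)" and A: "csub A" and T: "\<And>x. x \<in> A \<Longrightarrow> ap T x \<in> B"
  shows "bounded_module_map f (seq ` A) (seq ` B)"
proof -
  have "\<forall>x\<in>seq ` A. hnorm (f x) \<le> norm T * hnorm x" by (auto simp: f norm_ap_le)
  moreover have "\<forall>x\<in>seq ` A. \<forall>y\<in>seq ` A. f (x + y) = f x + f y"
    by (auto simp: f seq_plus ap_add)
  moreover have "\<forall>x\<in>seq ` A. \<forall>a. f (rscale x a) = rscale (f x) a"
    by (auto simp: f ap_rmul simp flip: seq_rmul')
  ultimately show ?thesis using T unfolding bounded_module_map_def by (auto simp: f)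
qed

lemma module_iso_op:
  fixes S T :: "'a::cstar_algebra mop"
  assumes f: "\<And>x. f (seq x) = seq (ap T x)" and A: "csub A" and B: "csub B"
    and T: "\<And>x. x \<in> A \<Longrightarrow> ap T x \<in> B \<and> ap S (ap T x) = x"
    and S: "\<And>y. y \<in> B \<Longrightarrow> ap S y \<in> A \<and> ap T (ap S y) = y"
  shows "module_iso f (seq ` A) (seq ` B)"
proof -
  have inj: "inj_on f (seq ` A)" using T by (auto simp: inj_on_def f) metis
  have bij: "bij_betw f (seq ` A) (seq ` B)"
    unfolding bij_betw_def using inj T S by (auto simp: f image_iff) metis
  have inv: "inv_into (seq ` A) f (seq y) = seq (ap S y)" if "y \<in> B" for y
    by (rule inv_into_f_eq[OF inj]) (use S[OF that] in \<open>auto simp: f\<close>)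
  define g where "g z = seq (ap S (hil z))" for z
  have "bounded_module_map g (seq ` B) (seq ` A)"
    by (rule bounded_module_map_op[OF _ B]) (use S in \<open>auto simp: g_def\<close>)
  then have "bounded_module_map (inv_into (seq ` A) f) (seq ` B) (seq ` A)"
    unfolding bounded_module_map_def using csub_ops(3,5)[OF B] S
    by (auto simp: inv g_def seq_plus simp flip: seq_rmul')
  moreover have "bounded_module_map f (seq ` A) (seq ` B)"
    by (rule bounded_module_map_op[OF f A]) (use T in auto)
  ultimately show ?thesis unfolding module_iso_def using bij by blast
qed

lemma csub_fix: "idem p \<Longrightarrow> csub {x. ap p x = x}"
  using closed_submodule_rng closed_submodule_seq rng_eq by metis

lemma isomorphic_rng_iff:
  fixes p q :: "'a::cstar_algebra mop"
  assumes p: "idem p" and q: "idem q"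
  shows "rng p \<cong>\<^sub>H rng q \<longleftrightarrow> cls p = cls q"
proof
  assume "rng p \<cong>\<^sub>H rng q"
  then obtain f where f: "module_iso f (rng p) (rng q)" unfolding isomorphic_modules_def by blast
  define g where "g = inv_into (rng p) f"
  have bf: "bounded_module_map f (rng p) (rng q)" and bg: "bounded_module_map g (rng q) (rng p)"
    and bij: "bij_betw f (rng p) (rng q)"
    using f unfolding module_iso_def g_def by auto
  obtain U where U: "\<And>z. seq (ap U z) = f (seq (ap p z))"
    using op_of_map_on_rng[OF p bf rng_subset_HA] by blast
  obtain V where V: "\<And>z. seq (ap V z) = g (seq (ap q z))"
    using op_of_map_on_rng[OF q bg rng_subset_HA] by blast
  have rp: "seq (ap p z) \<in> rng p" and rq: "seq (ap q z) \<in> rng q" for z by (auto simp: rng_def)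
  have fq: "f x \<in> rng q" if "x \<in> rng p" for x using bf that unfolding bounded_module_map_def by blast
  have gp: "g x \<in> rng p" if "x \<in> rng q" for x using bg that unfolding bounded_module_map_def by blast
  have gf: "g (f x) = x" if "x \<in> rng p" for x
    unfolding g_def using bij that by (simp add: bij_betw_inv_into_left)
  have fg: "f (g x) = x" if "x \<in> rng q" for x
    unfolding g_def using bij that by (simp add: bij_betw_inv_into_right)
  have "V * U = p"
  proof (rule mop_eqI)
    fix z
    have "seq (ap U z) \<in> rng q" unfolding U by (rule fq[OF rp])
    then have "ap q (ap U z) = ap U z" by (simp add: rng_iff[OF q])
    then have "seq (ap (V * U) z) = g (seq (ap U z))" by (simp add: V)
    also have "\<dots> = seq (ap p z)" unfolding U by (rule gf[OF rp])
    finally show "ap (V * U) z = ap p z" by simp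
  qed
  moreover have "U * V = q"
  proof (rule mop_eqI)
    fix z
    have "seq (ap V z) \<in> rng p" unfolding V by (rule gp[OF rq])
    then have "ap p (ap V z) = ap V z" by (simp add: rng_iff[OF p])
    then have "seq (ap (U * V) z) = f (seq (ap V z))" by (simp add: U)
    also have "\<dots> = seq (ap q z)" unfolding V by (rule fg[OF rq])
    finally show "ap (U * V) z = ap q z" by simp
  qed
  ultimately show "cls p = cls q" using p q by (intro cls_eqI)
next
  assume "cls p = cls q"
  then obtain u v where uv: "u * v = p" "v * u = q" using p q unfolding cls_eq_iff[OF p q] mvn_def by blast
  have v: "ap q (ap v x) = ap v (ap p x)" and u: "ap p (ap u x) = ap u (ap q x)" for x
    by (simp_all flip: ap_mult uv add: mult.assoc)
  have "ap u (ap v x) = ap p x" "ap v (ap u x) = ap q x" for x by (simp_all flip: ap_mult add: uv)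
  with u v have "module_iso (\<lambda>z. seq (ap v (hil z))) (seq ` {x. ap p x = x}) (seq ` {x. ap q x = x})"
    by (intro module_iso_op[of _ v _ _ u] csub_fix p q) auto
  then show "rng p \<cong>\<^sub>H rng q" unfolding isomorphic_modules_def rng_eq[OF p] rng_eq[OF q] by blast
qed

text \<open>The external direct sum is interleaving, which is what \<open>mat\<close> is built on.\<close>

lemma rng_oplus: 
  assumes p: "idem p" and q: "idem q" shows "rng p \<oplus>\<^sub>H rng q = rng (oplus p q)"
proof (intro equalityI subsetI)
  fix z assume "z \<in> rng p \<oplus>\<^sub>H rng q"
  then obtain a b where a: "(\<lambda>n. z (2 * n)) = seq a" "ap p a = a" and b: "(\<lambda>n. z (2 * n + 1)) = seq b" "ap q b = b"
    unfolding ext_sum_def mem_Collect_eq by (auto elim!: rngE[OF p] rngE[OF q])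
  define w where "w = ap even_in a + ap odd_in b"
  have "z n = seq w n" for n
    using fun_cong[OF a(1), of "n div 2"] fun_cong[OF b(1), of "n div 2"] by (auto simp: w_def elim!: evenE oddE)
  then have z: "z = seq w" by blast
  have "oplus p q * even_in = even_in * p" "oplus p q * odd_in = odd_in * q"
    by (simp_all add: oplus_def mat_def algebra_simps)
  then have "ap (oplus p q) (ap even_in a) = ap even_in (ap p a)" "ap (oplus p q) (ap odd_in b) = ap odd_in (ap q b)"
    by (metis ap_mult)+
  then have "ap (oplus p q) w = w" by (simp add: w_def ap_add a b)
  then show "z \<in> rng (oplus p q)" using z by (simp add: rng_iff idem_oplus p q)
next
  fix z assume "z \<in> rng (oplus p q)"
  then obtain w where z: "z = seq w" and w: "ap (oplus p q) w = w" using idem_oplus[OF p q] by (elim rngE)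
  have "even_out * oplus p q = p * even_out" "odd_out * oplus p q = q * odd_out"
    by (simp_all add: oplus_def mat_def algebra_simps)
  then have "ap p (ap even_out w) = ap even_out w" "ap q (ap odd_out w) = ap odd_out w"
    using w by (metis ap_mult)+
  moreover have "(\<lambda>n. z (2 * n)) = seq (ap even_out w)" "(\<lambda>n. z (2 * n + 1)) = seq (ap odd_out w)"
    by (auto simp: z)
  ultimately show "z \<in> rng p \<oplus>\<^sub>H rng q" unfolding ext_sum_def by (simp add: rng_iff p q)
qed

section \<open>Finitely generated submodules\<close>

lemma sum_seq: "(\<Sum>a\<in>A. seq (f a)) = seq (\<Sum>a\<in>A. f a)"
  by (induction A rule: infinite_finite_induct) (auto simp: seq_plus seq_0)

lemma rmul_sum_right: "rmul x (\<Sum>i\<in>I. f i) = (\<Sum>i\<in>I. rmul x (f i))"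
  by (rule hil_eqI) (simp add: sum_distrib_left)

lemma csub_sum: "csub L \<Longrightarrow> (\<And>i. i \<in> I \<Longrightarrow> f i \<in> L) \<Longrightarrow> (\<Sum>i\<in>I. f i) \<in> L"
  by (induction I rule: infinite_finite_induct) (auto simp: csub_ops)

lemma fin_gen_seq_iff:
  "fin_gen (seq ` L) \<longleftrightarrow> (\<exists>A. finite A \<and> A \<subseteq> L \<and> L = {\<Sum>a\<in>A. rmul a (c a) | c. True})" (is "?l \<longleftrightarrow> ?r")
proof -
  have inj: "inj_on seq X" for X :: "'a hil set" by (simp add: inj_on_def)
  have eq: "{\<Sum>s\<in>seq ` A. rscale s (c s) | c. True} = seq ` {\<Sum>a\<in>A. rmul a (c a) | c. True}" for A :: "'a hil set"
  proof (intro equalityI subsetI)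
    fix z assume "z \<in> {\<Sum>s\<in>seq ` A. rscale s (c s) | c. True}"
    then obtain c where "z = (\<Sum>s\<in>seq ` A. rscale s (c s))" by blast
    also have "\<dots> = seq (\<Sum>a\<in>A. rmul a (c (seq a)))"
      by (simp add: sum.reindex[OF inj] sum_seq[symmetric] seq_rmul')
    finally have z: "z = seq (\<Sum>a\<in>A. rmul a (c (seq a)))" .
    have "(\<Sum>a\<in>A. rmul a (c (seq a))) \<in> {\<Sum>a\<in>A. rmul a (c a) | c. True}"
      by (intro CollectI exI[of _ "\<lambda>a. c (seq a)"]) simp
    then show "z \<in> seq ` {\<Sum>a\<in>A. rmul a (c a) | c. True}" unfolding z by (rule imageI)
  next
    fix z assume "z \<in> seq ` {\<Sum>a\<in>A. rmul a (c a) | c. True}"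
    then obtain c where "z = seq (\<Sum>a\<in>A. rmul a (c a))" by blast
    also have "\<dots> = (\<Sum>s\<in>seq ` A. rscale s (c (hil s)))"
      by (simp add: sum.reindex[OF inj] sum_seq[symmetric] seq_rmul')
    finally have z: "z = (\<Sum>s\<in>seq ` A. rscale s (c (hil s)))" .
    show "z \<in> {\<Sum>s\<in>seq ` A. rscale s (c s) | c. True}"
      by (intro CollectI exI[of _ "\<lambda>s. c (hil s)"]) (simp add: z)
  qed
  have img: "seq ` X = seq ` Y \<longleftrightarrow> X = Y" "seq ` X \<subseteq> seq ` Y \<longleftrightarrow> X \<subseteq> Y" for X Y :: "'a hil set"
    using inj by (auto simp: inj_image_eq_iff inj_image_subset_iff)
  show ?thesis
  proof
    assume ?l
    then obtain S where S: "finite S" "S \<subseteq> seq ` L" "seq ` L = {\<Sum>s\<in>S. rscale s (c s) | c. True}"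
      unfolding fin_gen_def by blast
    then obtain A where A: "S = seq ` A" "A \<subseteq> L" by (meson subset_imageE)
    have "finite A" using S(1) A(1) inj finite_imageD by blast
    then show ?r using S(3) A unfolding A(1) eq img by blast
  next
    assume ?r
    then obtain A where A: "finite A" "A \<subseteq> L" "L = {\<Sum>a\<in>A. rmul a (c a) | c. True}" by blast
    have "seq ` L = {\<Sum>s\<in>seq ` A. rscale s (c s) | c. True}" unfolding eq using A(3) by (rule arg_cong)
    then show ?l unfolding fin_gen_def 
      by (intro exI[of _ "seq ` A"] conjI finite_imageI image_mono A(1,2))
  qed
qed

lemma fin_gen_iff_family:
  assumes L: "csub L"
  shows "fin_gen (seq ` L) \<longleftrightarrow> (\<exists>k (x :: nat \<Rightarrow> 'a::cstar_algebra hil). L = {\<Sum>i<k. rmul (x i) (c i) | c. True})"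
  unfolding fin_gen_seq_iff
proof
  assume "\<exists>A. finite A \<and> A \<subseteq> L \<and> L = {\<Sum>a\<in>A. rmul a (c a) | c. True}"
  then obtain A where A: "finite A" "L = {\<Sum>a\<in>A. rmul a (c a) | c. True}" by blast
  obtain k x where kx: "A = x ` {i::nat. i < k}" "inj_on x {i. i < k}"
    using finite_imp_nat_seg_image_inj_on[OF A(1)] by metis
  have *: "(\<Sum>a\<in>A. rmul a (c a)) = (\<Sum>i<k. rmul (x i) (c (x i)))" for c
    unfolding kx(1) by (subst sum.reindex[OF kx(2)]) (simp add: lessThan_def)
  have **: "(\<Sum>i<k. rmul (x i) (c i)) = (\<Sum>a\<in>A. rmul a (c (inv_into {i. i < k} x a)))" for c
    unfolding * by (rule sum.cong) (use kx(2) in auto)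
  have "L = {\<Sum>i<k. rmul (x i) (c i) | c. True}"
    unfolding A(2)
  proof (intro equalityI subsetI)
    fix z assume "z \<in> {\<Sum>a\<in>A. rmul a (c a) | c. True}"
    then obtain c where "z = (\<Sum>a\<in>A. rmul a (c a))" by blast
    then show "z \<in> {\<Sum>i<k. rmul (x i) (c i) | c. True}"
      unfolding * by (intro CollectI exI[of _ "\<lambda>i. c (x i)"]) simp
  next
    fix z assume "z \<in> {\<Sum>i<k. rmul (x i) (c i) | c. True}"
    then obtain c where "z = (\<Sum>i<k. rmul (x i) (c i))" by blast
    then show "z \<in> {\<Sum>a\<in>A. rmul a (c a) | c. True}"
      unfolding ** by (intro CollectI exI[of _ "\<lambda>a. c (inv_into {i. i < k} x a)"]) simp
  qed
  then show "\<exists>k (x :: nat \<Rightarrow> 'a hil). L = {\<Sum>i<k. rmul (x i) (c i) | c. True}" by (intro exI[of _ k] exI[of _ x])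
next
  assume "\<exists>k (x :: nat \<Rightarrow> 'a hil). L = {\<Sum>i<k. rmul (x i) (c i) | c. True}"
  then obtain k and x :: "nat \<Rightarrow> 'a hil" where kx: "L = {\<Sum>i<k. rmul (x i) (c i) | c. True}" by blast
  define A where "A = x ` {..<k}"
  have xL: "x i \<in> L" if "i < k" for i
  proof -
    have "(\<Sum>j<k. rmul (x j) (if j = i then 1 else 0)) = (\<Sum>j<k. if j = i then x i else 0)"
      by (rule sum.cong) (auto intro: hil_eqI)
    also have "\<dots> = x i" using that by simp
    finally have "x i = (\<Sum>j<k. rmul (x j) (if j = i then 1 else 0))" by (rule sym)
    then show ?thesis unfolding kx by (intro CollectI exI[of _ "\<lambda>j. if j = i then 1 else 0"] conjI TrueI)
  qed
  then have AL: "A \<subseteq> L" by (auto simp: A_def)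
  have regroup: "(\<Sum>i<k. rmul (x i) (c i)) = (\<Sum>a\<in>A. rmul a (\<Sum>i\<in>{i\<in>{..<k}. x i = a}. c i))" for c
  proof -
    have "(\<Sum>i<k. rmul (x i) (c i)) = (\<Sum>a\<in>A. \<Sum>i\<in>{i\<in>{..<k}. x i = a}. rmul (x i) (c i))"
      unfolding A_def by (rule sum.image_gen) simp
    also have "\<dots> = (\<Sum>a\<in>A. rmul a (\<Sum>i\<in>{i\<in>{..<k}. x i = a}. c i))"
      unfolding rmul_sum_right by (intro sum.cong) auto
    finally show ?thesis .
  qed
  have "L \<subseteq> {\<Sum>a\<in>A. rmul a (c a) | c. True}"
  proof
    fix z assume "z \<in> L"
    then obtain c where "z = (\<Sum>i<k. rmul (x i) (c i))" unfolding kx by blast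
    then show "z \<in> {\<Sum>a\<in>A. rmul a (c a) | c. True}"
      unfolding regroup by (intro CollectI exI[of _ "\<lambda>a. \<Sum>i\<in>{i\<in>{..<k}. x i = a}. c i"] conjI TrueI)
  qed
  moreover have "{\<Sum>a\<in>A. rmul a (c a) | c. True} \<subseteq> L"
    using AL csub_ops(5)[OF L] by (auto intro!: csub_sum[OF L])
  ultimately have "finite A \<and> A \<subseteq> L \<and> L = {\<Sum>a\<in>A. rmul a (c a) | c. True}"
    using AL by (simp add: A_def)
  then show "\<exists>A. finite A \<and> A \<subseteq> L \<and> L = {\<Sum>a\<in>A. rmul a (c a) | c. True}" by blast
qed

lemma ip_unit_vec_left: "ip (unit_vec i) x = seq x i"
proof -
  have "ip (unit_vec i) x = (\<Sum>n. star (seq (unit_vec i :: 'a hil) n) * seq x n)"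
    by (simp only: ip.rep_eq hinner_def)
  also have "\<dots> = (\<Sum>n\<in>{i}. star (seq (unit_vec i :: 'a hil) n) * seq x n)"
    by (rule suminf_finite) auto
  finally show ?thesis by simp
qed

lemma ip_diff_right: "ip x (y - z) = ip x y - ip x z"
  using ip_add_right[of x "y - z" z] by simp

lemma ip_scaleR_right: "ip x (r *\<^sub>R y) = r *\<^sub>R ip x y"
  using ip_rmul_right[of x y "r *\<^sub>R 1"] by (simp add: rmul_scaleR)

text \<open>A uniform lower bound on \<open>S + t\<close>, \<open>t \<ge> 0\<close>, replaces spectral theory. The equation \<open>(S + t)x = y\<close> is a
  contraction problem for large \<open>t\<close>; and where \<open>S + t + c/2\<close> is invertible on \<open>L\<close>, its inverse has norm at most
  \<open>1/c\<close>, so that the equation for \<open>S + t\<close> is again a contraction problem. Thus solvability descends to \<open>t = 0\<close> in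
  steps of the fixed length \<open>c/2\<close>.\<close>

lemma shifted_surjective_descent:
  fixes S :: "'a::cstar_algebra mop"
  assumes L: "csub L" and SL: "\<And>x. x \<in> L \<Longrightarrow> ap S x \<in> L" and c: "c > 0"
    and below: "\<And>t x. t \<ge> 0 \<Longrightarrow> x \<in> L \<Longrightarrow> c * norm x \<le> norm (ap S x + t *\<^sub>R x)"
    and y: "y \<in> L"
  shows "\<exists>x\<in>L. ap S x = y"
proof -
  have cL: "complete L" using csub_ops(1)[OF L] by (simp add: complete_eq_closed)
  have L0: "L \<noteq> {}" using y by blast
  define P where "P t \<longleftrightarrow> (\<forall>y\<in>L. \<exists>x\<in>L. ap S x + t *\<^sub>R x = y)" for t
  have large: "P t" if t: "t > norm S" for t
    unfolding P_def
  proof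
    fix y assume y: "y \<in> L"
    have t0: "t > 0" using t norm_ge_zero[of S] by linarith
    have "\<exists>!x\<in>L. (1/t) *\<^sub>R (y - ap S x) = x"
    proof (rule Banach_fix[OF cL L0, where c = "norm S / t"])
      show "(\<lambda>x. (1/t) *\<^sub>R (y - ap S x)) ` L \<subseteq> L" using y SL csub_ops(4,6)[OF L] by blast
      fix x x'
      have "dist ((1/t) *\<^sub>R (y - ap S x)) ((1/t) *\<^sub>R (y - ap S x')) = norm ((1/t) *\<^sub>R ap S (x' - x))"
        by (simp add: dist_norm ap_diff scaleR_diff_right)
      also have "\<dots> = norm (ap S (x' - x)) / t" using t0 by simp
      also have "\<dots> \<le> norm S * norm (x' - x) / t" using t0 by (intro divide_right_mono norm_ap_le) auto
      finally show "dist ((1/t) *\<^sub>R (y - ap S x)) ((1/t) *\<^sub>R (y - ap S x')) \<le> norm S / t * dist x x'"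
        by (simp add: dist_norm norm_minus_commute)
    qed (use t t0 in auto)
    then obtain x where x: "x \<in> L" "(1/t) *\<^sub>R (y - ap S x) = x" by blast
    have "t *\<^sub>R x = y - ap S x" using t0 by (subst x(2)[symmetric]) simp
    then show "\<exists>x\<in>L. ap S x + t *\<^sub>R x = y" using x(1) by (intro bexI[of _ x]) auto
  qed
  have step: "P t" if Pt: "P (t + c / 2)" and t: "t \<ge> 0" for t
    unfolding P_def
  proof
    fix y assume y: "y \<in> L"
    define t' where "t' = t + c / 2"
    obtain R where R: "\<And>z. z \<in> L \<Longrightarrow> R z \<in> L \<and> ap S (R z) + t' *\<^sub>R R z = z"
      using Pt unfolding P_def t'_def by metis
    have in_L: "y + (c/2) *\<^sub>R x \<in> L" if "x \<in> L" for x
      by (intro csub_ops(3)[OF L y] csub_ops(6)[OF L that])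
    have "\<exists>!x\<in>L. R (y + (c/2) *\<^sub>R x) = x"
    proof (rule Banach_fix[OF cL L0, where c = "1/2"])
      show "(\<lambda>x. R (y + (c/2) *\<^sub>R x)) ` L \<subseteq> L" using R in_L by blast
      fix x x' assume x: "x \<in> L" "x' \<in> L"
      define d where "d = R (y + (c/2) *\<^sub>R x) - R (y + (c/2) *\<^sub>R x')"
      have dL: "d \<in> L" unfolding d_def by (intro csub_ops(4)[OF L] conjunct1[OF R] in_L x)
      have "ap S d + t' *\<^sub>R d = (ap S (R (y + (c/2) *\<^sub>R x)) + t' *\<^sub>R R (y + (c/2) *\<^sub>R x))
          - (ap S (R (y + (c/2) *\<^sub>R x')) + t' *\<^sub>R R (y + (c/2) *\<^sub>R x'))"
        by (simp add: d_def ap_diff scaleR_diff_right)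
      also have "\<dots> = (c/2) *\<^sub>R (x - x')" using R in_L x by (simp add: scaleR_diff_right)
      finally have "c * norm d \<le> norm ((c/2) *\<^sub>R (x - x'))"
        using below[OF _ dL, of t'] t c by (simp add: t'_def)
      then have "norm d \<le> 1/2 * norm (x - x')" using c by simp
      then show "dist (R (y + (c/2) *\<^sub>R x)) (R (y + (c/2) *\<^sub>R x')) \<le> 1/2 * dist x x'"
        by (simp add: dist_norm d_def)
    qed auto
    then obtain x where x: "x \<in> L" "R (y + (c/2) *\<^sub>R x) = x" by blast
    have "ap S x + t' *\<^sub>R x = y + (c/2) *\<^sub>R x" using R[OF in_L[OF x(1)]] by (simp add: x(2))
    then have "ap S x + t *\<^sub>R x = y" by (simp add: t'_def scaleR_add_left)
    then show "\<exists>x\<in>L. ap S x + t *\<^sub>R x = y" using x(1) by blast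
  qed
  obtain N :: nat where "norm S / (c / 2) < real N" using reals_Archimedean2 by blast
  then have "norm S < real N * (c / 2)" using c by (simp add: pos_divide_less_eq)
  then have "P (real N * (c / 2))" by (rule large)
  then have "P 0"
  proof (induction N)
    case (Suc N)
    have "real (Suc N) * (c / 2) = real N * (c / 2) + c / 2" by (simp add: field_simps)
    then have "P (real N * (c / 2) + c / 2)" using Suc.prems by (simp only:)
    then have "P (real N * (c / 2))" by (rule step) (use c in simp)
    then show ?case by (rule Suc.IH)
  qed simp
  then show ?thesis using y unfolding P_def by simp
qed

text \<open>Let \<open>T\<close> map the unit vectors to the generators and \<open>T'\<close> be its adjoint. As \<open>T\<close> is open onto \<open>L\<close>, the
  adjoint is bounded below on \<open>L\<close>, and with it, by positivity, \<open>TT' + t\<close> for every \<open>t \<ge> 0\<close>. So \<open>S = TT'\<close> has a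
  bounded inverse \<open>J\<close> on \<open>L\<close>, and \<open>JS\<close> is a projection onto \<open>L\<close>. Since \<open>JS = SJJS = T(T'JJS)\<close> and \<open>T\<close> depends on
  finitely many coordinates only, it factors through some \<open>\<A>\<^sup>k\<close>.\<close>

theorem fin_gen_projection:
  fixes L :: "'a::cstar_algebra hil set"
  assumes L: "csub L" and fg: "fin_gen (seq ` L)"
  obtains P where "idem P" "P \<in> fin_ops" "rng P = seq ` L"
proof -
  obtain k and x :: "nat \<Rightarrow> 'a hil" where kx: "L = {\<Sum>i<k. rmul (x i) (c i) | c. True}"
    using fg unfolding fin_gen_iff_family[OF L] by blast
  obtain T where T: "\<And>z. ap T z = (\<Sum>i<k. rmul (x i) (seq z i))"
  proof (rule ex_mop[of "\<lambda>z. \<Sum>i<k. rmul (x i) (seq z i)" "\<Sum>i<k. norm (x i)"])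
    fix z :: "'a hil"
    show "norm (\<Sum>i<k. rmul (x i) (seq z i)) \<le> (\<Sum>i<k. norm (x i)) * norm z"
      unfolding sum_distrib_right
      by (intro sum_norm_le order_trans[OF norm_rmul_le] mult_left_mono norm_seq_le) auto
  qed (auto simp: rmul_add_right sum.distrib rmul_rmul rmul_sum_left)
  obtain T' where T': "\<And>z. ap T' z = (\<Sum>i<k. rmul (unit_vec i) (ip (x i) z))"
  proof (rule ex_mop[of "\<lambda>z. \<Sum>i<k. rmul (unit_vec i) (ip (x i) z)" "\<Sum>i<k. norm (unit_vec i :: 'a hil) * norm (x i)"])
    fix z :: "'a hil"
    have "norm (rmul (unit_vec i) (ip (x i) z)) \<le> norm (unit_vec i :: 'a hil) * norm (x i) * norm z" for i
    proof -
      have "norm (rmul (unit_vec i) (ip (x i) z)) \<le> norm (unit_vec i :: 'a hil) * norm (ip (x i) z)" by (rule norm_rmul_le)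
      also have "\<dots> \<le> norm (unit_vec i :: 'a hil) * (norm (x i) * norm z)" by (intro mult_left_mono norm_ip_le) auto
      finally show ?thesis by (simp add: mult.assoc)
    qed
    then show "norm (\<Sum>i<k. rmul (unit_vec i) (ip (x i) z)) \<le> (\<Sum>i<k. norm (unit_vec i :: 'a hil) * norm (x i)) * norm z"
      unfolding sum_distrib_right by (intro sum_norm_le) auto
  qed (auto simp: ip_add_right ip_rmul_right rmul_add_right sum.distrib rmul_rmul rmul_sum_left)
  have adj: "ip (ap T w) y = ip w (ap T' y)" for w y
  proof -
    have "ip (ap T w) y = (\<Sum>i<k. star (seq w i) * ip (x i) y)" by (simp add: T ip_sum_left ip_rmul_left)
    moreover have "star (ip w (ap T' y)) = star (\<Sum>i<k. star (seq w i) * ip (x i) y)"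
      by (simp add: star_ip T' ip_sum_left ip_rmul_left ip_unit_vec_left star_sum star_mult star_star)
    ultimately show ?thesis by (metis star_star)
  qed
  have Ttr: "T * trunc k = T" by (rule mop_eqI) (simp add: T)
  have TL: "range (ap T) = L"
  proof (intro equalityI subsetI)
    fix z assume "z \<in> L"
    then obtain c where c: "z = (\<Sum>i<k. rmul (x i) (c i))" using kx by blast
    have "seq (\<Sum>j<k. rmul (unit_vec j) (c j)) i = c i" if "i < k" for i
    proof -
      have "(\<Sum>j<k. (if i = j then 1 else 0) * c j) = (\<Sum>j<k. if i = j then c j else 0)" by (rule sum.cong) auto
      then show ?thesis using that by (simp add: sum.delta')
    qed
    then have "ap T (\<Sum>j<k. rmul (unit_vec j) (c j)) = z" unfolding T c by (intro sum.cong) auto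
    then show "z \<in> range (ap T)" by (metis rangeI)
  qed (use kx T in auto)
  obtain C where C: "C > 0" "\<And>y. y \<in> L \<Longrightarrow> \<exists>w. ap T w = y \<and> norm w \<le> C * norm y"
    using open_mapping_closed_range[OF bounded_linear_ap[of T], of UNIV] csub_ops(1)[OF L]
    by (metis TL closed_UNIV subspace_UNIV)
  have lower: "norm y \<le> C * norm (ap T' y)" if y: "y \<in> L" for y
  proof -
    obtain w where w: "ap T w = y" "norm w \<le> C * norm y" using C(2)[OF y] by blast
    have "norm y * norm y = norm (ip (ap T w) y)" unfolding w(1) norm_ip_self by (simp add: power2_eq_square)
    also have "\<dots> \<le> norm w * norm (ap T' y)" unfolding adj by (rule norm_ip_le)
    also have "\<dots> \<le> C * norm y * norm (ap T' y)" using w(2) by (rule mult_right_mono) simp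
    finally have "norm y * norm y \<le> norm y * (C * norm (ap T' y))" by (simp add: mult_ac)
    then show ?thesis using C(1) by (cases "y = 0") auto
  qed
  define S where "S = T * T'"
  have S_in: "ap S z \<in> L" for z using TL by (auto simp: S_def)
  define c where "c = 1 / C\<^sup>2"
  have c: "c > 0" using C by (simp add: c_def)
  have below: "c * norm y \<le> norm (ap S y + t *\<^sub>R y)" if t: "t \<ge> 0" and y: "y \<in> L" for t y
  proof -
    have ipS: "ip y (ap S y + t *\<^sub>R y) = ip (ap T' y) (ap T' y) + t *\<^sub>R ip y y"
    proof -
      have "star (ip y (ap S y)) = star (ip (ap T' y) (ap T' y))"
        unfolding star_ip S_def ap_mult adj ..
      then have "ip y (ap S y) = ip (ap T' y) (ap T' y)" by (metis star_star)
      then show ?thesis by (simp add: ip_add_right ip_scaleR_right)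
    qed
    have "(norm y)\<^sup>2 \<le> (C * norm (ap T' y))\<^sup>2" using lower[OF y] by (rule power_mono) simp
    then have "c * (norm y)\<^sup>2 \<le> (norm (ap T' y))\<^sup>2" using C by (simp add: c_def power_mult_distrib field_simps)
    also have "\<dots> = norm (ip (ap T' y) (ap T' y))" by (simp add: norm_ip_self)
    also have "\<dots> \<le> norm (ip y (ap S y + t *\<^sub>R y))"
      unfolding ipS by (rule pos_norm_mono) (use t in \<open>auto intro!: pos_ip_self pos_scaleR\<close>)
    also have "\<dots> \<le> norm y * norm (ap S y + t *\<^sub>R y)" by (rule norm_ip_le)
    finally have "norm y * (c * norm y) \<le> norm y * norm (ap S y + t *\<^sub>R y)" by (simp add: power2_eq_square mult_ac)
    then show ?thesis by (cases "y = 0") auto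
  qed
  have "\<exists>z\<in>L. ap S z = y" if "y \<in> L" for y
    using shifted_surjective_descent[OF L S_in c below that] by blast
  then obtain J where J: "\<And>y. y \<in> L \<Longrightarrow> J y \<in> L \<and> ap S (J y) = y" by metis
  have Jn: "norm (J y) \<le> norm y / c" if "y \<in> L" for y
    using below[OF order_refl, of "J y"] J[OF that] c by (simp add: field_simps)
  have Sinj: "y = z" if "y \<in> L" "z \<in> L" "ap S y = ap S z" for y z
    using below[OF order_refl csub_ops(4)[OF L that(1,2)]] that(3) c by (simp add: ap_diff mult_le_0_iff)
  have Jadd: "J (y + z) = J y + J z" if "y \<in> L" "z \<in> L" for y z
    by (rule Sinj) (use that J csub_ops(3)[OF L] in \<open>auto simp: ap_add\<close>)
  have Jmul: "J (rmul y a) = rmul (J y) a" if "y \<in> L" for y a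
    by (rule Sinj) (use that J csub_ops(5)[OF L] in \<open>auto simp: ap_rmul\<close>)
  define h where "h z = J (J (ap S z))" for z
  have J2: "J (ap S z) \<in> L" for z using J S_in by blast
  obtain H where H: "\<And>z. ap H z = h z"
  proof (rule ex_mop[of h "norm S / c / c"])
    fix y z a
    show "h (y + z) = h y + h z" by (simp add: h_def ap_add Jadd S_in J2)
    show "h (rmul z a) = rmul (h z) a" by (simp add: h_def ap_rmul Jmul S_in J2)
    have "norm (h z) \<le> norm (J (ap S z)) / c" unfolding h_def by (rule Jn[OF J2])
    also have "\<dots> \<le> norm (ap S z) / c / c" using Jn[OF S_in] c by (intro divide_right_mono) auto
    also have "\<dots> \<le> norm S * norm z / c / c" using c by (intro divide_right_mono norm_ap_le) auto
    finally show "norm (h z) \<le> norm S / c / c * norm z" by simp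
  qed (use that in auto)
  define P where "P = T * T' * H"
  have P: "ap P z = J (ap S z)" for z
  proof -
    have "ap P z = ap S (h z)" by (simp add: P_def S_def H)
    then show ?thesis using J[OF J2] by (simp add: h_def)
  qed
  have JS: "J (ap S z) = z" if "z \<in> L" for z by (rule Sinj) (use J S_in that in auto)
  have "idem P" unfolding idem_def by (rule mop_eqI) (simp add: P JS J2)
  moreover have "P \<in> fin_ops"
  proof -
    have "P = T * trunc k * (T' * H)" by (simp add: P_def Ttr mult.assoc)
    then show ?thesis by (simp add: fin_opsI)
  qed
  moreover have "range (ap P) = L" using P J2 JS by (auto simp: image_iff) metis
  ultimately show thesis using that unfolding rng_def by blast
qed

text \<open>A factorization \<open>p = x \<cdot> trunc m \<cdot> y\<close> exhibits the images of the first \<open>m\<close> unit vectors under \<open>px\<close> as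
  generators. Conversely, \<open>p = Pp\<close> for the projection \<open>P\<close> of \<open>fin_gen_projection\<close> onto its range.\<close>

lemma fin_gen_rng_iff:
  assumes p: "idem p" shows "fin_gen (rng p) \<longleftrightarrow> p \<in> fin_ops"
proof
  assume "fin_gen (rng p)"
  then obtain P where P: "idem P" "P \<in> fin_ops" "rng P = rng p"
    using fin_gen_projection[OF csub_fix[OF p]] unfolding rng_eq[OF p] by metis
  have "P * p = p"
  proof (rule mop_eqI)
    fix z
    have "seq (ap p z) \<in> rng P" unfolding P(3) by (simp add: rng_def)
    then show "ap (P * p) z = ap p z" using rng_iff[OF P(1)] by simp
  qed
  then show "p \<in> fin_ops" using fin_ops_mult(2)[OF P(2), of p] by simp
next
  assume "p \<in> fin_ops"
  then obtain x y m where k: "p = x * trunc m * y" unfolding fin_ops_def by blast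
  have pp: "ap p (ap p z) = ap p z" for z using p by (simp add: idem_def flip: ap_mult)
  have "{z. ap p z = z} = {\<Sum>i<m. rmul (ap (p * x) (unit_vec i)) (c i) | c. True}"
  proof (intro equalityI subsetI)
    fix z assume "z \<in> {z. ap p z = z}"
    then have "z = ap p (ap p z)" by simp
    also have "\<dots> = ap (p * x) (ap (trunc m) (ap y z))" by (simp add: k)
    also have "\<dots> = (\<Sum>i<m. rmul (ap (p * x) (unit_vec i)) (seq (ap y z) i))"
      unfolding trunc_expand ap_sum ap_rmul ..
    finally show "z \<in> {\<Sum>i<m. rmul (ap (p * x) (unit_vec i)) (c i) | c. True}" by blast
  next
    fix z assume "z \<in> {\<Sum>i<m. rmul (ap (p * x) (unit_vec i)) (c i) | c. True}"
    then obtain c where "z = (\<Sum>i<m. rmul (ap p (ap x (unit_vec i))) (c i))" by auto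
    then show "z \<in> {z. ap p z = z}" by (simp add: ap_sum ap_rmul pp)
  qed
  then show "fin_gen (rng p)" unfolding rng_eq[OF p] fin_gen_iff_family[OF csub_fix[OF p]]
    by (intro exI[of _ m] exI[of _ "\<lambda>i. ap (p * x) (unit_vec i)"])
qed

lemma fg_closed_submodule_iff: "fg_closed_submodule M \<longleftrightarrow> (\<exists>p. idem p \<and> p \<in> fin_ops \<and> M = rng p)"
proof
  assume M: "fg_closed_submodule M"
  then obtain L where L: "M = seq ` L" "csub L" unfolding fg_closed_submodule_def by (blast elim: closed_submoduleE)
  then show "\<exists>p. idem p \<and> p \<in> fin_ops \<and> M = rng p"
    using M fin_gen_projection[OF L(2)] unfolding fg_closed_submodule_def by metis
qed (auto simp: fg_closed_submodule_def closed_submodule_rng fin_gen_rng_iff)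

text \<open>The image of the embedding is finitely generated, hence the range of some idempotent \<open>l\<close>; then \<open>lq\<close> is an
  idempotent below \<open>q\<close> with the same range, and it splits off.\<close>

lemma embeds_rng_iff:
  assumes p: "idem p" "p \<in> fin_ops" and q: "idem q"
  shows "rng p \<preceq>\<^sub>H rng q \<longleftrightarrow> (\<exists>c. cls q = cls p + c)"
proof
  assume "rng p \<preceq>\<^sub>H rng q"
  then obtain M where M: "closed_submodule M" "M \<subseteq> rng q" "rng p \<cong>\<^sub>H M" unfolding embeds_in_def by blast
  then obtain f where f: "module_iso f (rng p) M" unfolding isomorphic_modules_def by blast
  obtain L where L: "M = seq ` L" "csub L" using M(1) by (rule closed_submoduleE)
  have "fin_gen M"
  proof -
    have "fin_gen (rng p)" using p fin_gen_rng_iff by blast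
    then obtain k and x :: "nat \<Rightarrow> 'a hil" where kx: "{z. ap p z = z} = {\<Sum>i<k. rmul (x i) (c i) | c. True}"
      unfolding rng_eq[OF p(1)] fin_gen_iff_family[OF csub_fix[OF p(1)]] by blast
    obtain U where U: "\<And>z. seq (ap U z) = f (seq (ap p z))"
      using op_of_map_on_rng[OF p(1), of f M] f M(2) rng_subset_HA unfolding module_iso_def by blast
    have fM: "f ` rng p = M" using f unfolding module_iso_def bij_betw_def by blast
    have "L = ap U ` {z. ap p z = z}"
    proof -
      have "seq ` L = seq ` ap U ` {z. ap p z = z}"
        unfolding L(1)[symmetric] fM[symmetric] rng_eq[OF p(1)] by (force simp: U image_image)
      then show ?thesis by (subst (asm) inj_image_eq_iff) (auto simp: inj_on_def)
    qed
    also have "\<dots> = {\<Sum>i<k. rmul (ap U (x i)) (c i) | c. True}"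
      unfolding kx by (force simp: ap_sum ap_rmul)
    finally show ?thesis unfolding L(1) fin_gen_iff_family[OF L(2)]
      by (intro exI[of _ k] exI[of _ "\<lambda>i. ap U (x i)"])
  qed
  then obtain l where l: "idem l" "rng l = M" using fin_gen_projection[OF L(2)] unfolding L(1) by metis
  have ql: "q * l = l"
  proof (rule mop_eqI)
    fix z
    have "seq (ap l z) \<in> rng q" using l(2) M(2) by (auto simp: rng_def)
    then show "ap (q * l) z = ap l z" using rng_iff[OF q] by simp
  qed
  define e where "e = l * q"
  have qq: "q * q = q" "q * (q * z) = q * z" and ll: "l * l = l" "l * (l * z) = l * z"
    and ql': "q * (l * z) = l * z" for z
    using q l(1) by (simp_all add: idem_def ql flip: mult.assoc)
  have e: "idem e" by (simp add: idem_def e_def mult.assoc ql' ll)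
  have "cls e = cls l" by (rule cls_eqI[OF e l(1), of l e]) (simp_all add: e_def ll mult.assoc ql)
  moreover have "cls p = cls l" using M(3) isomorphic_rng_iff[OF p(1) l(1)] by (simp add: l(2))
  moreover have "cls (e + (q - e)) = cls e + cls (q - e)"
    by (rule cls_orthogonal_sum) (use e in \<open>simp_all add: idem_def e_def algebra_simps qq ql ql' ll\<close>)
  ultimately show "\<exists>c. cls q = cls p + c" by auto
next
  assume "\<exists>c. cls q = cls p + c"
  then obtain r where r: "idem r" "cls q = cls p + cls r" by (metis cls_cases)
  then have "cls (oplus p r) = cls q" using p by (simp add: cls_oplus)
  then obtain u v where uv: "u * v = oplus p r" "v * u = q"
    using cls_eq_iff[OF idem_oplus[OF p(1) r(1)] q] unfolding mvn_def by blast
  have pp: "p * p = p" "p * (p * z) = p * z" for z using p(1) by (simp_all add: idem_def flip: mult.assoc)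
  define a where "a = q * v * even_in * p"
  define b where "b = p * even_out * u * q"
  have qv: "q * v = v * oplus p r" "u * q = oplus p r * u" by (simp_all add: mult.assoc flip: uv)
  have ba: "b * a = p"
  proof -
    have "b * a = p * even_out * (u * q * q * v) * even_in * p" by (simp add: a_def b_def mult.assoc)
    also have "u * q * q * v = u * v * (u * v) * (u * v)" by (simp add: mult.assoc flip: uv(2))
    also have "\<dots> = oplus p r" using idem_oplus[OF p(1) r(1)] by (simp add: uv idem_def)
    finally show ?thesis by (simp add: oplus_def mat_def algebra_simps pp)
  qed
  define l where "l = a * b"
  have l: "idem l"
  proof -
    have "l * l = a * (b * a) * b" by (simp add: l_def mult.assoc)
    also have "\<dots> = l" unfolding ba by (simp add: l_def a_def mult.assoc pp)
    finally show ?thesis by (simp add: idem_def)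
  qed
  have "cls p = cls l" by (rule cls_eqI[OF p(1) l, of b a]) (simp_all add: ba l_def)
  moreover have "rng l \<subseteq> rng q"
  proof -
    have "q * l = l" using q by (simp add: l_def a_def idem_def flip: mult.assoc)
    then have "ap q (ap l z) = ap l z" for z by (simp flip: ap_mult)
    then show ?thesis by (auto simp: rng_def image_iff) metis
  qed
  ultimately show "rng p \<preceq>\<^sub>H rng q"
    unfolding embeds_in_def using closed_submodule_rng[OF l] isomorphic_rng_iff[OF p(1) l] by blast
qed

section \<open>Decompositions and outer inverses\<close>

definition represents :: "'a::cstar_algebra mop \<Rightarrow> ((nat \<Rightarrow> 'a) \<Rightarrow> (nat \<Rightarrow> 'a)) \<Rightarrow> bool" where
  "represents T F \<longleftrightarrow> (\<forall>x. F (seq x) = seq (ap T x))"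

lemma ex_represents: assumes "bounded_module_map F HA HA" obtains T where "represents T F"
proof -
  have i: "idem (1 :: 'a mop)" by (simp add: idem_def)
  have "rng (1 :: 'a mop) = HA" by (simp add: rng_def HA_eq)
  then obtain U where "\<And>z. seq (ap U z) = F (seq (ap 1 z))"
    using op_of_map_on_rng[OF i, of F HA] assms by auto
  then have "represents U F" unfolding represents_def by simp
  then show thesis by (rule that)
qed

text \<open>\<open>G\<close> is the inverse of \<open>F\<close> on \<open>M\<^sub>1\<close>, preceded by the projection onto \<open>M\<^sub>2\<close> along \<open>N\<^sub>2\<close>.\<close>

lemma decomposition_iff_outer_inverse:
  fixes T :: "'a::cstar_algebra mop"
  assumes T: "represents T F"
  shows "(\<exists>M1 M2. decomposition F M1 N1 M2 N2) \<longleftrightarrow>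
    (\<exists>G. G * T * G = G \<and> N1 = rng (1 - G * T) \<and> N2 = rng (1 - T * G))"
proof
  assume "\<exists>M1 M2. decomposition F M1 N1 M2 N2"
  then obtain M1 M2 where d: "decomposition F M1 N1 M2 N2" by blast
  obtain p where p: "idem p" "M1 = rng p" "N1 = rng (1 - p)"
    by (rule projection_of_direct_sum[of M1 N1]) (use d in \<open>auto simp: decomposition_def\<close>)
  obtain q where q: "idem q" "M2 = rng q" "N2 = rng (1 - q)"
    by (rule projection_of_direct_sum[of M2 N2]) (use d in \<open>auto simp: decomposition_def\<close>)
  have F: "F (seq x) = seq (ap T x)" for x using T by (simp add: represents_def)
  define g where "g = inv_into (rng p) F"
  have bg: "bounded_module_map g (rng q) (rng p)" and bij: "bij_betw F (rng p) (rng q)"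
    using d unfolding decomposition_def module_iso_def p q g_def by auto
  have N: "F ` rng (1 - p) \<subseteq> rng (1 - q)" using d unfolding decomposition_def p q by blast
  obtain G where G: "\<And>z. seq (ap G z) = g (seq (ap q z))"
    using op_of_map_on_rng[OF q(1) bg rng_subset_HA] by blast
  have rp: "seq (ap p z) \<in> rng p" and rq: "seq (ap q z) \<in> rng q" for z by (auto simp: rng_def)
  have qT: "q * T = T * p"
  proof (rule mop_eqI)
    fix z
    have "F (seq (ap p z)) \<in> rng q" using bij rp unfolding bij_betw_def by blast
    then have 1: "ap q (ap T (ap p z)) = ap T (ap p z)" by (simp add: F rng_iff[OF q(1)])
    have "F (seq (ap (1 - p) z)) \<in> rng (1 - q)" using N by (auto simp: rng_def)
    then have "ap T (ap (1 - p) z) \<in> range (ap (1 - q))" by (auto simp: F rng_def)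
    then obtain y where "ap T (ap (1 - p) z) = ap (1 - q) y" by blast
    then have "ap q (ap T (ap (1 - p) z)) = ap (q * (1 - q)) y" by simp
    also have "q * (1 - q) = 0" using q(1) by (simp add: idem_def algebra_simps)
    finally have 2: "ap q (ap T (ap (1 - p) z)) = 0" by simp
    have "ap q (ap T z) = ap q (ap T (ap p z)) + ap q (ap T (ap (1 - p) z))"
      by (simp add: ap_diff_mop ap_diff)
    then show "ap (q * T) z = ap (T * p) z" using 1 2 by simp
  qed
  have GT: "G * T = p"
  proof (rule mop_eqI)
    fix z
    have "seq (ap G (ap T z)) = g (seq (ap (q * T) z))" by (simp add: G)
    also have "\<dots> = g (F (seq (ap p z)))" by (simp add: qT F)
    also have "\<dots> = seq (ap p z)" unfolding g_def using bij rp by (simp add: bij_betw_inv_into_left)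
    finally show "ap (G * T) z = ap p z" by simp
  qed
  have TG: "T * G = q"
  proof (rule mop_eqI)
    fix z
    have "seq (ap (T * G) z) = F (g (seq (ap q z)))" by (simp add: F[symmetric] G)
    also have "\<dots> = seq (ap q z)" unfolding g_def using bij rq by (simp add: bij_betw_inv_into_right)
    finally show "ap (T * G) z = ap q z" by simp
  qed
  have "p * G = G"
  proof (rule mop_eqI)
    fix z
    have "seq (ap G z) \<in> rng p" unfolding G using bg rq unfolding bounded_module_map_def by blast
    then show "ap (p * G) z = ap G z" by (simp add: rng_iff[OF p(1)])
  qed
  then have "G * T * G = G" by (simp add: GT)
  then show "\<exists>G. G * T * G = G \<and> N1 = rng (1 - G * T) \<and> N2 = rng (1 - T * G)"
    using p q GT TG by metis
next
  assume "\<exists>G. G * T * G = G \<and> N1 = rng (1 - G * T) \<and> N2 = rng (1 - T * G)"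
  then obtain G where G: "G * T * G = G" and N: "N1 = rng (1 - G * T)" "N2 = rng (1 - T * G)" by blast
  note i = outer_inverse_idem[OF G]
  have F: "F (seq x) = seq (ap T x)" for x using T by (simp add: represents_def)
  have g: "ap G (ap T (ap G z)) = ap G z" for z using G by (simp flip: ap_mult mult.assoc)
  have "module_iso F (rng (G * T)) (rng (T * G))"
    unfolding rng_eq[OF i(3)] rng_eq[OF i(4)]
    by (rule module_iso_op[where S = G, OF F csub_fix[OF i(3)] csub_fix[OF i(4)]]) (auto simp: g)
  moreover have "F ` rng (1 - G * T) \<subseteq> rng (1 - T * G)"
  proof -
    have "T * (1 - G * T) = (1 - T * G) * T" by (simp add: algebra_simps)
    then have "ap T (ap (1 - G * T) z) = ap (1 - T * G) (ap T z)" for z by (metis ap_mult)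
    then show ?thesis by (auto simp: rng_def F)
  qed
  ultimately have "decomposition F (rng (G * T)) N1 (rng (T * G)) N2"
    unfolding decomposition_def N using i closed_submodule_rng direct_sum_rng by blast
  then show "\<exists>M1 M2. decomposition F M1 N1 M2 N2" by blast
qed

section \<open>The index as a stable class\<close>

text \<open>Equality in the Grothendieck group of the finitely generated classes.\<close>

definition stably_eq :: "'a::cstar_algebra vcls \<Rightarrow> 'a vcls \<Rightarrow> bool" where
  "stably_eq a b \<longleftrightarrow> (\<exists>r\<in>fincls. a + r = b + r)"

lemma stably_eq_refl: "stably_eq a a" unfolding stably_eq_def using fincls_0 by blast

lemma stably_eq_sym: "stably_eq a b \<Longrightarrow> stably_eq b a" unfolding stably_eq_def by metis

lemma stably_eq_add:
  assumes "stably_eq a b" "stably_eq c d" shows "stably_eq (a + c) (b + d)"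
proof -
  obtain r s where r: "r \<in> fincls" "a + r = b + r" and s: "s \<in> fincls" "c + s = d + s"
    using assms unfolding stably_eq_def by blast
  have "(a + c) + (r + s) = (a + r) + (c + s)" by (simp add: add_ac)
  also have "\<dots> = (b + d) + (r + s)" unfolding r(2) s(2) by (simp add: add_ac)
  finally show ?thesis unfolding stably_eq_def using r s fincls_add by blast
qed

lemma stably_eq_cancel:
  assumes "stably_eq (a + c) (b + c)" "c \<in> fincls" shows "stably_eq a b"
proof -
  obtain r where "r \<in> fincls" "a + (c + r) = b + (c + r)"
    using assms(1) unfolding stably_eq_def by (auto simp: add.assoc)
  then show ?thesis unfolding stably_eq_def using assms(2) fincls_add by blast
qed

text \<open>Meaningful for ranges of idempotents; by \<open>modcls_rng\<close> the choice does not matter.\<close>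

definition modcls :: "(nat \<Rightarrow> 'a::cstar_algebra) set \<Rightarrow> 'a vcls" where
  "modcls M = cls (SOME p. idem p \<and> M = rng p)"

lemma modcls_rng: assumes p: "idem p" shows "modcls (rng p) = cls p"
proof -
  define q where "q = (SOME q. idem q \<and> rng p = rng q)"
  have "\<exists>q. idem q \<and> rng p = rng q" using p by blast
  then have q: "idem q" "rng p = rng q" unfolding q_def by (rule someI2_ex, simp)+
  have "rng p \<cong>\<^sub>H rng p" using isomorphic_rng_iff[OF p p] by simp
  then have "rng p \<cong>\<^sub>H rng q" using q(2) by simp
  then show ?thesis using isomorphic_rng_iff[OF p q(1)] unfolding modcls_def q_def[symmetric] by simp
qed

lemma fgE:
  assumes "fg_closed_submodule M" obtains p where "idem p" "p \<in> fin_ops" "M = rng p" "modcls M = cls p"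
  using assms modcls_rng unfolding fg_closed_submodule_iff by blast

lemma modcls_fincls: "fg_closed_submodule M \<Longrightarrow> modcls M \<in> fincls"
  by (elim fgE) (simp add: cls_in_fincls_iff)

lemma fincls_modcls: assumes "a \<in> fincls" obtains M where "fg_closed_submodule M" "modcls M = a"
  using assms modcls_rng unfolding fincls_def fg_closed_submodule_iff by blast

lemma modcls_iso: "fg_closed_submodule M \<Longrightarrow> fg_closed_submodule N \<Longrightarrow> M \<cong>\<^sub>H N \<longleftrightarrow> modcls M = modcls N"
  by (elim fgE) (simp add: isomorphic_rng_iff)

lemma modcls_ext_sum:
  assumes "fg_closed_submodule M" "fg_closed_submodule N"
  shows "fg_closed_submodule (M \<oplus>\<^sub>H N)" "modcls (M \<oplus>\<^sub>H N) = modcls M + modcls N"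
proof -
  obtain p where p: "idem p" "p \<in> fin_ops" "M = rng p" "modcls M = cls p" using assms(1) by (rule fgE)
  obtain q where q: "idem q" "q \<in> fin_ops" "N = rng q" "modcls N = cls q" using assms(2) by (rule fgE)
  have s: "M \<oplus>\<^sub>H N = rng (oplus p q)" using p q by (simp add: rng_oplus)
  have "cls (oplus p q) \<in> fincls"
    using p q by (simp add: cls_oplus fincls_add cls_in_fincls_iff)
  then have "oplus p q \<in> fin_ops" using p q by (simp add: cls_in_fincls_iff idem_oplus)
  then show "fg_closed_submodule (M \<oplus>\<^sub>H N)" unfolding fg_closed_submodule_iff s using p q idem_oplus by blast
  show "modcls (M \<oplus>\<^sub>H N) = modcls M + modcls N" unfolding s using p q by (simp add: modcls_rng idem_oplus cls_oplus)
qed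

lemma fg_zero: "fg_closed_submodule ({0} :: (nat \<Rightarrow> 'a::cstar_algebra) set)" "modcls ({0} :: (nat \<Rightarrow> 'a) set) = 0"
proof -
  have "{0} = rng (0 :: 'a mop)" by (auto simp: rng_def seq_0)
  then show "fg_closed_submodule ({0} :: (nat \<Rightarrow> 'a) set)"
    unfolding fg_closed_submodule_iff by (intro exI[of _ 0]) simp
  show "modcls ({0} :: (nat \<Rightarrow> 'a) set) = 0"
    unfolding \<open>{0} = rng 0\<close> using cls_0 by (simp add: modcls_rng)
qed

lemma K0_diff_iff:
  assumes P: "fg_closed_submodule P" and Q: "fg_closed_submodule Q"
  shows "(P', Q') \<in> K0_diff P Q \<longleftrightarrow>
    fg_closed_submodule P' \<and> fg_closed_submodule Q' \<and> stably_eq (modcls P + modcls Q') (modcls P' + modcls Q)"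
proof -
  have "(\<exists>R. fg_closed_submodule R \<and> P \<oplus>\<^sub>H Q' \<oplus>\<^sub>H R \<cong>\<^sub>H P' \<oplus>\<^sub>H Q \<oplus>\<^sub>H R) \<longleftrightarrow>
      stably_eq (modcls P + modcls Q') (modcls P' + modcls Q)"
    if P': "fg_closed_submodule P'" and Q': "fg_closed_submodule Q'"
  proof -
    have "P \<oplus>\<^sub>H Q' \<oplus>\<^sub>H R \<cong>\<^sub>H P' \<oplus>\<^sub>H Q \<oplus>\<^sub>H R \<longleftrightarrow>
        modcls P + modcls Q' + modcls R = modcls P' + modcls Q + modcls R" if R: "fg_closed_submodule R" for R
      by (subst modcls_iso) (simp_all add: modcls_ext_sum P Q P' Q' R add.assoc)
    then show ?thesis unfolding stably_eq_def by (metis fincls_modcls modcls_fincls)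
  qed
  then show ?thesis unfolding K0_diff_def by blast
qed

lemma K0_diff_eq_iff:
  assumes fg: "fg_closed_submodule P" "fg_closed_submodule Q" "fg_closed_submodule P'" "fg_closed_submodule Q'"
  shows "K0_diff P Q = K0_diff P' Q' \<longleftrightarrow> stably_eq (modcls P + modcls Q') (modcls P' + modcls Q)"
proof
  assume "K0_diff P Q = K0_diff P' Q'"
  moreover have "(P', Q') \<in> K0_diff P' Q'" by (simp add: K0_diff_iff fg stably_eq_refl)
  ultimately have "(P', Q') \<in> K0_diff P Q" by simp
  then show "stably_eq (modcls P + modcls Q') (modcls P' + modcls Q)" by (simp add: K0_diff_iff fg)
next
  have sub: "stably_eq (p' + y) (x + q')"
    if "stably_eq (p + q') (p' + q)" "stably_eq (p + y) (x + q)" "p \<in> fincls" "q \<in> fincls"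
    for p q p' q' x y :: "'a vcls"
  proof (rule stably_eq_cancel)
    show "stably_eq ((p' + y) + (p + q)) ((x + q') + (p + q))"
      using stably_eq_add[OF stably_eq_sym[OF that(1)] that(2)] by (simp add: add_ac)
    show "p + q \<in> fincls" using that fincls_add by blast
  qed
  assume s: "stably_eq (modcls P + modcls Q') (modcls P' + modcls Q)"
  have "(X, Y) \<in> K0_diff P Q \<longleftrightarrow> (X, Y) \<in> K0_diff P' Q'" for X Y
    unfolding K0_diff_iff[OF fg(1,2)] K0_diff_iff[OF fg(3,4)]
    using sub[OF s] sub[OF stably_eq_sym[OF s]] fg modcls_fincls by blast
  then show "K0_diff P Q = K0_diff P' Q'" by (auto simp: set_eq_iff)
qed

lemma K0_simps:
  "carrier K0 = {K0_diff P Q | P Q. fg_closed_submodule P \<and> fg_closed_submodule Q}"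
  "X \<otimes>\<^bsub>K0\<^esub> Y = (\<Union>(P, Q)\<in>X. \<Union>(P', Q')\<in>Y. K0_diff (P \<oplus>\<^sub>H P') (Q \<oplus>\<^sub>H Q'))"
  "\<one>\<^bsub>K0\<^esub> = K0_diff {0} {0}"
  by (simp_all add: K0_def)

lemma K0_diff_mult:
  assumes fg: "fg_closed_submodule P" "fg_closed_submodule Q" "fg_closed_submodule P'" "fg_closed_submodule Q'"
  shows "K0_diff P Q \<otimes>\<^bsub>K0\<^esub> K0_diff P' Q' = K0_diff (P \<oplus>\<^sub>H P') (Q \<oplus>\<^sub>H Q')"
proof -
  have eq: "K0_diff (A \<oplus>\<^sub>H A') (B \<oplus>\<^sub>H B') = K0_diff (P \<oplus>\<^sub>H P') (Q \<oplus>\<^sub>H Q')"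
    if "(A, B) \<in> K0_diff P Q" "(A', B') \<in> K0_diff P' Q'" for A B A' B'
  proof -
    have *: "fg_closed_submodule A" "fg_closed_submodule B" "fg_closed_submodule A'" "fg_closed_submodule B'"
      "stably_eq (modcls P + modcls B) (modcls A + modcls Q)" "stably_eq (modcls P' + modcls B') (modcls A' + modcls Q')"
      using that by (auto simp: K0_diff_iff fg)
    from stably_eq_add[OF *(5,6)] show ?thesis
      by (subst K0_diff_eq_iff) (auto simp: modcls_ext_sum fg * add_ac intro: stably_eq_sym)
  qed
  have "(P, Q) \<in> K0_diff P Q" "(P', Q') \<in> K0_diff P' Q'"
    by (simp_all add: K0_diff_iff fg stably_eq_refl)
  then have ne: "K0_diff P Q \<noteq> {}" "K0_diff P' Q' \<noteq> {}" by blast+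
  show ?thesis
    unfolding K0_simps case_prod_unfold by (intro SUP_eq_const ne) (use eq in simp)
qed

lemma K0_class_diff:
  assumes M: "fg_closed_submodule M" and N: "fg_closed_submodule N"
  shows "K0_class M \<otimes>\<^bsub>K0\<^esub> inv\<^bsub>K0\<^esub> K0_class N = K0_diff M N"
proof -
  have "inv\<^bsub>K0\<^esub> K0_class N = K0_diff {0} N"
    unfolding m_inv_def
  proof (rule the_equality)
    have "K0_diff {0} N \<in> carrier K0" unfolding K0_simps using N fg_zero(1) by blast
    moreover have "K0_class N \<otimes>\<^bsub>K0\<^esub> K0_diff {0} N = \<one>\<^bsub>K0\<^esub>" "K0_diff {0} N \<otimes>\<^bsub>K0\<^esub> K0_class N = \<one>\<^bsub>K0\<^esub>"
      unfolding K0_class_def K0_simps(3) K0_diff_mult[OF N fg_zero(1) fg_zero(1) N] K0_diff_mult[OF fg_zero(1) N N fg_zero(1)]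
      by (subst K0_diff_eq_iff; simp add: N fg_zero modcls_ext_sum stably_eq_refl)+
    ultimately show "K0_diff {0} N \<in> carrier K0 \<and> K0_class N \<otimes>\<^bsub>K0\<^esub> K0_diff {0} N = \<one>\<^bsub>K0\<^esub> \<and> K0_diff {0} N \<otimes>\<^bsub>K0\<^esub> K0_class N = \<one>\<^bsub>K0\<^esub>"
      by blast
  next
    fix y assume y: "y \<in> carrier K0 \<and> K0_class N \<otimes>\<^bsub>K0\<^esub> y = \<one>\<^bsub>K0\<^esub> \<and> y \<otimes>\<^bsub>K0\<^esub> K0_class N = \<one>\<^bsub>K0\<^esub>"
    then obtain A B where AB: "fg_closed_submodule A" "fg_closed_submodule B" "y = K0_diff A B"
      unfolding K0_simps(1) by blast
    have "K0_diff (N \<oplus>\<^sub>H A) ({0} \<oplus>\<^sub>H B) = K0_diff {0} {0}"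
      using y unfolding K0_class_def AB(3) K0_diff_mult[OF N fg_zero(1) AB(1,2)] K0_simps(3) by blast
    then have "stably_eq (modcls N + modcls A) (modcls B)"
      using AB N by (simp add: K0_diff_eq_iff modcls_ext_sum fg_zero)
    then show "y = K0_diff {0} N"
      using AB N by (simp add: K0_diff_eq_iff add.commute fg_zero)
  qed
  then show ?thesis
    using M N by (simp add: K0_class_def K0_diff_mult K0_diff_eq_iff modcls_ext_sum stably_eq_refl fg_zero)
qed

section \<open>Fredholm classes of operators\<close>

definition fred :: "'a::cstar_algebra mop \<Rightarrow> 'a mop \<Rightarrow> bool" where
  "fred T G \<longleftrightarrow> G * T * G = G \<and> 1 - G * T \<in> fin_ops \<and> 1 - T * G \<in> fin_ops"

text \<open>These are, in order, the images in \<open>B\<close> of \<open>MPhi_plus\<close>, \<open>MPhi\<close>, \<open>MPhi_0\<close> and \<open>MPhi_tilde_plus_minus\<close>; see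
  \<open>MPhi_plus_iff\<close> and its companions.\<close>

definition op_plus :: "'a::cstar_algebra mop set" where
  "op_plus = {T. \<exists>G. G * T * G = G \<and> 1 - G * T \<in> fin_ops}"
definition op_fred :: "'a::cstar_algebra mop set" where
  "op_fred = {T. \<exists>G. fred T G}"
definition op_zero :: "'a::cstar_algebra mop set" where
  "op_zero = {T. \<exists>G. fred T G \<and> stably_eq (cls (1 - G * T)) (cls (1 - T * G))}"
definition op_minus :: "'a::cstar_algebra mop set" where
  "op_minus = {T. \<exists>G. fred T G \<and> (\<exists>c. cls (1 - T * G) = cls (1 - G * T) + c)}"

lemma fred_iff:
  "fred T G \<longleftrightarrow> G * T * G = G \<and> cls (1 - G * T) \<in> fincls \<and> cls (1 - T * G) \<in> fincls"
  unfolding fred_def using outer_inverse_idem[of G T] by (auto simp: cls_in_fincls_iff)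

lemma fred_fincls:
  assumes "fred T G" shows "cls (1 - G * T) \<in> fincls" "cls (1 - T * G) \<in> fincls"
  using assms unfolding fred_iff by auto

lemma fredI:
  assumes "G * T * G = G" "cls (1 - G * T) \<in> fincls" "cls (1 - T * G) \<in> fincls" shows "fred T G"
  using assms unfolding fred_iff by blast

lemma fred_index:
  assumes "fred T G" "fred T G'"
  shows "stably_eq (cls (1 - G * T) + cls (1 - T * G')) (cls (1 - G' * T) + cls (1 - T * G))"
proof -
  obtain r where r: "r \<in> fincls" "r + cls (1 - G * T) + cls (1 - T * G') = r + cls (1 - G' * T) + cls (1 - T * G)"
    using index_independent[of G T G'] assms unfolding fred_def by blast
  then show ?thesis unfolding stably_eq_def by (intro bexI[of _ r]) (simp_all add: add_ac)
qed

lemma op_zero_any: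
  assumes "T \<in> op_zero" "fred T G" shows "stably_eq (cls (1 - G * T)) (cls (1 - T * G))"
proof -
  obtain H where H: "fred T H" "stably_eq (cls (1 - H * T)) (cls (1 - T * H))"
    using assms(1) unfolding op_zero_def by blast
  have "stably_eq (cls (1 - G * T) + (cls (1 - T * H) + cls (1 - H * T))) (cls (1 - T * G) + (cls (1 - T * H) + cls (1 - H * T)))"
    using stably_eq_add[OF fred_index[OF assms(2) H(1)] H(2)] by (simp add: add_ac)
  then show ?thesis by (rule stably_eq_cancel) (use H fred_fincls fincls_add in blast)
qed

lemma fred_enlarge:
  assumes "fred T G" "r \<in> fincls"
  obtains G' where "fred T G'" "cls (1 - G' * T) = cls (1 - G * T) + r" "cls (1 - T * G') = cls (1 - T * G) + r"
proof -
  obtain p where p: "idem p" "r = cls p" using assms(2) unfolding fincls_def by blast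
  obtain G' where G': "G' * T * G' = G'" "cls (1 - G' * T) = cls (1 - G * T) + r" "cls (1 - T * G') = cls (1 - T * G) + r"
    using enlarge_outer_inverse[of G T p] assms(1) p unfolding fred_def by metis
  then have "fred T G'" using fred_fincls[OF assms(1)] assms(2) by (intro fredI) (simp_all add: fincls_add)
  then show thesis using that G' by blast
qed

text \<open>If kernel and cokernel are stably isomorphic, the summand that makes them isomorphic can be added to both
  by enlarging the decomposition.\<close>

lemma op_zero_subset_op_minus: "op_zero \<subseteq> op_minus"
proof
  fix T :: "'a mop" assume "T \<in> op_zero"
  then obtain G r where G: "fred T G" "r \<in> fincls" "cls (1 - G * T) + r = cls (1 - T * G) + r"
    unfolding op_zero_def stably_eq_def by blast
  obtain G' where "fred T G'" "cls (1 - G' * T) = cls (1 - G * T) + r" "cls (1 - T * G') = cls (1 - T * G) + r"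
    using fred_enlarge[OF G(1,2)] by blast
  then have "fred T G' \<and> cls (1 - T * G') = cls (1 - G' * T) + 0" using G(3) by simp
  then show "T \<in> op_minus" unfolding op_minus_def by blast
qed

lemma op_subsets: "op_minus \<subseteq> op_fred" "op_fred \<subseteq> op_plus"
  unfolding op_minus_def op_fred_def op_plus_def fred_def by blast+

text \<open>The relation that \<open>outer_inverse_perturb\<close> establishes between \<open>(T, G)\<close> and its perturbations. Anything
  that depends only on the kernel and cokernel classes is preserved by it, hence is an open condition.\<close>

definition cognate :: "'a::cstar_algebra mop \<Rightarrow> 'a mop \<Rightarrow> 'a mop \<Rightarrow> 'a mop \<Rightarrow> bool" where
  "cognate T G T' G' \<longleftrightarrow> G' * T' * G' = G' \<and>
     cls (1 - G' * T') = cls (1 - G * T) \<and> cls (1 - T' * G') = cls (1 - T * G)"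

lemma open_if_cognate_closed:
  fixes X :: "'a::cstar_algebra mop set"
  assumes "\<And>T. T \<in> X \<Longrightarrow> \<exists>G. G * T * G = G \<and> (\<forall>T' G'. cognate T G T' G' \<longrightarrow> T' \<in> X)"
  shows "open X"
  unfolding open_dist
proof
  fix T assume "T \<in> X"
  from assms[OF this] obtain G where G: "G * T * G = G" and X: "\<And>T' G'. cognate T G T' G' \<Longrightarrow> T' \<in> X"
    by blast
  have n: "norm G + 1 > 0" by (simp add: add_nonneg_pos)
  have "T' \<in> X" if "dist T' T < 1 / (norm G + 1)" for T'
  proof -
    have "norm (T' - T) * norm G \<le> norm (T' - T) * (norm G + 1)" by (intro mult_left_mono) auto
    also have "\<dots> < 1" using that n by (simp add: dist_norm pos_less_divide_eq)
    finally show ?thesis using outer_inverse_perturb[OF G] X unfolding cognate_def by metis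
  qed
  then show "\<exists>e>0. \<forall>T'. dist T' T < e \<longrightarrow> T' \<in> X" using n by (intro exI[of _ "1 / (norm G + 1)"]) auto
qed

lemma cognate_fin_ops:
  assumes "G * T * G = G" "cognate T G T' G'"
  shows "1 - G' * T' \<in> fin_ops \<longleftrightarrow> 1 - G * T \<in> fin_ops" "1 - T' * G' \<in> fin_ops \<longleftrightarrow> 1 - T * G \<in> fin_ops"
  using outer_inverse_idem[of G T] outer_inverse_idem[of G' T'] assms cls_in_fincls_iff unfolding cognate_def by metis+

lemma cognate_fred: "fred T G \<Longrightarrow> cognate T G T' G' \<Longrightarrow> fred T' G'"
  unfolding cognate_def by (intro fredI) (simp_all add: fred_fincls)

lemma open_op_plus: "open op_plus"
proof (rule open_if_cognate_closed)
  fix T :: "'a mop" assume "T \<in> op_plus"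
  then obtain G where G: "G * T * G = G" "1 - G * T \<in> fin_ops" unfolding op_plus_def by blast
  have "T' \<in> op_plus" if "cognate T G T' G'" for T' G'
    using cognate_fin_ops(1)[OF G(1) that] G(2) that unfolding op_plus_def cognate_def by blast
  with G(1) show "\<exists>G. G * T * G = G \<and> (\<forall>T' G'. cognate T G T' G' \<longrightarrow> T' \<in> op_plus)" by blast
qed

lemma open_op_zero: "open op_zero"
proof (rule open_if_cognate_closed)
  fix T :: "'a mop" assume "T \<in> op_zero"
  then obtain G where G: "fred T G" "stably_eq (cls (1 - G * T)) (cls (1 - T * G))" unfolding op_zero_def by blast
  have "T' \<in> op_zero" if "cognate T G T' G'" for T' G'
    using cognate_fred[OF G(1) that] G(2) that unfolding op_zero_def cognate_def by auto
  with G(1) show "\<exists>G. G * T * G = G \<and> (\<forall>T' G'. cognate T G T' G' \<longrightarrow> T' \<in> op_zero)"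
    unfolding fred_def by blast
qed

lemma op_minusI: "fred T G \<Longrightarrow> cls (1 - T * G) = cls (1 - G * T) + c \<Longrightarrow> T \<in> op_minus"
  unfolding op_minus_def by blast

lemma open_op_minus: "open op_minus"
proof (rule open_if_cognate_closed)
  fix T :: "'a mop" assume "T \<in> op_minus"
  then obtain G c where G: "fred T G" "cls (1 - T * G) = cls (1 - G * T) + c" unfolding op_minus_def by blast
  have "T' \<in> op_minus" if "cognate T G T' G'" for T' G'
    by (rule op_minusI[OF cognate_fred[OF G(1) that]]) (use G(2) that in \<open>simp add: cognate_def\<close>)
  with G(1) show "\<exists>G. G * T * G = G \<and> (\<forall>T' G'. cognate T G T' G' \<longrightarrow> T' \<in> op_minus)"
    unfolding fred_def by blast
qed

text \<open>Perturbation preserves that the cokernel is not finitely generated for one outer inverse, and by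
  \<open>cokernel_fin_ops_transfer\<close> this excludes all Fredholm decompositions.\<close>

lemma open_op_plus_minus_op_fred: "open (op_plus - op_fred)"
proof (rule open_if_cognate_closed)
  fix T :: "'a mop" assume "T \<in> op_plus - op_fred"
  then obtain G where G: "G * T * G = G" "1 - G * T \<in> fin_ops" "1 - T * G \<notin> fin_ops"
    unfolding op_plus_def op_fred_def fred_def by blast
  have "T' \<in> op_plus - op_fred" if G': "cognate T G T' G'" for T' G'
  proof -
    have n: "1 - G' * T' \<in> fin_ops" "1 - T' * G' \<notin> fin_ops"
      using cognate_fin_ops[OF G(1) G'] G by blast+
    moreover have "T' \<notin> op_fred"
    proof
      assume "T' \<in> op_fred"
      then obtain H where "fred T' H" unfolding op_fred_def by blast
      then show False using cokernel_fin_ops_transfer[of T' H G'] n unfolding fred_def by blast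
    qed
    ultimately show ?thesis unfolding op_plus_def using G' cognate_def by blast
  qed
  with G(1) show "\<exists>G. G * T * G = G \<and> (\<forall>T' G'. cognate T G T' G' \<longrightarrow> T' \<in> op_plus - op_fred)" by blast
qed

text \<open>The index is locally constant: if it does not vanish at \<open>T\<close>, it does not vanish nearby.\<close>

lemma open_op_minus_minus_op_zero: "open (op_minus - op_zero)"
proof (rule open_if_cognate_closed)
  fix T :: "'a mop" assume T: "T \<in> op_minus - op_zero"
  then obtain G c where G: "fred T G" "cls (1 - T * G) = cls (1 - G * T) + c" unfolding op_minus_def by blast
  have n: "\<not> stably_eq (cls (1 - G * T)) (cls (1 - T * G))" using T G unfolding op_zero_def by blast
  have "T' \<in> op_minus - op_zero" if G': "cognate T G T' G'" for T' G'
  proof -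
    have f: "fred T' G'" by (rule cognate_fred[OF G(1) G'])
    have "T' \<in> op_minus" by (rule op_minusI[OF f]) (use G(2) G' in \<open>simp add: cognate_def\<close>)
    moreover have "T' \<notin> op_zero"
    proof
      assume "T' \<in> op_zero"
      from op_zero_any[OF this f] n show False using G' by (simp add: cognate_def)
    qed
    ultimately show ?thesis by blast
  qed
  with G(1) show "\<exists>G. G * T * G = G \<and> (\<forall>T' G'. cognate T G T' G' \<longrightarrow> T' \<in> op_minus - op_zero)"
    unfolding fred_def by blast
qed

text \<open>Let \<open>N\<^sub>1, N\<^sub>2\<close> be the kernel and cokernel classes of a Fredholm operator \<open>T\<close>, hence also of a nearby
  \<open>T'\<close>, and suppose that \<open>T'\<close> has others with \<open>N\<^sub>2' = N\<^sub>1' + c\<close>. Equality of the index gives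
  \<open>N\<^sub>1 + N\<^sub>1' + c + r = N\<^sub>1' + N\<^sub>2 + r\<close> with \<open>r\<close> finitely generated, so after enlarging the decomposition of \<open>T\<close> by
  \<open>N\<^sub>1' + r\<close> the kernel embeds in the cokernel.\<close>

lemma open_op_fred_minus_op_minus: "open (op_fred - op_minus)"
proof (rule open_if_cognate_closed)
  fix T :: "'a mop" assume T: "T \<in> op_fred - op_minus"
  then obtain G where G: "fred T G" unfolding op_fred_def by blast
  have "T' \<in> op_fred - op_minus" if cog: "cognate T G T' G'" for T' G'
  proof -
    note G' = cog[unfolded cognate_def]
    have f: "fred T' G'" by (rule cognate_fred[OF G cog])
    moreover have "T' \<notin> op_minus"
    proof
      assume "T' \<in> op_minus"
      then obtain H c where H: "fred T' H" "cls (1 - T' * H) = cls (1 - H * T') + c" unfolding op_minus_def by blast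
      obtain r where r: "r \<in> fincls"
        "cls (1 - G' * T') + cls (1 - T' * H) + r = cls (1 - H * T') + cls (1 - T' * G') + r"
        using fred_index[OF f H(1)] unfolding stably_eq_def by blast
      define s where "s = cls (1 - H * T') + r"
      have "s \<in> fincls" unfolding s_def using fred_fincls[OF H(1)] r fincls_add by blast
      then obtain G2 where G2: "fred T G2" "cls (1 - G2 * T) = cls (1 - G * T) + s" "cls (1 - T * G2) = cls (1 - T * G) + s"
        using fred_enlarge[OF G] by blast
      have "cls (1 - T * G2) = cls (1 - H * T') + cls (1 - T' * G') + r"
        using G2(3) G' by (simp add: s_def add_ac)
      also have "\<dots> = cls (1 - G2 * T) + c"
        unfolding r(2)[symmetric] H(2) G2(2) s_def using G' by (simp add: add_ac)
      finally have "T \<in> op_minus" by (rule op_minusI[OF G2(1)])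
      then show False using T by blast
    qed
    ultimately show ?thesis unfolding op_fred_def by blast
  qed
  with G show "\<exists>G. G * T * G = G \<and> (\<forall>T' G'. cognate T G T' G' \<longrightarrow> T' \<in> op_fred - op_minus)"
    unfolding fred_def by blast
qed

section \<open>Spectra\<close>

lemma fin_gen_outer_inverse:
  assumes "G * T * G = G"
  shows "fin_gen (rng (1 - G * T)) \<longleftrightarrow> 1 - G * T \<in> fin_ops" "fin_gen (rng (1 - T * G)) \<longleftrightarrow> 1 - T * G \<in> fin_ops"
  using outer_inverse_idem[OF assms] by (simp_all add: fin_gen_rng_iff)

lemma MPhi_decomposition_iff:
  assumes "represents T F"
  shows "(\<exists>M1 M2. MPhi_decomposition F M1 N1 M2 N2) \<longleftrightarrow> (\<exists>G. fred T G \<and> N1 = rng (1 - G * T) \<and> N2 = rng (1 - T * G))"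
proof -
  have "(\<exists>M1 M2. MPhi_decomposition F M1 N1 M2 N2) \<longleftrightarrow> (\<exists>M1 M2. decomposition F M1 N1 M2 N2) \<and> fin_gen N1 \<and> fin_gen N2"
    unfolding MPhi_decomposition_def by blast
  also have "\<dots> \<longleftrightarrow> (\<exists>G. fred T G \<and> N1 = rng (1 - G * T) \<and> N2 = rng (1 - T * G))"
    unfolding decomposition_iff_outer_inverse[OF assms] fred_def
    using fin_gen_outer_inverse by metis
  finally show ?thesis .
qed

lemma MPhi_plus_iff:
  assumes "F \<in> Ba" "represents T F" shows "F \<in> MPhi_plus \<longleftrightarrow> T \<in> op_plus"
proof -
  have "F \<in> MPhi_plus \<longleftrightarrow> (\<exists>N1 N2. (\<exists>M1 M2. decomposition F M1 N1 M2 N2) \<and> fin_gen N1)"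
    unfolding MPhi_plus_def using assms(1) by blast
  also have "\<dots> \<longleftrightarrow> (\<exists>G. G * T * G = G \<and> fin_gen (rng (1 - G * T)))"
    unfolding decomposition_iff_outer_inverse[OF assms(2)] by blast
  also have "\<dots> \<longleftrightarrow> T \<in> op_plus"
    unfolding op_plus_def mem_Collect_eq using fin_gen_outer_inverse(1) by blast
  finally show ?thesis .
qed

lemma MPhi_iff:
  assumes "F \<in> Ba" "represents T F" shows "F \<in> MPhi \<longleftrightarrow> T \<in> op_fred"
proof -
  have "F \<in> MPhi \<longleftrightarrow> (\<exists>N1 N2. \<exists>M1 M2. MPhi_decomposition F M1 N1 M2 N2)"
    unfolding MPhi_def using assms(1) by blast
  then show ?thesis unfolding MPhi_decomposition_iff[OF assms(2)] op_fred_def by blast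
qed

lemma MPhi_tilde_plus_minus_iff:
  assumes "F \<in> Ba" "represents T F" shows "F \<in> MPhi_tilde_plus_minus \<longleftrightarrow> T \<in> op_minus"
proof -
  have "F \<in> MPhi_tilde_plus_minus \<longleftrightarrow> (\<exists>N1 N2. (\<exists>M1 M2. MPhi_decomposition F M1 N1 M2 N2) \<and> N1 \<preceq>\<^sub>H N2)"
    unfolding MPhi_tilde_plus_minus_def using assms(1) by blast
  also have "\<dots> \<longleftrightarrow> (\<exists>G. fred T G \<and> rng (1 - G * T) \<preceq>\<^sub>H rng (1 - T * G))"
    unfolding MPhi_decomposition_iff[OF assms(2)] by blast
  also have "\<dots> \<longleftrightarrow> T \<in> op_minus"
  proof -
    have "rng (1 - G * T) \<preceq>\<^sub>H rng (1 - T * G) \<longleftrightarrow> (\<exists>c. cls (1 - T * G) = cls (1 - G * T) + c)" if "fred T G" for G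
      using that outer_inverse_idem[of G T] unfolding fred_def by (intro embeds_rng_iff) auto
    then show ?thesis unfolding op_minus_def by blast
  qed
  finally show ?thesis .
qed

text \<open>Independence of the decomposition makes the description of the index determine a unique element.\<close>

lemma index_eq:
  assumes "represents T F" "fred T G" shows "index F = K0_diff (rng (1 - G * T)) (rng (1 - T * G))"
proof -
  have fg: "fg_closed_submodule (rng (1 - H * T))" "fg_closed_submodule (rng (1 - T * H))"
    "modcls (rng (1 - H * T)) = cls (1 - H * T)" "modcls (rng (1 - T * H)) = cls (1 - T * H)" if H: "fred T H" for H
  proof -
    have i: "idem (1 - H * T)" "idem (1 - T * H)" using H outer_inverse_idem unfolding fred_def by blast+
    show "fg_closed_submodule (rng (1 - H * T))" "fg_closed_submodule (rng (1 - T * H))"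
      using H i unfolding fg_closed_submodule_iff fred_def by blast+
    show "modcls (rng (1 - H * T)) = cls (1 - H * T)" "modcls (rng (1 - T * H)) = cls (1 - T * H)"
      using i by (simp_all add: modcls_rng)
  qed
  have "index F = (THE k. \<exists>N1 N2. (\<exists>M1 M2. MPhi_decomposition F M1 N1 M2 N2) \<and>
      k = K0_class N1 \<otimes>\<^bsub>K0\<^esub> inv\<^bsub>K0\<^esub> K0_class N2)"
    unfolding index_def by (rule arg_cong[where f = The]) blast
  also have "\<dots> = (THE k. \<exists>H. fred T H \<and> k = K0_diff (rng (1 - H * T)) (rng (1 - T * H)))"
  proof -
    have "(\<exists>N1 N2. (\<exists>G. fred T G \<and> N1 = rng (1 - G * T) \<and> N2 = rng (1 - T * G)) \<and>
        k = K0_class N1 \<otimes>\<^bsub>K0\<^esub> inv\<^bsub>K0\<^esub> K0_class N2) \<longleftrightarrow>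
        (\<exists>H. fred T H \<and> k = K0_class (rng (1 - H * T)) \<otimes>\<^bsub>K0\<^esub> inv\<^bsub>K0\<^esub> K0_class (rng (1 - T * H)))" for k
      by blast
    also have "\<dots> k \<longleftrightarrow> (\<exists>H. fred T H \<and> k = K0_diff (rng (1 - H * T)) (rng (1 - T * H)))" for k
      using K0_class_diff[OF fg(1,2)] by auto
    finally show ?thesis unfolding MPhi_decomposition_iff[OF assms(1)] by simp
  qed
  also have "\<dots> = K0_diff (rng (1 - G * T)) (rng (1 - T * G))"
  proof (rule the_equality)
    fix k assume "\<exists>H. fred T H \<and> k = K0_diff (rng (1 - H * T)) (rng (1 - T * H))"
    then obtain H where H: "fred T H" "k = K0_diff (rng (1 - H * T)) (rng (1 - T * H))" by blast
    then show "k = K0_diff (rng (1 - G * T)) (rng (1 - T * G))"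
      using fg[OF H(1)] fg[OF assms(2)] fred_index[OF H(1) assms(2)] by (simp add: K0_diff_eq_iff)
  qed (use assms in blast)
  finally show ?thesis .
qed

lemma MPhi_0_iff:
  assumes "F \<in> Ba" "represents T F" shows "F \<in> MPhi_0 \<longleftrightarrow> T \<in> op_zero"
proof -
  have "index F = \<one>\<^bsub>K0\<^esub> \<longleftrightarrow> stably_eq (cls (1 - G * T)) (cls (1 - T * G))" if G: "fred T G" for G
  proof -
    have i: "idem (1 - G * T)" "idem (1 - T * G)" using G outer_inverse_idem unfolding fred_def by blast+
    have fg: "fg_closed_submodule (rng (1 - G * T))" "fg_closed_submodule (rng (1 - T * G))"
      using G i unfolding fg_closed_submodule_iff fred_def by blast+
    show ?thesis
      unfolding index_eq[OF assms(2) G] K0_simps K0_diff_eq_iff[OF fg fg_zero(1) fg_zero(1)]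
      by (simp add: modcls_rng i fg_zero)
  qed
  then show ?thesis unfolding MPhi_0_def op_zero_def using MPhi_iff[OF assms] by (auto simp: op_fred_def)
qed

lemma center_star: "\<alpha> \<in> center \<Longrightarrow> star \<alpha> \<in> center"
proof -
  assume "\<alpha> \<in> center"
  then have "star (star b * \<alpha>) = star (\<alpha> * star b)" for b by (simp add: center_def)
  then show ?thesis by (simp add: center_def star_mult star_star)
qed

lemma ex_scal: 
  assumes "\<alpha> \<in> center" shows "\<exists>T. \<forall>x. ap T x = rmul x \<alpha>"
proof -
  obtain T where "\<And>x. ap T x = rmul x \<alpha>"
  proof (rule ex_mop[of "\<lambda>x. rmul x \<alpha>" "norm \<alpha>"])
    fix x :: "'a hil" and a
    show "rmul (rmul x a) \<alpha> = rmul (rmul x \<alpha>) a" using assms by (simp add: rmul_rmul center_def)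
    show "norm (rmul x \<alpha>) \<le> norm \<alpha> * norm x" using norm_rmul_le[of x \<alpha>] by (simp add: mult.commute)
  qed (use that in \<open>auto simp: rmul_add_left\<close>)
  then show ?thesis by blast
qed

text \<open>Right multiplication by \<open>\<alpha>\<close>; it is a module operator only for central \<open>\<alpha>\<close>.\<close>

definition scal :: "'a::cstar_algebra \<Rightarrow> 'a mop" where
  "scal \<alpha> = (SOME T. \<forall>x. ap T x = rmul x \<alpha>)"

lemma ap_scal: "\<alpha> \<in> center \<Longrightarrow> ap (scal \<alpha>) x = rmul x \<alpha>"
  unfolding scal_def using someI_ex[OF ex_scal] by blast

lemma continuous_on_scal: "continuous_on center scal"
proof (rule continuous_onI)
  fix \<alpha> :: 'a and e :: real assume \<alpha>: "\<alpha> \<in> center" and e: "e > 0"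
  have "dist (scal \<beta>) (scal \<alpha>) \<le> dist \<beta> \<alpha>" if \<beta>: "\<beta> \<in> center" for \<beta>
    unfolding dist_norm
  proof (rule norm_mop_le)
    fix x :: "'a hil"
    have "ap (scal \<beta> - scal \<alpha>) x = rmul x (\<beta> - \<alpha>)"
      using rmul_add_right[of x "\<beta> - \<alpha>" \<alpha>] by (simp add: ap_diff_mop ap_scal \<alpha> \<beta>)
    then show "norm (ap (scal \<beta> - scal \<alpha>) x) \<le> norm (\<beta> - \<alpha>) * norm x"
      using norm_rmul_le[of x "\<beta> - \<alpha>"] by (simp add: mult.commute)
  qed simp
  then show "\<exists>d>0. \<forall>x'\<in>center. dist x' \<alpha> < d \<longrightarrow> dist (scal x') (scal \<alpha>) \<le> e"
    using e by (intro exI[of _ e]) (force intro: order_trans)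
qed

lemma represents_bounded_module_map: assumes "represents T F" shows "bounded_module_map F HA HA"
  unfolding HA_eq by (rule bounded_module_map_op[of F T])
    (use assms in \<open>auto simp: represents_def csub_def\<close>)

lemma shift_op_represents:
  assumes "represents T F" "\<alpha> \<in> center" shows "represents (T - scal \<alpha>) (shift_op F \<alpha>)"
  using assms by (simp add: represents_def shift_op_def ap_diff_mop ap_scal seq_minus[symmetric] seq_rmul')

lemma Ba_iff: "F \<in> Ba \<longleftrightarrow> (\<exists>T S. represents T F \<and> (\<forall>x y. ip (ap T x) y = ip x (ap S y)))"
proof
  assume "F \<in> Ba"
  then obtain G where F: "bounded_module_map F HA HA" and G: "bounded_module_map G HA HA"
    and adj: "\<And>x y. x \<in> HA \<Longrightarrow> y \<in> HA \<Longrightarrow> hinner (F x) y = hinner x (G y)" unfolding Ba_def by blast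
  obtain T where T: "represents T F" using F by (rule ex_represents)
  obtain S where S: "represents S G" using G by (rule ex_represents)
  have "ip (ap T x) y = ip x (ap S y)" for x y
    using adj[of "seq x" "seq y"] T S by (simp add: represents_def ip.rep_eq)
  then show "\<exists>T S. represents T F \<and> (\<forall>x y. ip (ap T x) y = ip x (ap S y))" using T by blast
next
  assume "\<exists>T S. represents T F \<and> (\<forall>x y. ip (ap T x) y = ip x (ap S y))"
  then obtain T S where T: "represents T F" and adj: "\<And>x y. ip (ap T x) y = ip x (ap S y)" by blast
  define G where "G z = seq (ap S (hil z))" for z
  have G: "represents S G" by (simp add: represents_def G_def)
  have "hinner (F (seq x)) (seq y) = hinner (seq x) (G (seq y))" for x y
    using adj[of x y] T G by (simp add: represents_def ip.rep_eq)
  then have "\<forall>x\<in>HA. \<forall>y\<in>HA. hinner (F x) y = hinner x (G y)" unfolding HA_eq by blast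
  then show "F \<in> Ba" unfolding Ba_def using represents_bounded_module_map[OF T] represents_bounded_module_map[OF G] by blast
qed

lemma ip_diff_left: "ip (x - y) z = ip x z - ip y z"
  using ip_add_left[of "x - y" y z] by simp

lemma shift_op_Ba: assumes F: "F \<in> Ba" and \<alpha>: "\<alpha> \<in> center" shows "shift_op F \<alpha> \<in> Ba"
proof -
  obtain T S where T: "represents T F" and adj: "\<And>x y. ip (ap T x) y = ip x (ap S y)" using F unfolding Ba_iff by blast
  have "ip (ap (T - scal \<alpha>) x) y = ip x (ap (S - scal (star \<alpha>)) y)" for x y
    using center_star[OF \<alpha>] \<alpha>
    by (simp add: ap_diff_mop ap_scal ip_diff_left ip_diff_right adj ip_rmul_left ip_rmul_right) (simp add: center_def)
  then show ?thesis unfolding Ba_iff using shift_op_represents[OF T \<alpha>] by blast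
qed

text \<open>A boundary point of \<open>A\<close> in \<open>B\<close> would have the neighbourhood \<open>B - A\<close>, which does not meet \<open>A\<close>.\<close>

lemma frontier_of_complement_subset:
  assumes A: "openin X A" and B: "openin X B" and AB: "A \<subseteq> B" and d: "openin X (B - A)"
  shows "X frontier_of (topspace X - A) \<subseteq> X frontier_of (topspace X - B)"
proof
  fix x assume "x \<in> X frontier_of (topspace X - A)"
  then have "x \<in> X frontier_of A" by (simp only: frontier_of_complement)
  then have x: "x \<in> X closure_of A" "x \<notin> A" using A by (simp_all add: frontier_of_def interior_of_openin)
  have "x \<in> X closure_of B" using x closure_of_mono[OF AB] by blast
  moreover have "x \<notin> B"
  proof
    assume "x \<in> B"
    then have "x \<in> B - A" using x by blast
    then obtain y where "y \<in> A" "y \<in> B - A" using x(1) d unfolding in_closure_of by blast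
    then show False by blast
  qed
  ultimately have "x \<in> X frontier_of B" using B by (simp add: frontier_of_def interior_of_openin)
  then show "x \<in> X frontier_of (topspace X - B)" by (simp only: frontier_of_complement)
qed

theorem theorem4p3:
  fixes F :: "(nat \<Rightarrow> 'a::cstar_algebra) \<Rightarrow> (nat \<Rightarrow> 'a)"
  assumes "F \<in> Ba"
  shows "boundary (sigma_ew F) \<subseteq> boundary (sigma_ea_tilde F) \<and>
         boundary (sigma_ea_tilde F) \<subseteq> boundary (sigma_ea F) \<and>
         (K0_cancellation TYPE('a) \<longrightarrow> boundary (sigma_ea F) \<subseteq> boundary (sigma_e_alpha F))"
proof -
  obtain T where T: "represents T F" using assms unfolding Ba_iff by blast
  define res where "res X = center \<inter> (\<lambda>\<alpha>. T - scal \<alpha>) -` X" for X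
  have res: "openin (top_of_set center) (res X)" if "open X" for X
    unfolding res_def
    by (rule continuous_openin_preimage_gen[OF _ that]) (intro continuous_intros continuous_on_scal)
  have mono: "boundary (center - res X) \<subseteq> boundary (center - res Y)" if "open X" "open Y" "X \<subseteq> Y" "open (Y - X)" for X Y
  proof -
    have "res Y - res X = res (Y - X)" "res X \<subseteq> res Y" using that(3) by (auto simp: res_def)
    then show ?thesis
      using frontier_of_complement_subset[of "top_of_set center" "res X" "res Y"] res that
      by (simp add: boundary_def)
  qed
  have r: "represents (T - scal \<alpha>) (shift_op F \<alpha>)" "shift_op F \<alpha> \<in> Ba" if "\<alpha> \<in> center" for \<alpha>
    using shift_op_represents[OF T that] shift_op_Ba[OF assms that] by auto
  define op_ea where "op_ea = op_minus \<union> (op_plus - op_fred :: 'a mop set)"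
  note iffs = MPhi_0_iff[OF r(2,1)] MPhi_tilde_plus_minus_iff[OF r(2,1)] MPhi_iff[OF r(2,1)] MPhi_plus_iff[OF r(2,1)]
  have 1: "sigma_ew F = center - res op_zero" by (auto simp: sigma_ew_def res_def iffs)
  have 2: "sigma_ea_tilde F = center - res op_minus" by (auto simp: sigma_ea_tilde_def res_def iffs)
  have 3: "sigma_ea F = center - res op_ea" by (auto simp: sigma_ea_def res_def op_ea_def MPhi_plus_minus_def iffs)
  have 4: "sigma_e_alpha F = center - res op_plus" by (auto simp: sigma_e_alpha_def res_def iffs)
  have o: "open op_ea" unfolding op_ea_def by (intro open_Un open_op_minus open_op_plus_minus_op_fred)
  have d: "op_ea - op_minus = op_plus - op_fred" "op_plus - op_ea = op_fred - op_minus"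
    "op_minus \<subseteq> op_ea" "op_ea \<subseteq> op_plus"
    using op_subsets by (auto simp: op_ea_def)
  have "boundary (center - res op_zero) \<subseteq> boundary (center - res op_minus)"
    by (intro mono open_op_zero open_op_minus op_zero_subset_op_minus open_op_minus_minus_op_zero)
  moreover have "boundary (center - res op_minus) \<subseteq> boundary (center - res op_ea)"
    by (rule mono[OF open_op_minus o d(3)]) (simp add: d open_op_plus_minus_op_fred)
  moreover have "boundary (center - res op_ea) \<subseteq> boundary (center - res op_plus)"
    by (rule mono[OF o open_op_plus d(4)]) (simp add: d open_op_fred_minus_op_minus)
  ultimately show ?thesis unfolding 1 2 3 4 by blast
qed

end
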